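(* The interpolant existence problem for $\mathsf{wK4}$ is \textsc{coNExpTime}-hard.
   Context: $\mathsf{wK4}$ (weak $\mathsf{K4}$) is the normal modal logic $\mathsf{K}\oplus\Diamond\Diamond p\to(p\lor\Diamond p)$, characterised by weakly transitive Kripke frames ($xRyRz$ implies $x=z$ or $xRz$). An interpolant for $\varphi\to\psi$ in $\mathsf{wK4}$ is a formula $\iota$ all of whose variables occur in both $\varphi$ and $\psi$ (built from $\top,\bot$ if there are no common variables) such that $\varphi\to\iota$ and $\iota\to\psi$ belong to $\mathsf{wK4}$. The interpolant existence problem: given formulas $\varphi,\psi$, decide whether $\varphi\to\psi$ has an interpolant in $\mathsf{wK4}$. *)

theory Defs
  imports "HOL-Computational_Algebra.Polynomial"
begin

section \<open>Normal modal logics and interpolants\<close>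

datatype fm = Var nat | Bot | Imp fm fm | Box fm

abbreviation Neg :: "fm \<Rightarrow> fm" where "Neg \<phi> \<equiv> Imp \<phi> Bot"
abbreviation Top :: fm where "Top \<equiv> Neg Bot"
abbreviation Or :: "fm \<Rightarrow> fm \<Rightarrow> fm" where "Or \<phi> \<psi> \<equiv> Imp (Neg \<phi>) \<psi>"
abbreviation And :: "fm \<Rightarrow> fm \<Rightarrow> fm" where "And \<phi> \<psi> \<equiv> Neg (Imp \<phi> (Neg \<psi>))"
abbreviation Dia :: "fm \<Rightarrow> fm" where "Dia \<phi> \<equiv> Neg (Box (Neg \<phi>))"

primrec vars :: "fm \<Rightarrow> nat set" where
  "vars (Var n) = {n}"
| "vars Bot = {}"
| "vars (Imp \<phi> \<psi>) = vars \<phi> \<union> vars \<psi>"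
| "vars (Box \<phi>) = vars \<phi>"

primrec subst :: "(nat \<Rightarrow> fm) \<Rightarrow> fm \<Rightarrow> fm" where
  "subst \<sigma> (Var n) = \<sigma> n"
| "subst \<sigma> Bot = Bot"
| "subst \<sigma> (Imp \<phi> \<psi>) = Imp (subst \<sigma> \<phi>) (subst \<sigma> \<psi>)"
| "subst \<sigma> (Box \<phi>) = Box (subst \<sigma> \<phi>)"

text \<open>Boolean evaluation: variables and boxed formulas are treated as atoms.\<close>

primrec bool_eval :: "(fm \<Rightarrow> bool) \<Rightarrow> fm \<Rightarrow> bool" where
  "bool_eval v (Var n) = v (Var n)"
| "bool_eval v Bot = False"
| "bool_eval v (Imp \<phi> \<psi>) = (bool_eval v \<phi> \<longrightarrow> bool_eval v \<psi>)"
| "bool_eval v (Box \<phi>) = v (Box \<phi>)"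

definition tautology :: "fm \<Rightarrow> bool" where
  "tautology \<phi> \<longleftrightarrow> (\<forall>v. bool_eval v \<phi>)"

text \<open>\<open>K_plus A\<close> is \<open>K \<oplus> A\<close>, the least normal modal logic containing \<open>A\<close>.\<close>

inductive_set K_plus :: "fm set \<Rightarrow> fm set" for A :: "fm set" where
  taut: "tautology \<phi> \<Longrightarrow> \<phi> \<in> K_plus A"
| K: "Imp (Box (Imp \<phi> \<psi>)) (Imp (Box \<phi>) (Box \<psi>)) \<in> K_plus A"
| ax: "\<phi> \<in> A \<Longrightarrow> \<phi> \<in> K_plus A"
| mp: "Imp \<phi> \<psi> \<in> K_plus A \<Longrightarrow> \<phi> \<in> K_plus A \<Longrightarrow> \<psi> \<in> K_plus A"
| nec: "\<phi> \<in> K_plus A \<Longrightarrow> Box \<phi> \<in> K_plus A"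
| sub: "\<phi> \<in> K_plus A \<Longrightarrow> subst \<sigma> \<phi> \<in> K_plus A"

definition wK4 :: "fm set" where
  "wK4 = K_plus {Imp (Dia (Dia (Var 0))) (Or (Var 0) (Dia (Var 0)))}"

definition interpolant :: "fm set \<Rightarrow> fm \<Rightarrow> fm \<Rightarrow> fm \<Rightarrow> bool" where
  "interpolant L \<phi> \<psi> \<iota> \<longleftrightarrow>
     vars \<iota> \<subseteq> vars \<phi> \<inter> vars \<psi> \<and> Imp \<phi> \<iota> \<in> L \<and> Imp \<iota> \<psi> \<in> L"

section \<open>The interpolant existence problem as a language\<close>

type_synonym word = "bool list"

text \<open>Binary representation, least significant digit first; zero is the empty word.\<close>

fun digits :: "nat \<Rightarrow> word" where
  "digits n = (if n = 0 then [] else odd n # digits (n div 2))"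

declare digits.simps [simp del]

text \<open>
  Formulas are written in prefix notation. Each connective is a two-bit token; the digits of
  the index of a variable are each preceded by \<open>True\<close>, and \<open>False\<close> ends the list of digits. The
  code is prefix-free, so a pair of formulas can be coded by concatenation.
\<close>

primrec encode :: "fm \<Rightarrow> word" where
  "encode (Var n) = [False, False] @ concat (map (\<lambda>b. [True, b]) (digits n)) @ [False]"
| "encode Bot = [False, True]"
| "encode (Imp \<phi> \<psi>) = [True, False] @ encode \<phi> @ encode \<psi>"
| "encode (Box \<phi>) = [True, True] @ encode \<phi>"

definition interpolant_existence :: "fm set \<Rightarrow> word set" where
  "interpolant_existence L = {encode \<phi> @ encode \<psi> | \<phi> \<psi>. \<exists>\<iota>. interpolant L \<phi> \<psi> \<iota>}"

lemma digits_inject: "digits m = digits n \<Longrightarrow> m = n"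
proof (induction m arbitrary: n rule: less_induct)
  case (less m)
  show ?case
  proof (cases "m = 0 \<or> n = 0")
    case True
    then show ?thesis
      using less.prems by (simp add: digits.simps[of m] digits.simps[of n] split: if_splits)
  next
    case False
    then have odd: "odd m = odd n" and "digits (m div 2) = digits (n div 2)"
      using less.prems by (simp_all add: digits.simps[of m] digits.simps[of n])
    from less.IH[OF _ this(2)] False have "m div 2 = n div 2" by simp
    with odd show ?thesis by presburger
  qed
qed

lemma delimited_inject:
  "concat (map (\<lambda>b. [True, b]) us) @ False # xs = concat (map (\<lambda>b. [True, b]) vs) @ False # ys
    \<Longrightarrow> us = vs \<and> xs = ys"
proof (induction us arbitrary: vs)
  case Nil
  then show ?case by (cases vs) auto
next
  case (Cons u us)
  then show ?case by (cases vs) auto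
qed

lemma encode_prefix_free: "encode \<phi> @ xs = encode \<psi> @ ys \<Longrightarrow> \<phi> = \<psi> \<and> xs = ys"
proof (induction \<phi> arbitrary: \<psi> xs ys)
  case (Var n)
  then show ?case
    by (cases \<psi>) (auto dest!: delimited_inject digits_inject)
next
  case Bot
  then show ?case by (cases \<psi>) auto
next
  case (Imp \<phi>1 \<phi>2)
  from Imp.prems obtain \<psi>1 \<psi>2 where \<psi>: "\<psi> = Imp \<psi>1 \<psi>2"
    by (cases \<psi>) simp_all
  then have "encode \<phi>1 @ (encode \<phi>2 @ xs) = encode \<psi>1 @ (encode \<psi>2 @ ys)"
    using Imp.prems by simp
  from Imp.IH(1)[OF this] Imp.IH(2)[of xs \<psi>2 ys] \<psi> show ?case by simp
next
  case (Box \<phi>)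
  then show ?case by (cases \<psi>) auto
qed

corollary encode_pair_inject:
  "encode \<phi> @ encode \<psi> = encode \<phi>' @ encode \<psi>' \<longleftrightarrow> \<phi> = \<phi>' \<and> \<psi> = \<psi>'"
  using encode_prefix_free[of \<phi> "encode \<psi>" \<phi>' "encode \<psi>'"]
    encode_prefix_free[of \<psi> "[]" \<psi>' "[]"] by fastforce

section \<open>Turing machines\<close>

text \<open>
  Nondeterministic multi-tape machines with two-way infinite tapes. States and tape symbols are
  initial segments of the natural numbers. State 0 is initial and state 1 accepting; symbol 0 is
  the blank, and symbols 1 and 2 are the input bits \<open>False\<close> and \<open>True\<close>. An instruction
  \<open>(q, rs, q', as)\<close> applies in state \<open>q\<close> when the heads read \<open>rs\<close>; it leads to state \<open>q'\<close>, and
  on tape \<open>i\<close> writes the first component of \<open>as ! i\<close> and moves the head by the second.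
\<close>

record machine =
  tapes :: nat
  states :: nat
  symbols :: nat
  instrs :: "(nat \<times> nat list \<times> nat \<times> (nat \<times> int) list) set"

definition wf_machine :: "machine \<Rightarrow> bool" where
  "wf_machine M \<longleftrightarrow>
     tapes M \<ge> 1 \<and> states M \<ge> 2 \<and> symbols M \<ge> 3 \<and>
     (\<forall>(q, rs, q', as) \<in> instrs M.
        q < states M \<and> q' < states M \<and>
        length rs = tapes M \<and> set rs \<subseteq> {..<symbols M} \<and>
        length as = tapes M \<and> set as \<subseteq> {..<symbols M} \<times> {-1, 0, 1})"

definition deterministic :: "machine \<Rightarrow> bool" where
  "deterministic M \<longleftrightarrow>
     (\<forall>q rs q1 as1 q2 as2.
        (q, rs, q1, as1) \<in> instrs M \<longrightarrow> (q, rs, q2, as2) \<in> instrs M \<longrightarrow> q1 = q2 \<and> as1 = as2)"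

record config =
  state :: nat
  head :: "nat \<Rightarrow> int"
  tape :: "nat \<Rightarrow> int \<Rightarrow> nat"

definition step :: "machine \<Rightarrow> config \<Rightarrow> config \<Rightarrow> bool" where
  "step M c c' \<longleftrightarrow>
     (\<exists>q' as.
        (state c, map (\<lambda>i. tape c i (head c i)) [0..<tapes M], q', as) \<in> instrs M \<and>
        c' = \<lparr>state = q',
              head = (\<lambda>i. if i < tapes M then head c i + snd (as ! i) else head c i),
              tape = (\<lambda>i. if i < tapes M then (tape c i)(head c i := fst (as ! i)) else tape c i)\<rparr>)"

definition halted :: "machine \<Rightarrow> config \<Rightarrow> bool" where
  "halted M c \<longleftrightarrow> (\<nexists>c'. step M c c')"

definition word_tape :: "word \<Rightarrow> int \<Rightarrow> nat" where
  "word_tape x z =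
     (if 0 \<le> z \<and> z < int (length x) then (if x ! nat z then 2 else 1) else 0)"

definition init :: "word \<Rightarrow> config" where
  "init x = \<lparr>state = 0, head = (\<lambda>i. 0), tape = (\<lambda>i. if i = 0 then word_tape x else (\<lambda>z. 0))\<rparr>"

text \<open>The second conjunct bounds the length of every computation.\<close>

definition decides_in_time :: "machine \<Rightarrow> (nat \<Rightarrow> nat) \<Rightarrow> word set \<Rightarrow> bool" where
  "decides_in_time M T L \<longleftrightarrow>
     wf_machine M \<and>
     (\<forall>x n c. (step M ^^ n) (init x) c \<longrightarrow> n \<le> T (length x)) \<and>
     (\<forall>x. x \<in> L \<longleftrightarrow> (\<exists>n c. (step M ^^ n) (init x) c \<and> halted M c \<and> state c = 1))"

text \<open>The output is read off the last tape, which must be blank outside of it.\<close>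

definition computes_in_time :: "machine \<Rightarrow> (nat \<Rightarrow> nat) \<Rightarrow> (word \<Rightarrow> word) \<Rightarrow> bool" where
  "computes_in_time M T f \<longleftrightarrow>
     wf_machine M \<and> deterministic M \<and>
     (\<forall>x. \<exists>n c. n \<le> T (length x) \<and> (step M ^^ n) (init x) c \<and> halted M c \<and>
                tape c (tapes M - 1) = word_tape (f x))"

section \<open>Complexity classes and hardness\<close>

definition NExpTime :: "word set set" where
  "NExpTime = {L. \<exists>M (p :: nat poly). decides_in_time M (\<lambda>n. 2 ^ poly p n) L}"

definition coNExpTime :: "word set set" where
  "coNExpTime = {L. - L \<in> NExpTime}"

definition polytime_computable :: "(word \<Rightarrow> word) \<Rightarrow> bool" where
  "polytime_computable f \<longleftrightarrow> (\<exists>M (p :: nat poly). computes_in_time M (poly p) f)"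

definition polytime_reducible :: "word set \<Rightarrow> word set \<Rightarrow> bool" where
  "polytime_reducible A B \<longleftrightarrow> (\<exists>f. polytime_computable f \<and> (\<forall>x. x \<in> A \<longleftrightarrow> f x \<in> B))"

definition hard_for :: "word set set \<Rightarrow> word set \<Rightarrow> bool" where
  "hard_for C B \<longleftrightarrow> (\<forall>A \<in> C. polytime_reducible A B)"

end

(*
  The reduction goes through bisimilar models: by a canonical model argument, an implication has no
  interpolant iff its antecedent and the negation of its consequent hold at points of weakly
  transitive models that are bisimilar for the common variables.

  The consequent is refuted only if all E-points of the second model coincide: a weakly transitive
  cluster may contain irreflexive points, and "no E-point sees another one" then makes the E-point
  unique. The antecedent generates a tree with one E-point for each of exponentially many addresses.
  All of them are bisimilar to the same point, so they all see copies of the same leaves, although each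
  of them knows its own address through variables that are not shared. This lets polynomially large
  formulas express constraints between the leaves at arbitrary adjacent addresses, and hence the
  existence of a tiling of exponential size that describes an accepting computation.
*)

theory Submission
  imports Defs "HOL-Library.Countable"
begin

section \<open>Kripke semantics\<close>


text \<open>Two obstacles shape the details. A polynomial formula cannot list the pairs of adjacent
  addresses. A finite automaton therefore reads two addresses digit by digit along a path, its
  states being ordinary variables, and the point at the end of the path knows how its two addresses
  are related. Adjacency in turn must suffice for every constraint of a computation whose heads move
  independently on several tapes; so each tape is described relative to its own head, and the tape
  is shifted, cyclically, instead of the head. The reduction must also be computed by an explicit
  Turing machine. Hence each formula is a chain of implications whose members are copies of finitely
  many fixed formulas, one copy per digit or per input letter, differing only in the indices of
  variables. Variables are numbered so that passing from copy 0 to copy \<open>i\<close> multiplies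
  the even numbers by \<open>2 ^ i\<close>, which inserts \<open>i\<close> zero digits into their
  binary code. The machine then needs only constant words and a unary counter.\<close>

primrec sat :: "('w \<Rightarrow> 'w \<Rightarrow> bool) \<Rightarrow> ('w \<Rightarrow> nat \<Rightarrow> bool) \<Rightarrow> 'w \<Rightarrow> fm \<Rightarrow> bool" where
  "sat R V w (Var n) = V w n"
| "sat R V w Bot = False"
| "sat R V w (Imp \<phi> \<psi>) = (sat R V w \<phi> \<longrightarrow> sat R V w \<psi>)"
| "sat R V w (Box \<phi>) = (\<forall>u. R w u \<longrightarrow> sat R V u \<phi>)"

definition weakly_transitive :: "('w \<Rightarrow> 'w \<Rightarrow> bool) \<Rightarrow> bool" where
  "weakly_transitive R \<longleftrightarrow> (\<forall>x y z. R x y \<longrightarrow> R y z \<longrightarrow> x = z \<or> R x z)"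

lemma sat_tautology:
  assumes "tautology \<phi>"
  shows "sat R V w \<phi>"
proof -
  have "bool_eval (sat R V w) \<psi> = sat R V w \<psi>" for \<psi>
    by (induction \<psi>) auto
  then show ?thesis using assms by (auto simp: tautology_def)
qed

lemma sat_subst: "sat R V w (subst \<sigma> \<phi>) = sat R (\<lambda>u n. sat R V u (\<sigma> n)) w \<phi>"
  by (induction \<phi> arbitrary: w) auto

lemma wK4_sound:
  assumes "\<phi> \<in> wK4" "weakly_transitive R"
  shows "sat R V w \<phi>"
  using assms(1) unfolding wK4_def
\<comment> \<open>Substitution is absorbed into the valuation, so the induction hypothesis has to be
  available for every \<open>V\<close>.\<close>
proof (induction arbitrary: V w)
  case (taut \<phi>)
  then show ?case by (rule sat_tautology)
next
  case (ax \<phi>)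
  then show ?case using assms(2) unfolding weakly_transitive_def by fastforce
next
  case (sub \<phi> \<sigma>)
  then show ?case by (simp add: sat_subst)
qed auto

section \<open>Bisimulations for a set of variables\<close>

definition bisimulation :: "nat set \<Rightarrow> ('v \<Rightarrow> 'v \<Rightarrow> bool) \<Rightarrow> ('v \<Rightarrow> nat \<Rightarrow> bool) \<Rightarrow>
    ('w \<Rightarrow> 'w \<Rightarrow> bool) \<Rightarrow> ('w \<Rightarrow> nat \<Rightarrow> bool) \<Rightarrow> ('v \<Rightarrow> 'w \<Rightarrow> bool) \<Rightarrow> bool" where
  "bisimulation \<sigma> R V R' V' Z \<longleftrightarrow> (\<forall>x y. Z x y \<longrightarrow>
     (\<forall>n\<in>\<sigma>. V x n = V' y n) \<and>
     (\<forall>x'. R x x' \<longrightarrow> (\<exists>y'. R' y y' \<and> Z x' y')) \<and>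
     (\<forall>y'. R' y y' \<longrightarrow> (\<exists>x'. R x x' \<and> Z x' y')))"

lemma bisimulation_sat:
  assumes "bisimulation \<sigma> R V R' V' Z" "Z x y" "vars \<phi> \<subseteq> \<sigma>"
  shows "sat R V x \<phi> = sat R' V' y \<phi>"
  using assms(2,3)
proof (induction \<phi> arbitrary: x y)
  case (Var n)
  then show ?case using assms(1) by (auto simp: bisimulation_def)
next
  case (Box \<phi>)
  from Box.prems(1) assms(1)
  have forth: "\<And>x'. R x x' \<Longrightarrow> \<exists>y'. R' y y' \<and> Z x' y'"
    and back': "\<And>y'. R' y y' \<Longrightarrow> \<exists>x'. R x x' \<and> Z x' y'"
    unfolding bisimulation_def by blast+
  have *: "sat R V x' \<phi> = sat R' V' y' \<phi>" if "Z x' y'" for x' y'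
    using Box.IH[OF that] Box.prems(2) by simp
  show ?case unfolding sat.simps using forth back' * by meson
qed auto

text \<open>Soundness makes \<open>\<iota>\<close> true at \<open>x\<close>; having shared variables
  only, it is carried over to \<open>y\<close> and would make \<open>\<psi>\<close> true
  there.\<close>

lemma bisimilar_no_interpolant:
  assumes "weakly_transitive R" "weakly_transitive R'"
    and "bisimulation (vars \<phi> \<inter> vars \<psi>) R V R' V' Z" "Z x y"
    and "sat R V x \<phi>" "\<not> sat R' V' y \<psi>"
  shows "\<not> interpolant wK4 \<phi> \<psi> \<iota>"
proof
  assume "interpolant wK4 \<phi> \<psi> \<iota>"
  then have "vars \<iota> \<subseteq> vars \<phi> \<inter> vars \<psi>" "sat R V x (Imp \<phi> \<iota>)" "sat R' V' y (Imp \<iota> \<psi>)"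
    unfolding interpolant_def by (auto simp del: sat.simps intro: wK4_sound assms(1,2))
  with assms(5,6) bisimulation_sat[OF assms(3,4)] show False by simp
qed

section \<open>The canonical model\<close>

text \<open>A chain of implications plays the part of a finite conjunction. With conclusion
  \<open>Bot\<close> it expresses inconsistency, and in prefix notation its code is a concatenation
  over the members, which suits a machine that writes them one after the other.\<close>

definition imps :: "fm list \<Rightarrow> fm \<Rightarrow> fm" where
  "imps xs \<phi> = foldr Imp xs \<phi>"

lemma imps_simps [simp]: "imps [] \<phi> = \<phi>" "imps (x # xs) \<phi> = Imp x (imps xs \<phi>)"
  by (simp_all add: imps_def)

lemma bool_eval_imps [simp]:
  "bool_eval v (imps xs \<phi>) \<longleftrightarrow> ((\<forall>x\<in>set xs. bool_eval v x) \<longrightarrow> bool_eval v \<phi>)"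
  by (induction xs) auto

lemma sat_imps [simp]:
  "sat R V w (imps xs \<phi>) \<longleftrightarrow> ((\<forall>x\<in>set xs. sat R V w x) \<longrightarrow> sat R V w \<phi>)"
  by (induction xs) auto

lemma vars_imps [simp]: "vars (imps xs \<phi>) = (\<Union>x\<in>set xs. vars x) \<union> vars \<phi>"
  by (induction xs) auto

lemma wK4_tautology: "tautology \<phi> \<Longrightarrow> \<phi> \<in> wK4"
  unfolding wK4_def by (rule K_plus.taut)

lemma wK4_mp: "Imp \<phi> \<psi> \<in> wK4 \<Longrightarrow> \<phi> \<in> wK4 \<Longrightarrow> \<psi> \<in> wK4"
  unfolding wK4_def by (rule K_plus.mp)

lemma wK4_nec: "\<phi> \<in> wK4 \<Longrightarrow> Box \<phi> \<in> wK4"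
  unfolding wK4_def by (rule K_plus.nec)

lemma wK4_mono: "\<phi> \<in> wK4 \<Longrightarrow> tautology (Imp \<phi> \<psi>) \<Longrightarrow> \<psi> \<in> wK4"
  using wK4_mp wK4_tautology by blast

lemma wK4_mono2: "\<phi> \<in> wK4 \<Longrightarrow> \<chi> \<in> wK4 \<Longrightarrow> tautology (Imp \<phi> (Imp \<chi> \<psi>)) \<Longrightarrow> \<psi> \<in> wK4"
  using wK4_mp wK4_tautology by blast

lemma wK4_weak_transitivity: "Imp (Dia (Dia \<phi>)) (Or \<phi> (Dia \<phi>)) \<in> wK4"
proof -
  have "subst (\<lambda>_. \<phi>) (Imp (Dia (Dia (Var 0))) (Or (Var 0) (Dia (Var 0)))) \<in> wK4"
    unfolding wK4_def by (intro K_plus.sub K_plus.ax) simp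
  then show ?thesis by simp
qed

lemma wK4_Box_imps:
  assumes "imps xs \<phi> \<in> wK4"
  shows "imps (map Box xs) (Box \<phi>) \<in> wK4"
proof -
  have "Imp (Box (imps xs \<phi>)) (imps (map Box xs) (Box \<phi>)) \<in> wK4"
  proof (induction xs)
    case Nil
    then show ?case by (intro wK4_tautology) (simp add: tautology_def)
  next
    case (Cons x xs)
    have "Imp (Box (Imp x (imps xs \<phi>))) (Imp (Box x) (Box (imps xs \<phi>))) \<in> wK4"
      unfolding wK4_def by (rule K_plus.K)
    from wK4_mono2[OF this Cons.IH] show ?case by (simp add: tautology_def)
  qed
  with assms show ?thesis using wK4_mp wK4_nec by blast
qed

definition consistent :: "fm set \<Rightarrow> bool" where
  "consistent S \<longleftrightarrow> (\<forall>xs. set xs \<subseteq> S \<longrightarrow> imps xs Bot \<notin> wK4)"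

definition mcs :: "fm set \<Rightarrow> bool" where
  "mcs S \<longleftrightarrow> consistent S \<and> (\<forall>\<phi>. \<phi> \<in> S \<or> Neg \<phi> \<in> S)"

lemma inconsistent_Un:
  assumes "\<not> consistent (A \<union> B)"
  obtains as bs where "set as \<subseteq> A" "set bs \<subseteq> B" "imps as (imps bs Bot) \<in> wK4"
proof -
  from assms obtain xs where xs: "set xs \<subseteq> A \<union> B" "imps xs Bot \<in> wK4"
    by (auto simp: consistent_def)
  let ?as = "filter (\<lambda>x. x \<in> A) xs" and ?bs = "filter (\<lambda>x. x \<notin> A) xs"
  have "imps ?as (imps ?bs Bot) \<in> wK4"
    by (rule wK4_mono[OF xs(2)]) (auto simp: tautology_def)
  then show thesis using that[of ?as ?bs] xs(1) by auto
qed

lemma consistent_insert: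
  assumes "consistent S" "\<not> consistent (insert \<phi> S)"
  obtains xs where "set xs \<subseteq> S" "imps xs (Neg \<phi>) \<in> wK4"
proof -
  from assms(2) have "\<not> consistent (S \<union> {\<phi>})" by simp
  then obtain as bs where *: "set as \<subseteq> S" "set bs \<subseteq> {\<phi>}" "imps as (imps bs Bot) \<in> wK4"
    by (rule inconsistent_Un)
  have "imps as (Neg \<phi>) \<in> wK4"
    by (rule wK4_mono[OF *(3)]) (use *(2) in \<open>auto simp: tautology_def\<close>)
  with * show thesis using that by blast
qed

text \<open>Zorn's lemma applies because an inconsistency uses finitely many formulas, and these lie
  in a single member of a chain.\<close>

lemma lindenbaum:
  assumes "consistent S"
  obtains T where "S \<subseteq> T" "mcs T"
proof -
  let ?A = "{T. S \<subseteq> T \<and> consistent T}"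
  have "\<exists>M\<in>?A. \<forall>X\<in>?A. M \<subseteq> X \<longrightarrow> X = M"
  proof (rule subset_Zorn_nonempty)
    show "?A \<noteq> {}" using assms by auto
  next
    fix C assume C: "C \<noteq> {}" "subset.chain ?A C"
    have "consistent (\<Union>C)"
      unfolding consistent_def
    proof (intro allI impI)
      fix xs assume "set xs \<subseteq> \<Union>C"
      from finite_subset_Union_chain[OF _ this C]
      obtain T where "T \<in> C" "set xs \<subseteq> T" by auto
      then show "imps xs Bot \<notin> wK4" using C by (auto simp: subset.chain_def consistent_def)
    qed
    moreover have "S \<subseteq> \<Union>C" using C unfolding subset.chain_def by fast
    ultimately show "\<Union>C \<in> ?A" by simp
  qed
  then obtain T where "T \<in> ?A" and max': "\<forall>X\<in>?A. T \<subseteq> X \<longrightarrow> X = T" ..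
  then have T: "S \<subseteq> T" "consistent T" by auto
  have max: "X = T" if "consistent X" "T \<subseteq> X" for X
    using max' T(1) that by blast
  have "\<phi> \<in> T \<or> Neg \<phi> \<in> T" for \<phi>
  proof (rule ccontr)
    assume "\<not> (\<phi> \<in> T \<or> Neg \<phi> \<in> T)"
    then have "\<not> consistent (insert \<phi> T)" "\<not> consistent (insert (Neg \<phi>) T)"
      using max[of "insert \<phi> T"] max[of "insert (Neg \<phi>) T"] by blast+
    then obtain xs ys where *: "set xs \<subseteq> T" "imps xs (Neg \<phi>) \<in> wK4"
        "set ys \<subseteq> T" "imps ys (Neg (Neg \<phi>)) \<in> wK4"
      using consistent_insert[OF T(2)] by metis
    have "imps (xs @ ys) Bot \<in> wK4"
      by (rule wK4_mono2[OF *(2,4)]) (auto simp: tautology_def)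
    with * T(2) show False by (auto simp: consistent_def)
  qed
  then show thesis using that T by (auto simp: mcs_def)
qed

lemma mcs_closed:
  assumes "mcs S" "set xs \<subseteq> S" "imps xs \<phi> \<in> wK4"
  shows "\<phi> \<in> S"
proof (rule ccontr)
  assume "\<phi> \<notin> S"
  with assms have "set (Neg \<phi> # xs) \<subseteq> S" by (auto simp: mcs_def)
  moreover have "imps (Neg \<phi> # xs) Bot \<in> wK4"
    unfolding imps_simps
    by (rule wK4_mono[OF assms(3)]) (auto simp: tautology_def)
  ultimately show False using assms(1) unfolding mcs_def consistent_def by blast
qed

lemma mcs_tautology:
  assumes "mcs S" "set xs \<subseteq> S" "tautology (imps xs \<phi>)"
  shows "\<phi> \<in> S"
  using mcs_closed[OF assms(1,2)] wK4_tautology assms(3) by blast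

lemma mcs_Bot: "mcs S \<Longrightarrow> Bot \<notin> S"
  using wK4_tautology[of "imps [Bot] Bot"] unfolding mcs_def consistent_def
  by (auto simp: tautology_def dest!: spec[of _ "[Bot]"])

lemma mcs_Imp:
  assumes "mcs S"
  shows "Imp \<phi> \<psi> \<in> S \<longleftrightarrow> (\<phi> \<in> S \<longrightarrow> \<psi> \<in> S)"
proof (intro iffI impI)
  assume "Imp \<phi> \<psi> \<in> S" "\<phi> \<in> S"
  then show "\<psi> \<in> S"
    by (intro mcs_tautology[OF assms, of "[Imp \<phi> \<psi>, \<phi>]"]) (auto simp: tautology_def)
next
  assume "\<phi> \<in> S \<longrightarrow> \<psi> \<in> S"
  then have "Neg \<phi> \<in> S \<or> \<psi> \<in> S" using assms unfolding mcs_def by blast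
  then show "Imp \<phi> \<psi> \<in> S"
  proof
    assume "Neg \<phi> \<in> S"
    then show ?thesis
      by (intro mcs_tautology[OF assms, of "[Neg \<phi>]"]) (auto simp: tautology_def)
  next
    assume "\<psi> \<in> S"
    then show ?thesis by (intro mcs_tautology[OF assms, of "[\<psi>]"]) (auto simp: tautology_def)
  qed
qed

lemma mcs_Neg: "mcs S \<Longrightarrow> Neg \<phi> \<in> S \<longleftrightarrow> \<phi> \<notin> S"
  by (simp add: mcs_Imp mcs_Bot)

section \<open>Canonical frame, truth lemma and canonical bisimulation\<close>

definition canon_R :: "fm set \<Rightarrow> fm set \<Rightarrow> bool" where
  "canon_R S T \<longleftrightarrow> mcs S \<and> mcs T \<and> (\<forall>\<phi>. Box \<phi> \<in> S \<longrightarrow> \<phi> \<in> T)"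

definition canon_V :: "fm set \<Rightarrow> nat \<Rightarrow> bool" where
  "canon_V S n \<longleftrightarrow> Var n \<in> S"

lemma mcs_Box_closed:
  assumes "mcs S" "\<forall>x\<in>set xs. Box x \<in> S" "imps xs \<phi> \<in> wK4"
  shows "Box \<phi> \<in> S"
  using mcs_closed[OF assms(1) _ wK4_Box_imps[OF assms(3)]] assms(2) by auto

text \<open>\<open>B\<close> is what the successor has to satisfy: a single negated formula in the
  truth lemma, a whole theory in the shared variables in the bisimulation lemma.\<close>

lemma canon_successor:
  assumes "mcs S" "\<And>bs. set bs \<subseteq> B \<Longrightarrow> Box (imps bs Bot) \<notin> S"
  obtains T where "canon_R S T" "B \<subseteq> T"
proof -
  have "consistent ({\<phi>. Box \<phi> \<in> S} \<union> B)"
  proof (rule ccontr)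
    assume "\<not> consistent ({\<phi>. Box \<phi> \<in> S} \<union> B)"
    then obtain as bs where "set as \<subseteq> {\<phi>. Box \<phi> \<in> S}" "set bs \<subseteq> B" "imps as (imps bs Bot) \<in> wK4"
      by (rule inconsistent_Un)
    then show False using mcs_Box_closed[OF assms(1), of as "imps bs Bot"] assms(2) by auto
  qed
  then obtain T where "{\<phi>. Box \<phi> \<in> S} \<union> B \<subseteq> T" "mcs T" by (rule lindenbaum)
  then show thesis using that assms(1) by (auto simp: canon_R_def)
qed

lemma canon_sat: "mcs S \<Longrightarrow> sat canon_R canon_V S \<phi> \<longleftrightarrow> \<phi> \<in> S"
proof (induction \<phi> arbitrary: S)
  case (Box \<phi>)
  show ?case
  proof
    assume *: "sat canon_R canon_V S (Box \<phi>)"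
    show "Box \<phi> \<in> S"
    proof (rule ccontr)
      assume no: "Box \<phi> \<notin> S"
      have "Box (imps bs Bot) \<notin> S" if "set bs \<subseteq> {Neg \<phi>}" for bs
      proof
        assume "Box (imps bs Bot) \<in> S"
        then have "Box \<phi> \<in> S"
          using that by (intro mcs_Box_closed[OF Box.prems, of "[imps bs Bot]"] wK4_tautology)
            (auto simp: tautology_def)
        with no show False by simp
      qed
      from canon_successor[OF Box.prems this]
      obtain T where "canon_R S T" "Neg \<phi> \<in> T" by blast
      moreover have "mcs T" using \<open>canon_R S T\<close> by (simp add: canon_R_def)
      ultimately show False
        using * Box.IH[of T] mcs_Imp[OF \<open>mcs T\<close>] mcs_Bot[OF \<open>mcs T\<close>] by auto
    qed
  qed (use Box.IH in \<open>auto simp: canon_R_def\<close>)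
qed (auto simp: canon_V_def mcs_Bot mcs_Imp)

text \<open>If the conclusion fails, some \<open>\<alpha>\<close> is boxed in \<open>S\<close> but
  missing from \<open>U\<close>, and some \<open>\<beta>\<close> lies in \<open>S\<close> but not in
  \<open>U\<close>. The negation of their disjunction holds at \<open>U\<close>, so it is possible
  in two steps from \<open>S\<close>; but \<open>\<beta>\<close> excludes it at \<open>S\<close>
  itself and the boxed \<open>\<alpha>\<close> excludes it at the successors of \<open>S\<close>.
  This contradicts the axiom.\<close>

lemma weakly_transitive_canon: "weakly_transitive canon_R"
  unfolding weakly_transitive_def
proof (intro allI impI)
  fix S T U assume R: "canon_R S T" "canon_R T U"
  then have mcs: "mcs S" "mcs T" "mcs U" by (auto simp: canon_R_def)
  show "S = U \<or> canon_R S U"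
  proof (rule ccontr)
    assume *: "\<not> (S = U \<or> canon_R S U)"
    then obtain \<alpha> where \<alpha>: "Box \<alpha> \<in> S" "\<alpha> \<notin> U" using mcs by (auto simp: canon_R_def)
    from * obtain \<beta> where \<beta>: "\<beta> \<in> S" "\<beta> \<notin> U"
    proof -
      from * have "\<not> S \<subseteq> U \<or> \<not> U \<subseteq> S" by auto
      then show thesis
        using that[of "Neg _"] that mcs_Neg[OF mcs(1)] mcs_Neg[OF mcs(3)] by blast
    qed
    let ?p = "Neg (Or \<alpha> \<beta>)"
    note simps = mcs_Imp[OF mcs(1)] mcs_Imp[OF mcs(2)] mcs_Imp[OF mcs(3)]
      mcs_Bot[OF mcs(1)] mcs_Bot[OF mcs(2)] mcs_Bot[OF mcs(3)]
    have "?p \<in> U" using \<alpha> \<beta> by (simp add: simps)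
    then have "Dia ?p \<in> T" using R(2) simps unfolding canon_R_def by blast
    then have "Dia (Dia ?p) \<in> S" using R(1) simps unfolding canon_R_def by blast
    moreover have "Imp (Dia (Dia ?p)) (Or ?p (Dia ?p)) \<in> S"
      using mcs_closed[OF mcs(1), of "[]"] wK4_weak_transitivity by simp
    ultimately have "?p \<in> S \<or> Dia ?p \<in> S" by (auto simp: simps)
    moreover have "Box (Neg ?p) \<in> S"
      using \<alpha>(1) by (intro mcs_Box_closed[OF mcs(1), of "[\<alpha>]"] wK4_tautology) (auto simp: tautology_def)
    ultimately show False using \<beta>(1) by (auto simp: simps)
  qed
qed

text \<open>A successor of \<open>T\<close> must contain the part of \<open>S'\<close> over
  \<open>\<sigma>\<close>. If \<open>T\<close> excluded this, it would do so by a boxed formula over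
  \<open>\<sigma>\<close>, which \<open>S\<close> would then contain as well, contradicting the
  existence of \<open>S'\<close>.\<close>

lemma bisimulation_canon:
  "bisimulation \<sigma> canon_R canon_V canon_R canon_V
     (\<lambda>S T. mcs S \<and> mcs T \<and> (\<forall>\<phi>. vars \<phi> \<subseteq> \<sigma> \<longrightarrow> (\<phi> \<in> S \<longleftrightarrow> \<phi> \<in> T)))"
proof -
  have ext: "\<exists>T'. canon_R T T' \<and> (\<forall>\<phi>. vars \<phi> \<subseteq> \<sigma> \<longrightarrow> (\<phi> \<in> S' \<longleftrightarrow> \<phi> \<in> T'))"
    if "mcs S" "mcs T" and eq: "\<forall>\<phi>. vars \<phi> \<subseteq> \<sigma> \<longrightarrow> (\<phi> \<in> S \<longleftrightarrow> \<phi> \<in> T)" and R: "canon_R S S'" for S T S'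
  proof -
    from R have S': "mcs S'" by (simp add: canon_R_def)
    let ?B = "{\<phi> \<in> S'. vars \<phi> \<subseteq> \<sigma>}"
    have "Box (imps bs Bot) \<notin> T" if "set bs \<subseteq> ?B" for bs
    proof
      assume "Box (imps bs Bot) \<in> T"
      moreover have "vars (Box (imps bs Bot)) \<subseteq> \<sigma>" using that by auto
      ultimately have "Box (imps bs Bot) \<in> S" using eq by blast
      then have "imps bs Bot \<in> S'" using R by (simp add: canon_R_def)
      then have "Bot \<in> S'"
        using that by (intro mcs_tautology[OF S', of "imps bs Bot # bs"]) (auto simp: tautology_def)
      then show False using mcs_Bot[OF S'] by simp
    qed
    from canon_successor[OF \<open>mcs T\<close> this]
    obtain T' where T': "canon_R T T'" "?B \<subseteq> T'" by blast
    then have "mcs T'" by (simp add: canon_R_def)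
    have "\<phi> \<in> S' \<longleftrightarrow> \<phi> \<in> T'" if "vars \<phi> \<subseteq> \<sigma>" for \<phi>
    proof (cases "\<phi> \<in> S'")
      case True
      then show ?thesis using that T' by auto
    next
      case False
      then have "Neg \<phi> \<in> ?B" using S' that by (auto simp: mcs_def)
      then have "Neg \<phi> \<in> T'" using T' by blast
      then show ?thesis using False mcs_Neg[OF \<open>mcs T'\<close>] by simp
    qed
    then show ?thesis using T' by blast
  qed
  show ?thesis
    unfolding bisimulation_def
  proof (intro allI impI conjI ballI)
    fix S T S' assume "mcs S \<and> mcs T \<and> (\<forall>\<phi>. vars \<phi> \<subseteq> \<sigma> \<longrightarrow> (\<phi> \<in> S \<longleftrightarrow> \<phi> \<in> T))" "canon_R S S'"
    then show "\<exists>y'. canon_R T y' \<and> mcs S' \<and> mcs y' \<and> (\<forall>\<phi>. vars \<phi> \<subseteq> \<sigma> \<longrightarrow> (\<phi> \<in> S') = (\<phi> \<in> y'))"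
      using ext[of S T S'] by (auto simp: canon_R_def)
  next
    fix S T S' assume "mcs T \<and> mcs S \<and> (\<forall>\<phi>. vars \<phi> \<subseteq> \<sigma> \<longrightarrow> (\<phi> \<in> T \<longleftrightarrow> \<phi> \<in> S))" "canon_R S S'"
    then show "\<exists>y'. canon_R T y' \<and> mcs y' \<and> mcs S' \<and> (\<forall>\<phi>. vars \<phi> \<subseteq> \<sigma> \<longrightarrow> (\<phi> \<in> y') = (\<phi> \<in> S'))"
      using ext[of S T S'] by (auto simp: canon_R_def)
  qed (auto simp: canon_V_def)
qed

text \<open>The theory \<open>T\<close> is chosen first, around \<open>Neg \<psi>\<close> and all
  shared consequences of \<open>\<phi>\<close>; an inconsistency would turn a finite conjunction of
  these consequences into an interpolant. The shared part of \<open>T\<close> is then consistent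
  with \<open>\<phi>\<close>, because any shared formula that \<open>\<phi>\<close> implies already
  lies in \<open>T\<close>.\<close>

lemma no_interpolant_canon:
  assumes no: "\<nexists>\<iota>. interpolant wK4 \<phi> \<psi> \<iota>"
  obtains S T where "mcs S" "mcs T" "\<phi> \<in> S" "\<psi> \<notin> T"
    "\<And>\<chi>. vars \<chi> \<subseteq> vars \<phi> \<inter> vars \<psi> \<Longrightarrow> \<chi> \<in> S \<longleftrightarrow> \<chi> \<in> T"
proof -
  let ?\<sigma> = "vars \<phi> \<inter> vars \<psi>"
  let ?C = "{\<iota>. vars \<iota> \<subseteq> ?\<sigma> \<and> Imp \<phi> \<iota> \<in> wK4}"
  have "consistent (?C \<union> {Neg \<psi>})"
  proof (rule ccontr)
    assume "\<not> consistent (?C \<union> {Neg \<psi>})"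
    then obtain as bs where *: "set as \<subseteq> ?C" "set bs \<subseteq> {Neg \<psi>}" "imps as (imps bs Bot) \<in> wK4"
      by (rule inconsistent_Un)
    let ?\<iota> = "Neg (imps as Bot)"
    have "Imp ?\<iota> \<psi> \<in> wK4"
      by (rule wK4_mono[OF *(3)]) (use *(2) in \<open>auto simp: tautology_def\<close>)
    moreover have "Imp \<phi> ?\<iota> \<in> wK4"
      using *(1)
    proof (induction as)
      case Nil
      then show ?case by (intro wK4_tautology) (simp add: tautology_def)
    next
      case (Cons a as)
      then have "Imp \<phi> a \<in> wK4" "Imp \<phi> (Neg (imps as Bot)) \<in> wK4" by auto
      then show ?case by (rule wK4_mono2) (auto simp: tautology_def)
    qed
    moreover have "vars ?\<iota> \<subseteq> ?\<sigma>" using *(1) by auto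
    ultimately show False using no by (auto simp: interpolant_def)
  qed
  then obtain T where T: "?C \<union> {Neg \<psi>} \<subseteq> T" "mcs T" by (rule lindenbaum)
  have "consistent ({\<phi>} \<union> {\<chi> \<in> T. vars \<chi> \<subseteq> ?\<sigma>})"
  proof (rule ccontr)
    assume "\<not> consistent ({\<phi>} \<union> {\<chi> \<in> T. vars \<chi> \<subseteq> ?\<sigma>})"
    then obtain as bs where *: "set as \<subseteq> {\<phi>}" "set bs \<subseteq> {\<chi> \<in> T. vars \<chi> \<subseteq> ?\<sigma>}"
        "imps as (imps bs Bot) \<in> wK4"
      by (rule inconsistent_Un)
    have "Imp \<phi> (imps bs Bot) \<in> wK4"
      by (rule wK4_mono[OF *(3)]) (use *(1) in \<open>auto simp: tautology_def\<close>)
    moreover have "vars (imps bs Bot) \<subseteq> ?\<sigma>" using *(2) by auto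
    ultimately have "imps bs Bot \<in> T" using T(1) by blast
    then have "Bot \<in> T"
      using *(2) by (intro mcs_tautology[OF T(2), of "imps bs Bot # bs"]) (auto simp: tautology_def)
    then show False using mcs_Bot[OF T(2)] by simp
  qed
  then obtain S where S: "{\<phi>} \<union> {\<chi> \<in> T. vars \<chi> \<subseteq> ?\<sigma>} \<subseteq> S" "mcs S" by (rule lindenbaum)
  have "\<chi> \<in> S \<longleftrightarrow> \<chi> \<in> T" if "vars \<chi> \<subseteq> ?\<sigma>" for \<chi>
  proof (cases "\<chi> \<in> T")
    case True
    then show ?thesis using S that by auto
  next
    case False
    then have "Neg \<chi> \<in> T" using T(2) by (auto simp: mcs_def)
    then have "Neg \<chi> \<in> {\<chi> \<in> T. vars \<chi> \<subseteq> ?\<sigma>}" using that by simp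
    then have "Neg \<chi> \<in> S" using S by blast
    then show ?thesis using False mcs_Neg[OF S(2)] by simp
  qed
  moreover have "\<psi> \<notin> T" using T mcs_Neg[OF T(2)] by simp
  ultimately show thesis using that S T by auto
qed


section \<open>A constraint problem on exponentially many addresses\<close>

text \<open>A letter holds one binary digit of the time and one of the offset of a cell, so a list
  of letters addresses both coordinates at once.\<close>

type_synonym letter = "bool \<times> bool"

datatype shift = Same | Up | Down

text \<open>States of the automaton reading two addresses. Four of them test, on a pair of equal
  addresses, whether a coordinate is zero; \<open>Rel b p\<close> means that the second time exceeds
  the first by \<open>b\<close> and that the offsets differ by the cyclic shift
  \<open>p\<close>.\<close>

datatype phase = TimeZero | TimePos | OffsetZero | OffsetPos | Rel bool shift

datatype global = E | D | Leaf | Leaf' | Phase phase | Tile nat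

datatype indexed = Level | Match | Match' | Bit letter | Bit' letter | Label letter | Mark

datatype atom = G global | I indexed nat

instance shift :: countable by countable_datatype
instance phase :: countable by countable_datatype
instance global :: countable by countable_datatype
instance indexed :: countable by countable_datatype

text \<open>Only global variables have odd numbers, so the reduction can shift all indices of a formula by
  multiplying the even ones by a power of two.\<close>

fun idx :: "atom \<Rightarrow> nat" where
  "idx (G g) = 2 * to_nat g + 1"
| "idx (I b i) = 2 ^ Suc i * (2 * to_nat b + 1)"

lemma odd_pow2_inject:
  assumes "2 ^ i * (2 * a + 1) = 2 ^ j * (2 * b + 1 :: nat)"
  shows "i = j \<and> a = b"
  using assms
proof (induction i arbitrary: j)
  case 0
  then have "odd (2 ^ j * (2 * b + 1))" by (metis even_plus_one_iff mult_1 odd_two_times_div_two_succ even_mult_iff dvd_triv_left power_0)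
  then have "j = 0" by (cases j) auto
  with 0 show ?case by simp
next
  case (Suc i)
  then have "even (2 ^ j * (2 * b + 1))" by (metis dvd_mult2 dvd_triv_left power_Suc)
  then obtain j' where "j = Suc j'" by (cases j) auto
  moreover from this Suc.prems have "2 ^ i * (2 * a + 1) = 2 ^ j' * (2 * b + 1)" by simp
  ultimately show ?case using Suc.IH by blast
qed

lemma idx_inject: "idx a = idx b \<longleftrightarrow> a = b"
proof
  have form: "idx a = 2 ^ (case a of G g \<Rightarrow> 0 | I b i \<Rightarrow> Suc i) *
      (2 * (case a of G g \<Rightarrow> to_nat g | I b i \<Rightarrow> to_nat b) + 1)" for a
    by (cases a) auto
  assume "idx a = idx b"
  from this[unfolded form[of a] form[of b], THEN odd_pow2_inject] show "a = b"
    by (auto split: atom.splits)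
qed simp

declare idx.simps [simp del]

abbreviation At :: "atom \<Rightarrow> fm" where "At a \<equiv> Var (idx a)"

definition atom_val :: "('w \<Rightarrow> atom \<Rightarrow> bool) \<Rightarrow> 'w \<Rightarrow> nat \<Rightarrow> bool" where
  "atom_val V w n \<longleftrightarrow> (\<exists>a. n = idx a \<and> V w a)"

lemma atom_val_idx [simp]: "atom_val V w (idx a) = V w a"
  by (auto simp: atom_val_def idx_inject)

definition disj :: "fm list \<Rightarrow> fm" where
  "disj xs = imps (map Neg xs) Bot"

lemma sat_disj [simp]: "sat R V w (disj xs) \<longleftrightarrow> (\<exists>x\<in>set xs. sat R V w x)"
  by (auto simp: disj_def)

lemma vars_disj [simp]: "vars (disj xs) = (\<Union>x\<in>set xs. vars x)"
  by (auto simp: disj_def)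

text \<open>By weak transitivity every point reachable from the root is the root or one of its
  successors, so a formula together with its box at the root holds at all of them.\<close>

definition boxed :: "fm list \<Rightarrow> fm list" where
  "boxed xs = concat (map (\<lambda>x. [x, Box x]) xs)"

lemma set_boxed [simp]: "set (boxed xs) = set xs \<union> Box ` set xs"
  by (auto simp: boxed_def)

section \<open>Formulas describing the tree and the cluster\<close>

type_synonym edge = "phase \<times> letter \<times> letter \<times> phase"
text \<open>A rule concerns the two addresses of a path ending in the given phase: the atom at the
  first address forces one of the listed atoms at the second. A clause concerns a single
  address.\<close>

type_synonym rule = "phase \<times> atom \<times> atom list"
type_synonym clause = "atom list \<times> atom list"

definition letters :: "letter list" where
  "letters = [(False, False), (False, True), (True, False), (True, True)]"

lemma set_letters [simp]: "set letters = UNIV"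
  by (auto simp: letters_def)

text \<open>A path of the tree chooses digit by digit, the most significant one first, a pair of addresses,
  recorded in \<open>Bit\<close> and \<open>Bit'\<close>; an automaton with states \<open>Phase\<close> restricts the pairs.
  \<open>Label\<close> is the address shown by a leaf to both models, and \<open>Match i\<close> says that it agrees with
  \<open>Bit\<close> from digit \<open>i\<close> on.\<close>

definition edge_item :: "nat \<Rightarrow> edge \<Rightarrow> fm" where
  "edge_item i = (\<lambda>(s, c, c', s').
     imps [At (I Level (Suc i)), At (G (Phase s))]
       (Neg (Box (imps [At (I Level i), At (G (Phase s')), At (I (Bit c) i), At (I (Bit' c') i)] Bot))))"

text \<open>The first two items hand the chosen digits on to all later points. The next two let
  agreement of label and digits be derived from the most significant digit on. The last one works in
  the opposite direction: a leaf demanded by an E-point must show the first address of that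
  point.\<close>

definition letter_items :: "nat \<Rightarrow> letter \<Rightarrow> fm list" where
  "letter_items i c =
     [Imp (At (I (Bit c) i)) (Box (At (I (Bit c) i))),
      Imp (At (I (Bit' c) i)) (Box (At (I (Bit' c) i))),
      imps [At (I Match (Suc i)), At (I (Bit c) i), At (I (Label c) i)] (At (I Match i)),
      imps [At (I Match' (Suc i)), At (I (Bit' c) i), At (I (Label c) i)] (At (I Match' i)),
      imps [At (I Match i), At (I (Bit c) i)] (At (I (Label c) i))]"

definition level_items :: "edge list \<Rightarrow> nat \<Rightarrow> fm list" where
  "level_items \<Delta> i = map (edge_item i) \<Delta> @ concat (map (letter_items i) letters) @
     [Imp (At (I Match i)) (At (I Match (Suc i)))]"

definition clause_item :: "clause \<Rightarrow> fm" where
  "clause_item = (\<lambda>(as, bs). imps (At (G Leaf) # map At as) (disj (map At bs)))"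

text \<open>The comparison takes place at an E-point, whose successors include copies of all leaves:
  those showing its first address satisfy \<open>Leaf\<close>, those showing its second satisfy
  \<open>Leaf'\<close>. So two distinct leaves are related without any edge between them.\<close>

definition rule_item :: "rule \<Rightarrow> fm" where
  "rule_item = (\<lambda>(s, a, bs).
     imps [At (G E), At (G (Phase s)), Neg (Box (imps [At (G Leaf), At a] Bot))]
       (Box (Imp (At (G Leaf')) (disj (map At bs)))))"

definition const_items :: "fm list" where
  "const_items =
     [Imp (At (I Level 0)) (At (G E)),
      Imp (At (G E)) (Dia (At (G Leaf))),
      Imp (At (I Match 0)) (At (G Leaf)),
      Imp (At (G Leaf)) (At (I Match 0)),
      Imp (At (I Match' 0)) (At (G Leaf'))]"

abbreviation tree_items :: "edge list \<Rightarrow> nat \<Rightarrow> fm list" where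
  "tree_items \<Delta> P \<equiv>
     const_items @ [At (I Match P), At (I Match' P)] @ concat (map (level_items \<Delta>) [0..<P])"

text \<open>\<open>D\<close> serves as a name for the root: no successor of the root has it, so by
  weak transitivity the \<open>D\<close>-point that an E-point has to see is the root
  itself.\<close>

definition cluster_items :: "fm list" where
  "cluster_items =
     [At (G D), Box (Neg (At (G D))), Box (Imp (At (G E)) (Dia (At (G D)))),
      Box (Imp (At (G E)) (Box (Neg (At (G E)))))]"

text \<open>The list is read from its end, where the most significant digit stands; the head of the
  list is digit 0 and is read last.\<close>

fun run :: "edge list \<Rightarrow> phase list \<Rightarrow> (letter \<times> letter) list \<Rightarrow> phase \<Rightarrow> bool" where
  "run \<Delta> S [] s \<longleftrightarrow> s \<in> set S"
| "run \<Delta> S (p # u) s \<longleftrightarrow> (\<exists>r. run \<Delta> S u r \<and> (r, fst p, snd p, s) \<in> set \<Delta>)"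

fun tile_atom :: "atom \<Rightarrow> bool" where
  "tile_atom (G (Tile _)) = True"
| "tile_atom (I Mark _) = True"
| "tile_atom _ = False"

fun label_atom :: "atom \<Rightarrow> bool" where
  "label_atom (I (Label _) _) = True"
| "label_atom a = tile_atom a"

definition solves :: "nat \<Rightarrow> edge list \<Rightarrow> phase list \<Rightarrow> rule set \<Rightarrow> clause set \<Rightarrow>
    (letter list \<Rightarrow> atom \<Rightarrow> bool) \<Rightarrow> bool" where
  "solves P \<Delta> S rules clauses T \<longleftrightarrow>
     (\<forall>z as bs. length z = P \<longrightarrow> (as, bs) \<in> clauses \<longrightarrow> (\<forall>a\<in>set as. T z a) \<longrightarrow> (\<exists>b\<in>set bs. T z b)) \<and>
     (\<forall>u s a bs. length u = P \<longrightarrow> run \<Delta> S u s \<longrightarrow> (s, a, bs) \<in> rules \<longrightarrow> T (map fst u) a \<longrightarrow>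
        (\<exists>b\<in>set bs. T (map snd u) b))"

text \<open>The lists \<open>items\<close> and \<open>shared\<close> are constrained only through
  their members, because the reduction writes them in an order convenient for a generator. By
  \<open>covered\<close>, every address is the first address of some path, which provides an E-point
  demanding its leaf.\<close>

locale gadget =
  fixes P :: nat and \<Delta> :: "edge list" and S :: "phase list"
    and rules :: "rule set" and clauses :: "clause set"
    and items :: "fm list" and shared :: "atom list"
  assumes P_pos: "0 < P"
    and set_items: "set items = {At (I Level P), Neg (At (G E))} \<union> At ` G ` Phase ` set S \<union>
      set (boxed (tree_items \<Delta> P)) \<union>
      (\<Union>x \<in> clause_item ` clauses \<union> rule_item ` rules. {x, Box x})"
    and shared_E: "G E \<in> set shared"
    and shared_label: "\<And>c i. i < P \<Longrightarrow> I (Label c) i \<in> set shared"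
    and shared_only: "\<And>a. a \<in> set shared \<Longrightarrow> a = G E \<or> label_atom a"
    and rules_shared: "\<And>s a bs. (s, a, bs) \<in> rules \<Longrightarrow> set (a # bs) \<subseteq> set shared \<inter> Collect tile_atom"
    and clauses_shared: "\<And>as bs. (as, bs) \<in> clauses \<Longrightarrow> set (as @ bs) \<subseteq> set shared \<inter> Collect tile_atom"
    and covered: "\<And>z. length z = P \<Longrightarrow> \<exists>u s. run \<Delta> S u s \<and> map fst u = z"
begin

abbreviation "solution \<equiv> solves P \<Delta> S rules clauses"

definition lhs :: fm where "lhs = Neg (imps items Bot)"

text \<open>The tautologies put the intended atoms among the variables of the consequent, hence
  among the shared ones, without affecting its truth. Refuting \<open>rhs\<close> means satisfying
  all of \<open>cluster_items\<close>.\<close>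

definition rhs :: fm where
  "rhs = imps (map (\<lambda>a. Imp (At a) (At a)) shared) (imps cluster_items Bot)"

definition relevant :: "atom \<Rightarrow> bool" where
  "relevant a \<longleftrightarrow> a = G E \<or> (\<exists>c i. i < P \<and> a = I (Label c) i) \<or>
     (\<exists>as bs. (as, bs) \<in> clauses \<and> a \<in> set (as @ bs)) \<or>
     (\<exists>s b bs. (s, b, bs) \<in> rules \<and> a \<in> set (b # bs))"

lemma boxed_item:
  assumes "x \<in> set (tree_items \<Delta> P)
      \<or> x \<in> clause_item ` clauses \<or> x \<in> rule_item ` rules"
  shows "x \<in> set items \<and> Box x \<in> set items"
  using assms unfolding set_items set_boxed by blast

lemma relevant_shared:
  assumes "relevant a"
  shows "idx a \<in> vars lhs \<inter> vars rhs"
proof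
  have "a \<in> set shared"
    using assms shared_E shared_label rules_shared clauses_shared unfolding relevant_def by fast
  then show "idx a \<in> vars rhs" by (auto simp: rhs_def)
  have "\<exists>x\<in>set items. idx a \<in> vars x"
    using assms unfolding relevant_def
  proof (elim disjE exE conjE)
    assume "a = G E"
    then have "idx a \<in> vars (Neg (At (G E)))" by simp
    moreover have "Neg (At (G E)) \<in> set items" by (simp add: set_items)
    ultimately show ?thesis by blast
  next
    fix c i assume "i < P" "a = I (Label c) i"
    then have "idx a \<in> vars (imps [At (I Match i), At (I (Bit c) i)] (At (I (Label c) i)))"
      by simp
    moreover have "imps [At (I Match i), At (I (Bit c) i)] (At (I (Label c) i)) \<in> set items"
      using \<open>i < P\<close> by (intro conjunct1[OF boxed_item] disjI1)
        (cases c, auto simp: level_items_def letter_items_def idx_inject intro!: bexI[of _ i])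
    ultimately show ?thesis by blast
  next
    fix as bs assume "(as, bs) \<in> clauses" "a \<in> set (as @ bs)"
    then have "idx a \<in> vars (clause_item (as, bs))" by (auto simp: clause_item_def)
    moreover have "clause_item (as, bs) \<in> set items"
      using boxed_item \<open>(as, bs) \<in> clauses\<close> by blast
    ultimately show ?thesis by blast
  next
    fix s b bs assume "(s, b, bs) \<in> rules" "a \<in> set (b # bs)"
    then have "idx a \<in> vars (rule_item (s, b, bs))" by (auto simp: rule_item_def)
    moreover have "rule_item (s, b, bs) \<in> set items"
      using boxed_item \<open>(s, b, bs) \<in> rules\<close> by blast
    ultimately show ?thesis by blast
  qed
  then show "idx a \<in> vars lhs" by (auto simp: lhs_def)
qed

text \<open>\<open>D\<close> has to stay private to the second formula: it singles out the root of
  the second model, whereas the bisimilar points of the tree are not to be distinguished in this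
  way.\<close>

lemma D_notin_lhs: "idx (G D) \<notin> vars lhs"
proof -
  have "idx (G D) \<notin> vars x" if x: "x \<in> set items" for x
  proof -
    have rule: "idx (G D) \<notin> vars (rule_item r)" if "r \<in> rules" for r
      using rules_shared[of "fst r" "fst (snd r)" "snd (snd r)"] that
      by (auto simp: rule_item_def idx_inject split: prod.splits)
    have clause: "idx (G D) \<notin> vars (clause_item r)" if "r \<in> clauses" for r
      using clauses_shared[of "fst r" "snd r"] that
      by (auto simp: clause_item_def idx_inject split: prod.splits)
    have const: "idx (G D) \<notin> vars y" if "y \<in> set const_items" for y
      using that by (auto simp: const_items_def idx_inject)
    have level: "idx (G D) \<notin> vars y" if "y \<in> set (level_items \<Delta> i)" for y i
      using that
      by (auto simp: level_items_def edge_item_def letter_items_def idx_inject)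
    have boxed: "idx (G D) \<notin> vars y"
      if "y \<in> set (tree_items \<Delta> P)" for y
      using that const level by (auto simp: idx_inject)
    consider "x \<in> {At (I Level P), Neg (At (G E))} \<union> At ` G ` Phase ` set S"
      | y where "x = y \<or> x = Box y"
          "y \<in> set (tree_items \<Delta> P)"
      | r where "r \<in> clauses" "x = clause_item r \<or> x = Box (clause_item r)"
      | r where "r \<in> rules" "x = rule_item r \<or> x = Box (rule_item r)"
      using x unfolding set_items set_boxed by blast
    then show ?thesis
    proof cases
      case 1
      then show ?thesis by (auto simp: idx_inject)
    next
      case (2 y)
      then show ?thesis using boxed[of y] by auto
    next
      case (3 r)
      then show ?thesis using clause[of r] by auto
    next
      case (4 r)
      then show ?thesis using rule[of r] by auto
    qed
  qed
  then show ?thesis by (auto simp: lhs_def)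
qed

text \<open>Points showing the same address may differ from each other, so \<open>T\<close> is read
  off one chosen leaf per address. A rule is then applied at the E-point of the path
  \<open>u\<close>, to copies below it of the two leaves chosen for its addresses; the copies agree
  with the originals on all shared atoms.\<close>

lemma bisimilar_solution:
  assumes wt: "weakly_transitive R" "weakly_transitive R'"
    and bis: "bisimulation (vars lhs \<inter> vars rhs) R V R' V' B" and B: "B r r'"
    and lhs: "sat R V r lhs" and rhs: "\<not> sat R' V' r' rhs"
  shows "\<exists>T. solution T"
proof -
  have item: "sat R V r x" if "x \<in> set items" for x
    using lhs that by (simp add: lhs_def)
  have "\<forall>x\<in>set cluster_items. sat R' V' r' x"
    using rhs by (simp add: rhs_def)
  then have no_D: "\<And>y. R' r' y \<Longrightarrow> \<not> V' y (idx (G D))"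
    and E_D: "\<And>y. R' r' y \<Longrightarrow> V' y (idx (G E)) \<Longrightarrow> \<exists>x. R' y x \<and> V' x (idx (G D))"
    and E_unique: "\<And>y x. R' r' y \<Longrightarrow> V' y (idx (G E)) \<Longrightarrow> R' y x \<Longrightarrow> \<not> V' x (idx (G E))"
    by (simp_all add: cluster_items_def)
  have agree: "V x (idx a) = V' y (idx a)" if "B x y" "relevant a" for x y a
    using bis that relevant_shared[of a] unfolding bisimulation_def by blast
  have zig: "\<exists>y'. R' y y' \<and> B x' y'" if "B x y" "R x x'" for x y x'
    using bis that unfolding bisimulation_def by meson
  have zag: "\<exists>x'. R x x' \<and> B x' y'" if "B x y" "R' y y'" for x y y'
    using bis that unfolding bisimulation_def by meson
  have rel_E: "relevant (G E)" and rel_Label: "i < P \<Longrightarrow> relevant (I (Label c) i)" for c i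
    by (auto simp: relevant_def)

  define reach where "reach x \<longleftrightarrow> x = r \<or> R r x" for x
  have reach_r: "reach r" by (simp add: reach_def)
  have reach_step: "reach y" if "reach x" "R x y" for x y
    using that wt(1) unfolding reach_def weakly_transitive_def by blast
  have everywhere: "sat R V x y"
    if "reach x" "y \<in> set (tree_items \<Delta> P)
      \<or> y \<in> clause_item ` clauses \<or> y \<in> rule_item ` rules" for x y
    using that(1) item[of y] item[of "Box y"] boxed_item[OF that(2)] by (auto simp: reach_def)
  have level: "sat R V x y" if "reach x" "i < P" "y \<in> set (level_items \<Delta> i)" for x i y
    using that by (intro everywhere) auto
  have letter: "sat R V x y" if "reach x" "i < P" "y \<in> set (letter_items i c)" for x i c y
    proof (rule level[OF that(1,2)])
    show "y \<in> set (level_items \<Delta> i)"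
      using that(3) unfolding level_items_def set_append set_concat set_map set_letters by blast
  qed
  have const: "sat R V x y" if "reach x" "y \<in> set const_items" for x y
    using that by (intro everywhere) auto

  have r_not_E: "\<not> V r (idx (G E))" using item[of "Neg (At (G E))"] by (simp add: set_items)
  have r_level: "V r (idx (I Level P))" using item[of "At (I Level P)"] by (simp add: set_items)
  have r_phase: "V r (idx (G (Phase s)))" if "s \<in> set S" for s
    using item[of "At (G (Phase s))"] that by (simp add: set_items)
  have bit: "V y (idx (I (Bit c) i))" if "reach x" "R x y" "i < P" "V x (idx (I (Bit c) i))" for x y c i
    using letter[OF that(1,3), of "Imp (At (I (Bit c) i)) (Box (At (I (Bit c) i)))" c] that
    by (simp add: letter_items_def)
  have bit': "V y (idx (I (Bit' c) i))" if "reach x" "R x y" "i < P" "V x (idx (I (Bit' c) i))" for x y c i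
    using letter[OF that(1,3), of "Imp (At (I (Bit' c) i)) (Box (At (I (Bit' c) i)))" c] that
    by (simp add: letter_items_def)

  \<comment> \<open>A partial path \<open>u\<close> holds the most significant digits, so its entry
    \<open>k\<close> is digit \<open>P - length u + k\<close> of the address and its point has level
    \<open>P - length u\<close>.\<close>
  have tree: "\<exists>w. reach w \<and> V w (idx (I Level (P - length u))) \<and> V w (idx (G (Phase s))) \<and>
      (\<forall>k<length u. V w (idx (I (Bit (fst (u ! k))) (P - length u + k))) \<and>
         V w (idx (I (Bit' (snd (u ! k))) (P - length u + k))))"
    if "run \<Delta> S u s" "length u \<le> P" for u s
    using that
  proof (induction u arbitrary: s)
    case Nil
    then show ?case using reach_r r_level r_phase by (intro exI[of _ r]) simp
  next
    case (Cons p u)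
    from Cons.prems obtain q where q: "run \<Delta> S u q" "(q, fst p, snd p, s) \<in> set \<Delta>" by auto
    from Cons.prems(2) have "length u \<le> P" by simp
    from Cons.IH[OF q(1) this] obtain w where w: "reach w" "V w (idx (I Level (P - length u)))"
        "V w (idx (G (Phase q)))" and
      bits: "\<And>k. k < length u \<Longrightarrow> V w (idx (I (Bit (fst (u ! k))) (P - length u + k)))"
        "\<And>k. k < length u \<Longrightarrow> V w (idx (I (Bit' (snd (u ! k))) (P - length u + k)))" by blast
    define i where "i = P - length (p # u)"
    with Cons.prems(2) have i: "i < P" "P - length u = Suc i" by auto
    have "sat R V w (edge_item i (q, fst p, snd p, s))"
      using q(2) by (intro level[OF w(1) i(1)]) (auto simp: level_items_def)
    then obtain x where x: "R w x" "V x (idx (I Level i))" "V x (idx (G (Phase s)))"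
        "V x (idx (I (Bit (fst p)) i))" "V x (idx (I (Bit' (snd p)) i))"
      using w(2,3) i(2) by (auto simp: edge_item_def)
    have "V x (idx (I (Bit (fst ((p # u) ! k))) (i + k))) \<and>
         V x (idx (I (Bit' (snd ((p # u) ! k))) (i + k)))" if "k < length (p # u)" for k
    proof (cases k)
      case 0
      then show ?thesis using x(4,5) by (simp)
    next
      case (Suc l)
      then have l: "l < length u" "i + k < P" "i + k = P - length u + l" using that i Cons.prems(2) by auto
      then show ?thesis
        using bits[OF l(1), folded l(3)] bit[OF w(1) x(1) l(2)] bit'[OF w(1) x(1) l(2)] Suc by auto
    qed
    then show ?case using reach_step[OF w(1) x(1)] x(2,3) unfolding i_def by blast
  qed

  define node where "node u s w \<longleftrightarrow> reach w \<and> V w (idx (G E)) \<and> V w (idx (G (Phase s))) \<and>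
      (\<forall>k<P. V w (idx (I (Bit (fst (u ! k))) k)) \<and> V w (idx (I (Bit' (snd (u ! k))) k)))" for u s w
  have ex_node: "\<exists>w. node u s w" if u: "run \<Delta> S u s" "length u = P" for u s
  proof -
    from tree[OF u(1)] u(2) obtain w where w: "reach w" "V w (idx (I Level 0))" "V w (idx (G (Phase s)))"
      "\<forall>k<P. V w (idx (I (Bit (fst (u ! k))) k)) \<and> V w (idx (I (Bit' (snd (u ! k))) k))"
      by (auto)
    have "V w (idx (G E))"
      using const[OF w(1), of "Imp (At (I Level 0)) (At (G E))"] w(2) by (simp add: const_items_def)
    with w show ?thesis unfolding node_def by blast
  qed

  have node_bit: "V l (idx (I (Bit (map fst u ! k)) k))" "V l (idx (I (Bit' (map snd u ! k)) k))"
    if "node u s w" "length u = P" "R w l" "k < P" for u s w l k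
    using that bit[of w l k "fst (u ! k)"] bit'[of w l k "snd (u ! k)"] by (simp_all add: node_def)

  text \<open>The root of the second model is the only point satisfying D and is seen by all E-points,
    hence these lie in its cluster, where an E-point sees every other one.\<close>
  have same: "y = y'" if y: "R' r' y" "V' y (idx (G E))" "R' r' y'" "V' y' (idx (G E))" for y y'
  proof -
    obtain x where x: "R' y x" "V' x (idx (G D))" using E_D[OF y(1,2)] by blast
    then have "x = r'" using wt(2) y(1) no_D[of x] unfolding weakly_transitive_def by blast
    then have "y = y' \<or> R' y y'" using wt(2) x(1) y(3) unfolding weakly_transitive_def by blast
    then show ?thesis using E_unique[OF y(1,2)] y(4) by blast
  qed
  \<comment> \<open>Neither E-point is the root, so the bisimulation takes both to successors of the
    second root, that is, to one and the same E-point. A successor of the first is carried there and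
    back to the second.\<close>
  have copy: "\<exists>l'. R w' l' \<and> (\<forall>a. relevant a \<longrightarrow> V l' (idx a) = V l (idx a))"
    if w: "reach w" "V w (idx (G E))" "reach w'" "V w' (idx (G E))" and l: "R w l" for w w' l
  proof -
    from w r_not_E have "R r w" "R r w'" by (auto simp: reach_def)
    then obtain y y' where y: "R' r' y" "B w y" "R' r' y'" "B w' y'" using zig[OF B] by blast
    then have "y = y'" using same agree[OF _ rel_E] w by blast
    with y l obtain m where m: "R' y m" "B l m" using zig by blast
    with y \<open>y = y'\<close> obtain l' where l': "R w' l'" "B l' m" using zag by blast
    with m agree show ?thesis by blast
  qed

  have match: "V x (idx (G Leaf))"
    if x: "reach x" and z: "\<And>k. k < P \<Longrightarrow> V x (idx (I (Bit (z ! k)) k)) \<and> V x (idx (I (Label (z ! k)) k))" for x z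
  proof -
    have "V x (idx (I Match (P - j)))" if "j \<le> P" for j
      using that
    proof (induction j)
      case 0
      then show ?case using everywhere[OF x, of "At (I Match P)"] by simp
    next
      case (Suc j)
      define i where "i = P - Suc j"
      with Suc.prems have "i < P" "P - j = Suc i" by auto
      with Suc z[of i] letter[OF x, of i "imps [At (I Match (Suc i)), At (I (Bit (z ! i)) i),
          At (I (Label (z ! i)) i)] (At (I Match i))" "z ! i"] show ?case
        by (simp add: letter_items_def i_def[symmetric])
    qed
    from this[of P] show ?thesis
      using const[OF x, of "Imp (At (I Match 0)) (At (G Leaf))"] by (simp add: const_items_def)
  qed
  have match': "V x (idx (G Leaf'))"
    if x: "reach x" and z: "\<And>k. k < P \<Longrightarrow> V x (idx (I (Bit' (z ! k)) k)) \<and> V x (idx (I (Label (z ! k)) k))" for x z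
  proof -
    have "V x (idx (I Match' (P - j)))" if "j \<le> P" for j
      using that
    proof (induction j)
      case 0
      then show ?case using everywhere[OF x, of "At (I Match' P)"] by simp
    next
      case (Suc j)
      define i where "i = P - Suc j"
      with Suc.prems have "i < P" "P - j = Suc i" by auto
      with Suc z[of i] letter[OF x, of i "imps [At (I Match' (Suc i)), At (I (Bit' (z ! i)) i),
          At (I (Label (z ! i)) i)] (At (I Match' i))" "z ! i"] show ?case
        by (simp add: letter_items_def i_def[symmetric])
    qed
    from this[of P] show ?thesis
      using const[OF x, of "Imp (At (I Match' 0)) (At (G Leaf'))"] by (simp add: const_items_def)
  qed
  have label: "V x (idx (I (Label (z ! k)) k))"
    if x: "reach x" "V x (idx (G Leaf))" and z: "\<And>k. k < P \<Longrightarrow> V x (idx (I (Bit (z ! k)) k))" and "k < P" for x z k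
  proof -
    have *: "V x (idx (I Match i))" if "i \<le> P" for i
      using that
    proof (induction i)
      case 0
      then show ?case
        using x const[OF x(1), of "Imp (At (G Leaf)) (At (I Match 0))"] by (simp add: const_items_def)
    next
      case (Suc i)
      then show ?case
        using level[OF x(1), of i "Imp (At (I Match i)) (At (I Match (Suc i)))"]
        by (simp add: level_items_def)
    qed
    from *[of k] \<open>k < P\<close> z[of k] show ?thesis
      using letter[OF x(1), of k "imps [At (I Match k), At (I (Bit (z ! k)) k)] (At (I (Label (z ! k)) k))" "z ! k"]
      by (simp add: letter_items_def)
  qed

  \<comment> \<open>Only the address shown matters here, not the E-point above; the choice of one
    such point per address is made by \<open>f\<close>.\<close>
  define leaf where "leaf z l \<longleftrightarrow> (\<exists>w. reach w \<and> V w (idx (G E)) \<and> R w l) \<and> V l (idx (G Leaf)) \<and>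
      (\<forall>k<P. V l (idx (I (Label (z ! k)) k)))" for z l
  have ex_leaf: "\<exists>l. leaf z l" if "length z = P" for z
  proof -
    from covered[OF that] obtain u s where u: "run \<Delta> S u s" "map fst u = z" by blast
    then have "length u = P" using that by auto
    with ex_node u obtain w where w: "node u s w" by blast
    have "sat R V w (Imp (At (G E)) (Dia (At (G Leaf))))"
      using w by (intro const) (auto simp: node_def const_items_def)
    with w obtain l where l: "R w l" "V l (idx (G Leaf))" by (auto simp: node_def)
    with w reach_step have "reach l" by (auto simp: node_def)
    moreover have "V l (idx (I (Bit (z ! k)) k))" if "k < P" for k
      using node_bit(1)[OF w \<open>length u = P\<close> l(1) that] u(2) by simp
    ultimately have "V l (idx (I (Label (z ! k)) k))" if "k < P" for k
      using label[OF _ l(2)] that by blast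
    with l w show ?thesis by (auto simp: leaf_def node_def)
  qed
  define f where "f z = (SOME l. leaf z l)" for z
  define T where "T z a \<longleftrightarrow> V (f z) (idx a)" for z a
  have leaf: "leaf z (f z)" if "length z = P" for z
    unfolding f_def using someI_ex[OF ex_leaf[OF that]] .
  have "solution T"
    unfolding solves_def
  proof (intro conjI allI impI)
    fix z :: "letter list" and as bs
    assume z: "length z = P" and c: "(as, bs) \<in> clauses" and "\<forall>a\<in>set as. T z a"
    moreover from leaf[OF z] have "reach (f z)" "V (f z) (idx (G Leaf))"
      using reach_step by (auto simp: leaf_def)
    moreover have "sat R V (f z) (clause_item (as, bs))"
      using c calculation by (intro everywhere) auto
    ultimately show "\<exists>b\<in>set bs. T z b" by (auto simp: clause_item_def T_def)
  next
    fix u s a bs assume u: "length u = P" "run \<Delta> S u s" and c: "(s, a, bs) \<in> rules" and a: "T (map fst u) a"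
    from ex_node[OF u(2,1)] obtain w where w: "node u s w" by blast
    have view: "\<exists>l'. R w l' \<and> (\<forall>a. relevant a \<longrightarrow> V l' (idx a) = T z a) \<and>
      (\<forall>k<P. V l' (idx (I (Label (z ! k)) k)))" if "length z = P" for z
    proof -
      from leaf[OF that] copy w obtain l' where "R w l'"
          "\<And>a. relevant a \<Longrightarrow> V l' (idx a) = V (f z) (idx a)"
        unfolding leaf_def node_def by blast
      moreover have "V (f z) (idx (I (Label (z ! k)) k))" if "k < P" for k
        using leaf[OF \<open>length z = P\<close>] that by (simp add: leaf_def)
      ultimately show ?thesis using rel_Label unfolding T_def by metis
    qed
    from view[of "map fst u"] u(1) obtain l where l: "R w l" "V l (idx a) = T (map fst u) a"
        "\<And>k. k < P \<Longrightarrow> V l (idx (I (Label (map fst u ! k)) k))"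
      using c unfolding relevant_def by (metis length_map list.set_intros(1))
    \<comment> \<open>\<open>Leaf\<close> is not shared and is not inherited by the copy; it holds
      because the label of the copy agrees with the digits received from \<open>w\<close>.\<close>
    have "V l (idx (I (Bit (map fst u ! k)) k))" if "k < P" for k
      using node_bit(1)[OF w u(1) l(1) that] .
    then have Leaf: "V l (idx (G Leaf))"
      using match[of l "map fst u"] l reach_step[of w l] w by (auto simp: node_def)
    from view[of "map snd u"] u(1) obtain l' where l': "R w l'"
        "\<And>a. relevant a \<Longrightarrow> V l' (idx a) = T (map snd u) a"
        "\<And>k. k < P \<Longrightarrow> V l' (idx (I (Label (map snd u ! k)) k))"
      by (metis length_map)
    have "V l' (idx (I (Bit' (map snd u ! k)) k))" if "k < P" for k
      using node_bit(2)[OF w u(1) l'(1) that] .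
    then have Leaf': "V l' (idx (G Leaf'))"
      using match'[of l' "map snd u"] l' reach_step[of w l'] w by (auto simp: node_def)
    have "sat R V w (rule_item (s, a, bs))"
      using w everywhere[OF _ disjI2[OF disjI2[OF imageI[OF c]]]] by (simp add: node_def)
    then have "\<exists>b\<in>set bs. V l' (idx b)"
      using l(1,2) a Leaf l'(1) Leaf' w by (auto simp: rule_item_def node_def)
    moreover have "relevant b" if "b \<in> set bs" for b
      using c that unfolding relevant_def by (metis list.set_intros(2))
    ultimately show "\<exists>b\<in>set bs. T (map snd u) b" using l'(2) by blast
  qed
  then show ?thesis by blast
qed

end

section \<open>Two bisimilar models of a solution\<close>

text \<open>A full-length \<open>Node\<close> is an E-point and must not see an E-point, yet has to
  imitate \<open>Center\<close>, which sees the points without \<open>E\<close> in its cluster; its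
  \<open>Partner\<close> supplies these. \<open>Twig u z\<close> is the copy, below the path
  \<open>u\<close>, of the leaf showing address \<open>z\<close>.\<close>

datatype tree_point = Node "(letter \<times> letter) list" | Partner "(letter \<times> letter) list"
  | Twig "(letter \<times> letter) list" "letter list"

text \<open>\<open>Root\<close> satisfies \<open>D\<close> and so cannot see itself, but partners
  are related to it and do see themselves. The reflexive \<open>Root'\<close> provides the matching
  successor.\<close>

datatype cluster_point = Root | Root' | Center | Tip "letter list"

fun path :: "tree_point \<Rightarrow> (letter \<times> letter) list" where
  "path (Node u) = u"
| "path (Partner u) = u"
| "path (Twig u z) = u"

text \<open>The position is counted from the end of the path, so the digit does not change when the
  path is extended at its front.\<close>

definition chosen :: "nat \<Rightarrow> ((letter \<times> letter) \<Rightarrow> letter) \<Rightarrow> tree_point \<Rightarrow> nat \<Rightarrow> letter \<Rightarrow> bool" where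
  "chosen P f x i c \<longleftrightarrow> (\<exists>v p u. path x = v @ p # u \<and> length u + Suc i = P \<and> f p = c)"

lemma chosen_mono: "chosen P f x i c \<Longrightarrow> path y = v @ path x \<Longrightarrow> chosen P f y i c"
  unfolding chosen_def by (metis append.assoc)

lemma chosen_unique: "chosen P f x i c \<Longrightarrow> chosen P f x i d \<Longrightarrow> c = d"
  unfolding chosen_def by (smt (verit) add_right_cancel append_eq_append_conv list.inject length_Cons)

lemma chosen_nth:
  assumes "length (path x) = P" "i < P"
  shows "chosen P f x i (f (path x ! i))"
  unfolding chosen_def
  using assms id_take_nth_drop[of i "path x"]
  by (intro exI[of _ "take i (path x)"] exI[of _ "path x ! i"] exI[of _ "drop (Suc i) (path x)"]) auto

lemma chosen_full: "length (path x) = P \<Longrightarrow> i < P \<Longrightarrow> chosen P f x i c \<longleftrightarrow> c = f (path x ! i)"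
  using chosen_nth chosen_unique by blast

context gadget
begin

fun legal :: "tree_point \<Rightarrow> bool" where
  "legal (Node u) \<longleftrightarrow> length u \<le> P"
| "legal (Partner u) \<longleftrightarrow> length u = P"
| "legal (Twig u z) \<longleftrightarrow> length u = P \<and> length z = P"

definition tree_R :: "tree_point \<Rightarrow> tree_point \<Rightarrow> bool" where
  "tree_R x y \<longleftrightarrow> legal x \<and> legal y \<and> (\<forall>u z. x \<noteq> Twig u z) \<and> (\<exists>v. path y = v @ path x) \<and>
     \<not> (x = y \<and> (\<exists>u. x = Node u))"

fun cluster_R :: "cluster_point \<Rightarrow> cluster_point \<Rightarrow> bool" where
  "cluster_R (Tip z) y \<longleftrightarrow> False"
| "cluster_R x (Tip z) \<longleftrightarrow> length z = P"
| "cluster_R x y \<longleftrightarrow> x \<noteq> y \<or> x = Root'"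

text \<open>Agreement from \<open>P\<close> on is vacuous and holds at all points, as the items
  require; below \<open>P\<close> it is reserved to twigs.\<close>

definition matching :: "((letter \<times> letter) \<Rightarrow> letter) \<Rightarrow> tree_point \<Rightarrow> nat \<Rightarrow> bool" where
  "matching f x i \<longleftrightarrow> P \<le> i \<or> (\<exists>u z. x = Twig u z \<and> (\<forall>j. i \<le> j \<and> j < P \<longrightarrow> z ! j = f (u ! j)))"

fun tree_val :: "(letter list \<Rightarrow> atom \<Rightarrow> bool) \<Rightarrow> tree_point \<Rightarrow> atom \<Rightarrow> bool" where
  "tree_val T x (G E) \<longleftrightarrow> (\<exists>u. x = Node u \<and> length u = P)"
| "tree_val T x (G D) \<longleftrightarrow> False"
| "tree_val T x (G Leaf) \<longleftrightarrow> matching fst x 0"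
| "tree_val T x (G Leaf') \<longleftrightarrow> matching snd x 0"
| "tree_val T x (G (Phase s)) \<longleftrightarrow> (\<exists>u. x = Node u \<and> run \<Delta> S u s)"
| "tree_val T x (G (Tile k)) \<longleftrightarrow> (\<exists>u z. x = Twig u z \<and> T z (G (Tile k)))"
| "tree_val T x (I Mark i) \<longleftrightarrow> (\<exists>u z. x = Twig u z \<and> T z (I Mark i))"
| "tree_val T x (I Level i) \<longleftrightarrow> (\<exists>u. x = Node u \<and> length u + i = P)"
| "tree_val T x (I Match i) \<longleftrightarrow> matching fst x i"
| "tree_val T x (I Match' i) \<longleftrightarrow> matching snd x i"
| "tree_val T x (I (Bit c) i) \<longleftrightarrow> chosen P fst x i c"
| "tree_val T x (I (Bit' c) i) \<longleftrightarrow> chosen P snd x i c"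
| "tree_val T x (I (Label c) i) \<longleftrightarrow> (\<exists>u z. x = Twig u z \<and> z ! i = c)"

fun cluster_val :: "(letter list \<Rightarrow> atom \<Rightarrow> bool) \<Rightarrow> cluster_point \<Rightarrow> atom \<Rightarrow> bool" where
  "cluster_val T x (G E) \<longleftrightarrow> x = Center"
| "cluster_val T x (G D) \<longleftrightarrow> x = Root"
| "cluster_val T x (I (Label c) i) \<longleftrightarrow> (\<exists>z. x = Tip z \<and> z ! i = c)"
| "cluster_val T x a \<longleftrightarrow> (\<exists>z. x = Tip z \<and> T z a)"

text \<open>Addresses are forgotten: all full-length nodes go to the one \<open>Center\<close>. The
  other nodes and the partners are related to both \<open>Root\<close> and \<open>Root'\<close>,
  which differ only in \<open>D\<close> and in the loop.\<close>

definition collapse :: "tree_point \<Rightarrow> cluster_point \<Rightarrow> bool" where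
  "collapse x y \<longleftrightarrow> legal x \<and>
     (case x of
        Node u \<Rightarrow> if length u = P then y = Center else y = Root \<or> y = Root'
      | Partner u \<Rightarrow> y = Root \<or> y = Root'
      | Twig u z \<Rightarrow> y = Tip z)"

text \<open>Extension of paths is transitive, and the only pairs left out for this reason are loops
  at nodes, which weak transitivity tolerates.\<close>

lemma weakly_transitive_tree: "weakly_transitive tree_R"
  unfolding weakly_transitive_def
proof (intro allI impI)
  fix x y z assume *: "tree_R x y" "tree_R y z"
  then obtain v w where "path y = v @ path x" "path z = w @ path y" by (auto simp: tree_R_def)
  then have "\<exists>v. path z = v @ path x" by simp
  with * show "x = z \<or> tree_R x z" by (auto simp: tree_R_def)
qed

lemma weakly_transitive_cluster: "weakly_transitive cluster_R"
  unfolding weakly_transitive_def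
proof (intro allI impI)
  fix x y z assume "cluster_R x y" "cluster_R y z"
  then show "x = z \<or> cluster_R x z" by (cases x; cases y; cases z) auto
qed

text \<open>The rules are the crucial case. The twigs seen by a full-length \<open>Node u\<close>
  have the form \<open>Twig u z\<close>; on them \<open>Leaf\<close> forces
  \<open>z = map fst u\<close> and \<open>Leaf'\<close> forces \<open>z = map snd u\<close>, so a
  rule formula says just what \<open>solves\<close> demands of \<open>u\<close>.\<close>

lemma sat_tree_items:
  assumes T: "solution T" and x: "x \<in> set items"
  shows "sat tree_R (atom_val (tree_val T)) (Node []) x"
proof -
  let ?sat = "sat tree_R (atom_val (tree_val T))"
  have const: "?sat y c" if "c \<in> set const_items" "legal y" for y c
  proof -
    have "\<exists>l. tree_R (Node u) l \<and> matching fst l 0" if "length u = P" for u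
      using that by (intro exI[of _ "Twig u (map fst u)"]) (auto simp: tree_R_def matching_def)
    then show ?thesis using that by (auto simp: const_items_def)
  qed
  have edge: "?sat y (edge_item i e)" if "i < P" "e \<in> set \<Delta>" "legal y" for y i e
  proof -
    obtain s c c' s' where e: "e = (s, c, c', s')" by (cases e)
    have "\<exists>l. tree_R (Node u) l \<and> tree_val T l (I Level i) \<and> tree_val T l (G (Phase s')) \<and>
        tree_val T l (I (Bit c) i) \<and> tree_val T l (I (Bit' c') i)"
      if u: "length u + Suc i = P" "run \<Delta> S u s" for u
    proof (intro exI[of _ "Node ((c, c') # u)"] conjI)
      show "tree_R (Node u) (Node ((c, c') # u))" using u by (auto simp: tree_R_def)
      show "tree_val T (Node ((c, c') # u)) (G (Phase s'))"
        using u \<open>e \<in> set \<Delta>\<close> e by auto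
      show "tree_val T (Node ((c, c') # u)) (I (Bit c) i)"
        "tree_val T (Node ((c, c') # u)) (I (Bit' c') i)"
        using u unfolding tree_val.simps chosen_def
        by (intro exI[of _ "[]"] exI[of _ "(c, c')"] exI[of _ u]; simp)+
    qed (use u in auto)
    then show ?thesis by (auto simp: edge_item_def e)
  qed
  have letter: "?sat y d" if "i < P" "d \<in> set (letter_items i c)" "legal y" for y i c d
  proof -
    have matching: "matching f y i"
      if "matching f y (Suc i)" "chosen P f y i c" "y = Twig u z" "z ! i = c" for f u z
    proof -
      have "z ! j = f (u ! j)" if "i \<le> j" "j < P" for j
      proof (cases "j = i")
        case True
        then show ?thesis
          using \<open>y = Twig u z\<close> \<open>z ! i = c\<close> \<open>chosen P f y i c\<close> chosen_full[of y P i f c] \<open>legal y\<close> \<open>i < P\<close> by simp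
      next
        case False
        with that show ?thesis
          using \<open>matching f y (Suc i)\<close> \<open>y = Twig u z\<close> by (auto simp: matching_def)
      qed
      with \<open>y = Twig u z\<close> show ?thesis by (simp add: matching_def)
    qed
    have "c = z ! i" if "matching fst y i" "chosen P fst y i c" "y = Twig u z" for u z
      using that chosen_full[of y P i fst c] \<open>legal y\<close> \<open>i < P\<close> by (auto simp: matching_def)
    moreover have "\<exists>u z. y = Twig u z" if "matching fst y i"
      using that \<open>i < P\<close> by (auto simp: matching_def)
    moreover have "chosen P f l i c" if "chosen P f y i c" "tree_R y l" for f l
      using that chosen_mono[of P f y i c l] by (auto simp: tree_R_def)
    ultimately show ?thesis
      using that(2) matching by (auto simp: letter_items_def)
  qed
  have level: "?sat y d" if "i < P" "d \<in> set (level_items \<Delta> i)" "legal y" for y i d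
  proof -
    have "?sat y (Imp (At (I Match i)) (At (I Match (Suc i))))" by (auto simp: matching_def)
    with that edge letter show ?thesis
      unfolding level_items_def set_append set_concat set_map by (elim UnE imageE UN_E) auto
  qed
  have clause: "?sat y (clause_item r)" if "r \<in> clauses" "legal y" for y r
  proof -
    obtain as bs where r: "r = (as, bs)" by (cases r)
    have tile: "tree_val T (Twig u z) a = T z a" if "a \<in> set (as @ bs)" for u z a
      using that clauses_shared[of as bs] \<open>r \<in> clauses\<close> r by (cases a rule: tile_atom.cases) auto
    have "\<exists>b\<in>set bs. T z b" if "y = Twig u z" "\<forall>a\<in>set as. T z a" for u z
      using T that \<open>legal y\<close> \<open>r \<in> clauses\<close> r unfolding solves_def by auto
    then show ?thesis using tile P_pos by (auto simp: clause_item_def r matching_def)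
  qed
  have rule: "?sat y (rule_item r)" if "r \<in> rules" "legal y" for y r
  proof -
    obtain s a bs where r: "r = (s, a, bs)" by (cases r)
    have tile: "tree_val T (Twig u z) b = T z b" if "b \<in> set (a # bs)" for u z b
      using that rules_shared[of s a bs] \<open>r \<in> rules\<close> r by (cases b rule: tile_atom.cases) auto
    have full: "z = map f u" if "matching f (Twig u z) 0" "legal (Twig u z)" for f u z
      using that P_pos by (auto simp: matching_def intro!: nth_equalityI)
    have Twig: "\<exists>z. l = Twig u z \<and> legal (Twig u z)"
      if l: "tree_R (Node u) l" and u: "length u = P" and "matching f l 0" for u l f
    proof -
      obtain v z where v: "l = Twig v z"
        using \<open>matching f l 0\<close> P_pos unfolding matching_def by blast
      then have legal: "legal (Twig v z)" and "\<exists>w. v = w @ u" using l by (simp_all add: tree_R_def)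
      then have "v = u" using u by auto
      with v legal show ?thesis by blast
    qed
    have "\<exists>b\<in>set bs. tree_val T l' b"
      if u: "y = Node u" "length u = P" "run \<Delta> S u s"
        and l: "tree_R y l" "matching fst l 0" "tree_val T l a" and l': "tree_R y l'" "matching snd l' 0" for u l l'
    proof -
      from Twig u l obtain z where z: "l = Twig u z" "legal (Twig u z)" by blast
      from Twig u l' obtain z' where z': "l' = Twig u z'" "legal (Twig u z')" by blast
      have "T (map fst u) a" using tile l(2,3) z full by auto
      then have "\<exists>b\<in>set bs. T (map snd u) b"
        using T u \<open>r \<in> rules\<close> r unfolding solves_def by blast
      then show ?thesis using tile l'(2) z' full by auto
    qed
    then show ?thesis by (auto simp: rule_item_def r)
  qed
  have [simp]: "legal y" if "tree_R x y" for x y using that by (simp add: tree_R_def)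
  have boxed: "?sat y c" if "legal y" "c \<in> set (tree_items \<Delta> P)" for y c
    using that const level by (auto simp: matching_def)
  have "x \<in> {At (I Level P), Neg (At (G E))} \<union> At ` G ` Phase ` set S \<or>
      (\<exists>y. (x = y \<or> x = Box y) \<and> y \<in> set (tree_items \<Delta> P)) \<or>
      (\<exists>r \<in> clauses. x = clause_item r \<or> x = Box (clause_item r)) \<or>
      (\<exists>r \<in> rules. x = rule_item r \<or> x = Box (rule_item r))"
    using x unfolding set_items set_boxed by blast
  then show ?thesis
  proof (elim disjE exE bexE conjE)
    assume "x \<in> {At (I Level P), Neg (At (G E))} \<union> At ` G ` Phase ` set S"
    then show ?thesis using P_pos by auto
  next
    fix y assume "x = y" "y \<in> set (tree_items \<Delta> P)"
    then show ?thesis using boxed[of "Node []" y] by simp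
  next
    fix y assume "x = Box y" "y \<in> set (tree_items \<Delta> P)"
    then show ?thesis using boxed[of _ y] by simp
  qed (use clause rule in simp_all)
qed

lemma bisimulation_collapse:
  assumes "\<sigma> \<subseteq> idx ` {a. a = G E \<or> label_atom a}"
  shows "bisimulation \<sigma> tree_R (atom_val (tree_val T)) cluster_R (atom_val (cluster_val T)) collapse"
  unfolding bisimulation_def
proof (intro allI impI conjI ballI)
  fix x y n assume xy: "collapse x y" and n: "n \<in> \<sigma>"
  then obtain a where a: "n = idx a" "a = G E \<or> label_atom a" using assms by blast
  have iff: "(\<exists>u. x = Node u \<and> length u = P) \<longleftrightarrow> y = Center"
    "(\<exists>u z. x = Twig u z \<and> Q z) \<longleftrightarrow> (\<exists>z. y = Tip z \<and> Q z)" for Q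
    using xy by (cases x; auto simp: collapse_def split: if_splits)+
  consider "a = G E" | k where "a = G (Tile k)" | i where "a = I Mark i"
    | c i where "a = I (Label c) i"
    using a(2) by (cases a rule: label_atom.cases) (auto elim: tile_atom.elims)
  then show "atom_val (tree_val T) x n = atom_val (cluster_val T) y n"
    by cases (simp_all only: a(1) atom_val_idx tree_val.simps cluster_val.simps iff)
next
  fix x y x' assume xy: "collapse x y" and x': "tree_R x x'"
  then have y: "y = Root \<or> y = Root' \<or> y = Center"
    by (cases x) (auto simp: collapse_def tree_R_def split: if_splits)
  have legal: "legal x'" using x' by (simp add: tree_R_def)
  show "\<exists>y'. cluster_R y y' \<and> collapse x' y'"
  proof (cases "\<exists>u. x' = Node u \<and> length u = P")
    case True
    \<comment> \<open>Of two full-length paths one can extend the other only if they are equal, and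
      nodes have no loop.\<close>
    have "y \<noteq> Center"
    proof
      assume "y = Center"
      with xy obtain w where "x = Node w" "length w = P"
        by (cases x) (auto simp: collapse_def split: if_splits)
      with True x' show False by (auto simp: tree_R_def)
    qed
    with y have "cluster_R y Center" by auto
    moreover have "collapse x' Center" using True legal by (auto simp: collapse_def)
    ultimately show ?thesis by blast
  next
    case False
    show ?thesis
    proof (cases "\<exists>u z. x' = Twig u z")
      case True
      then obtain u z where "x' = Twig u z" by blast
      with legal have "length z = P" "collapse x' (Tip z)" by (simp_all add: collapse_def)
      moreover from this y have "cluster_R y (Tip z)" by (elim disjE) simp_all
      ultimately have "cluster_R y (Tip z)" "collapse x' (Tip z)" by blast+
      then show ?thesis by blast
    next
      case False
      with \<open>\<not> (\<exists>u. x' = Node u \<and> length u = P)\<close> legal have "collapse x' Root'"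
        by (cases x') (auto simp: collapse_def)
      moreover have "cluster_R y Root'" using y by auto
      ultimately show ?thesis by blast
    qed
  qed
next
  fix x y y' assume xy: "collapse x y" and y': "cluster_R y y'"
  have legal: "legal x" using xy by (simp add: collapse_def)
  then have "length (path x) \<le> P" by (cases x) auto
  \<comment> \<open>The tree branches over all pairs of letters, whether or not the automaton has a
    run, so arbitrary filler digits extend the path to full length.\<close>
  define u where "u = replicate (P - length (path x)) undefined @ path x"
  have u: "length u = P" "\<exists>v. u = v @ path x" using \<open>length (path x) \<le> P\<close> by (auto simp: u_def)
  have no_Twig: "\<forall>w z. x \<noteq> Twig w z" using xy y' by (auto simp: collapse_def)
  show "\<exists>x'. tree_R x x' \<and> collapse x' y'"
  proof (cases y')
    case (Tip z)
    then have "length z = P" using y' by (cases y) auto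
    with u legal no_Twig Tip have "tree_R x (Twig u z)" "collapse (Twig u z) y'"
      by (simp_all add: tree_R_def collapse_def)
    then show ?thesis by blast
  next
    case Center
    have "x \<noteq> Node u"
    proof
      assume "x = Node u"
      with xy u(1) have "y = Center" by (simp add: collapse_def)
      with Center y' show False by simp
    qed
    with u legal no_Twig Center have "tree_R x (Node u)" "collapse (Node u) y'"
      by (simp_all add: tree_R_def collapse_def)
    then show ?thesis by blast
  qed (use u legal no_Twig in \<open>simp_all add: tree_R_def collapse_def exI[of _ "Partner u"]\<close>)
qed

lemma not_sat_rhs: "\<not> sat cluster_R (atom_val (cluster_val T)) Root rhs"
proof -
  have "sat cluster_R (atom_val (cluster_val T)) Root x" if "x \<in> set cluster_items" for x
  proof -
    have "y = Root' \<or> y = Center \<or> (\<exists>z. y = Tip z)" if "cluster_R Root y" for y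
      using that by (cases y) auto
    moreover have "cluster_R Center Root" by simp
    ultimately show ?thesis using that by (auto simp: cluster_items_def simp del: cluster_R.simps) auto
  qed
  then show ?thesis by (auto simp: rhs_def)
qed

theorem interpolant_iff: "(\<exists>\<iota>. interpolant wK4 lhs rhs \<iota>) \<longleftrightarrow> \<not> (\<exists>T. solution T)"
proof
  assume *: "\<exists>\<iota>. interpolant wK4 lhs rhs \<iota>"
  show "\<not> (\<exists>T. solution T)"
  proof
    assume "\<exists>T. solution T"
    then obtain T where T: "solution T" by blast
    have "vars lhs \<inter> vars rhs \<subseteq> idx ` {a. a = G E \<or> label_atom a}"
      using D_notin_lhs shared_E shared_only by (auto simp: rhs_def cluster_items_def)
    note bis = bisimulation_collapse[OF this, of T]
    have "collapse (Node []) Root" using P_pos by (simp add: collapse_def)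
    moreover have "sat tree_R (atom_val (tree_val T)) (Node []) lhs"
      using sat_tree_items[OF T] by (simp add: lhs_def)
    ultimately show False
      using bisimilar_no_interpolant[OF weakly_transitive_tree weakly_transitive_cluster bis]
        not_sat_rhs * by blast
  qed
next
  assume *: "\<not> (\<exists>T. solution T)"
  show "\<exists>\<iota>. interpolant wK4 lhs rhs \<iota>"
  proof (rule ccontr)
    assume no: "\<nexists>\<iota>. interpolant wK4 lhs rhs \<iota>"
    obtain X Y where XY: "mcs X" "mcs Y" "lhs \<in> X" "rhs \<notin> Y"
        "\<And>\<chi>. vars \<chi> \<subseteq> vars lhs \<inter> vars rhs \<Longrightarrow> \<chi> \<in> X \<longleftrightarrow> \<chi> \<in> Y"
      using no_interpolant_canon[OF no] by blast
    have "\<exists>T. solution T"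
      by (rule bisimilar_solution[OF weakly_transitive_canon weakly_transitive_canon
            bisimulation_canon, of X Y]) (use XY in \<open>auto simp: canon_sat\<close>)
    with * show False by blast
  qed
qed

end


section \<open>Adjacency of binary addresses\<close>

fun val :: "bool list \<Rightarrow> nat" where
  "val [] = 0"
| "val (b # bs) = of_bool b + 2 * val bs"

fun bits :: "nat \<Rightarrow> nat \<Rightarrow> bool list" where
  "bits 0 m = []"
| "bits (Suc n) m = odd m # bits n (m div 2)"

lemma length_bits [simp]: "length (bits n m) = n"
  by (induction n arbitrary: m) auto

lemma val_bits: "m < 2 ^ n \<Longrightarrow> val (bits n m) = m"
proof (induction n arbitrary: m)
  case (Suc n)
  from Suc.prems have "m div 2 < 2 ^ n" by simp
  from Suc.IH[OF this] show ?case by simp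
qed simp

lemma val_less: "val bs < 2 ^ length bs"
  by (induction bs) (auto simp: of_bool_def)

definition time :: "letter list \<Rightarrow> nat" where "time z = val (map fst z)"
definition offset :: "letter list \<Rightarrow> nat" where "offset z = val (map snd z)"

definition address :: "nat \<Rightarrow> nat \<Rightarrow> nat \<Rightarrow> letter list" where
  "address P t y = zip (bits P t) (bits P y)"

lemma address:
  "length (address P t y) = P"
  "t < 2 ^ P \<Longrightarrow> time (address P t y) = t" "y < 2 ^ P \<Longrightarrow> offset (address P t y) = y"
  by (simp_all add: address_def time_def offset_def val_bits)

lemma time_less: "length z = P \<Longrightarrow> time z < 2 ^ P"
  and offset_less: "length z = P \<Longrightarrow> offset z < 2 ^ P"
  using val_less[of "map fst z"] val_less[of "map snd z"] by (auto simp: time_def offset_def)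

text \<open>The flags give the difference of the two numbers on the digits read so far, the most
  significant ones. A further digit doubles the difference and adds that of the new digits. A
  difference outside the range 0 to 1 could never return to it, so two states are enough.\<close>

fun time_step :: "bool \<Rightarrow> bool \<Rightarrow> bool \<Rightarrow> bool \<Rightarrow> bool" where
  "time_step False b b' later \<longleftrightarrow> (if later then \<not> b \<and> b' else b = b')"
| "time_step True b b' later \<longleftrightarrow> later \<and> b \<and> \<not> b'"

text \<open>The same bookkeeping with differences 0, 1 (\<open>Up\<close>) and -1
  (\<open>Down\<close>), now modulo a power of two.\<close>

fun offset_step :: "shift \<Rightarrow> bool \<Rightarrow> bool \<Rightarrow> shift \<Rightarrow> bool" where
  "offset_step Same b b' Same \<longleftrightarrow> b = b'"
| "offset_step Same b b' Up \<longleftrightarrow> \<not> b \<and> b'"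
| "offset_step Same b b' Down \<longleftrightarrow> b \<and> \<not> b'"
| "offset_step Up b b' p \<longleftrightarrow> p = Up \<and> b \<and> \<not> b'"
| "offset_step Down b b' p \<longleftrightarrow> p = Down \<and> \<not> b \<and> b'"

fun trans :: "phase \<Rightarrow> letter \<Rightarrow> letter \<Rightarrow> phase \<Rightarrow> bool" where
  "trans TimeZero c c' s \<longleftrightarrow> c = c' \<and> s = (if fst c then TimePos else TimeZero)"
| "trans TimePos c c' s \<longleftrightarrow> c = c' \<and> s = TimePos"
| "trans OffsetZero c c' s \<longleftrightarrow> c = c' \<and> s = (if snd c then OffsetPos else OffsetZero)"
| "trans OffsetPos c c' s \<longleftrightarrow> c = c' \<and> s = OffsetPos"
| "trans (Rel b p) c c' s \<longleftrightarrow>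
     (\<exists>b' p'. s = Rel b' p' \<and> time_step b (fst c) (fst c') b' \<and> offset_step p (snd c) (snd c') p')"

definition phases :: "phase list" where
  "phases = [TimeZero, TimePos, OffsetZero, OffsetPos, Rel False Same, Rel False Up, Rel False Down,
     Rel True Same, Rel True Up, Rel True Down]"

lemma set_phases [simp]: "set phases = UNIV"
proof -
  have "s \<in> set phases" for s
  proof (cases s)
    case (Rel b p)
    then show ?thesis by (cases b; cases p) (auto simp: phases_def)
  qed (auto simp: phases_def)
  then show ?thesis by auto
qed

definition edges :: "edge list" where
  "edges = filter (\<lambda>(s, c, c', s'). trans s c c' s')
     (List.product phases (List.product letters (List.product letters phases)))"

lemma set_edges [simp]: "(s, c, c', s') \<in> set edges \<longleftrightarrow> trans s c c' s'"
  by (simp add: edges_def)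

text \<open>Before any digit is read both times are 0, so the time difference starts at 0 and time
  never wraps around. Modulo \<open>2 ^ 0\<close>, however, every cyclic shift holds, so all three
  offset states may start.\<close>

definition starts :: "phase list" where
  "starts = [TimeZero, OffsetZero, Rel False Same, Rel False Up, Rel False Down]"

abbreviation "reaches \<equiv> run edges starts"

lemma reaches_zero_test:
  assumes start: "z \<in> set starts" "p \<notin> set starts"
    and z: "\<And>r c c'. trans r c c' z \<longleftrightarrow> r = z \<and> c = c' \<and> \<not> g c"
    and p: "\<And>r c c'. trans r c c' p \<longleftrightarrow> c = c' \<and> (r = p \<or> r = z \<and> g c)"
  shows "reaches u z \<longleftrightarrow> map fst u = map snd u \<and> val (map g (map fst u)) = 0"
    and "reaches u p \<longleftrightarrow> map fst u = map snd u \<and> val (map g (map fst u)) \<noteq> 0"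
proof (induction u)
  case (Cons x u)
  {
    case 1 show ?case using Cons by (auto simp: z)
  next
    case 2 show ?case using Cons by (auto simp: p)
  }
qed (use start in auto)

lemma reaches_time:
  "reaches u TimeZero \<longleftrightarrow> map fst u = map snd u \<and> time (map fst u) = 0"
  "reaches u TimePos \<longleftrightarrow> map fst u = map snd u \<and> time (map fst u) \<noteq> 0"
proof -
  have "trans r c c' TimeZero \<longleftrightarrow> r = TimeZero \<and> c = c' \<and> \<not> fst c"
    "trans r c c' TimePos \<longleftrightarrow> c = c' \<and> (r = TimePos \<or> r = TimeZero \<and> fst c)" for r c c'
    by (cases r; auto)+
  from reaches_zero_test[OF _ _ this]
  show "reaches u TimeZero \<longleftrightarrow> map fst u = map snd u \<and> time (map fst u) = 0"
    "reaches u TimePos \<longleftrightarrow> map fst u = map snd u \<and> time (map fst u) \<noteq> 0"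
    by (simp_all add: starts_def time_def)
qed

lemma reaches_offset:
  "reaches u OffsetZero \<longleftrightarrow> map fst u = map snd u \<and> offset (map fst u) = 0"
  "reaches u OffsetPos \<longleftrightarrow> map fst u = map snd u \<and> offset (map fst u) \<noteq> 0"
proof -
  have "trans r c c' OffsetZero \<longleftrightarrow> r = OffsetZero \<and> c = c' \<and> \<not> snd c"
    "trans r c c' OffsetPos \<longleftrightarrow> c = c' \<and> (r = OffsetPos \<or> r = OffsetZero \<and> snd c)" for r c c'
    by (cases r; auto)+
  from reaches_zero_test[OF _ _ this]
  show "reaches u OffsetZero \<longleftrightarrow> map fst u = map snd u \<and> offset (map fst u) = 0"
    "reaches u OffsetPos \<longleftrightarrow> map fst u = map snd u \<and> offset (map fst u) \<noteq> 0"
    by (simp_all add: starts_def offset_def)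
qed

fun shifted :: "nat \<Rightarrow> shift \<Rightarrow> nat \<Rightarrow> nat \<Rightarrow> bool" where
  "shifted n Same y y' \<longleftrightarrow> y' = y"
| "shifted n Up y y' \<longleftrightarrow> y' = (y + 1) mod 2 ^ n"
| "shifted n Down y y' \<longleftrightarrow> y = (y' + 1) mod 2 ^ n"

lemma time_step_val:
  "(\<exists>b. t' = t + of_bool b \<and> time_step b c c' b') \<longleftrightarrow>
     of_bool c' + 2 * t' = of_bool c + 2 * t + (of_bool b' :: nat)"
  by (cases c; cases c'; cases b') (auto simp: ex_bool_eq, presburger+)

text \<open>Adding one modulo \<open>2 ^ Suc n\<close> adds one to the high part modulo
  \<open>2 ^ n\<close> exactly if the low digit is 1; comparing parities settles the remaining
  cases.\<close>

lemma shifted_Suc: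
  assumes "y < 2 ^ n" "y' < 2 ^ n"
  shows "(\<exists>p. shifted n p y y' \<and> offset_step p c c' q) \<longleftrightarrow>
     shifted (Suc n) q (of_bool c + 2 * y) (of_bool c' + 2 * y')"
proof -
  have ex: "(\<exists>p. Q p) \<longleftrightarrow> Q Same \<or> Q Up \<or> Q Down" for Q by (metis shift.exhaust)
  have carry: "(of_bool b + 2 * v + 1) mod 2 ^ Suc n =
      (if b then 2 * ((v + 1) mod 2 ^ n) else 2 * v + 1)" if "v < 2 ^ n" for b and v :: nat
  proof (cases b)
    case True
    then have "(of_bool b + 2 * v + 1) mod 2 ^ Suc n = (2 * (v + 1)) mod (2 * 2 ^ n)" by simp
    also have "\<dots> = 2 * ((v + 1) mod 2 ^ n)" by (rule mult_mod_right[symmetric])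
    finally show ?thesis using True by simp
  next
    case False
    then show ?thesis using that by simp
  qed
  show ?thesis
  proof (cases q)
    case Same
    show ?thesis unfolding ex Same shifted.simps
      by (cases c; cases c') (auto simp: Suc_double_not_eq_double double_not_eq_Suc_double)
  next
    case Up
    show ?thesis unfolding ex Up shifted.simps carry[OF assms(1)]
      by (cases c; cases c') (auto simp: Suc_double_not_eq_double double_not_eq_Suc_double)
  next
    case Down
    show ?thesis unfolding ex Down shifted.simps carry[OF assms(2)]
      by (cases c; cases c') (auto simp: Suc_double_not_eq_double double_not_eq_Suc_double)
  qed
qed

text \<open>The two components of \<open>Rel\<close> evolve independently, so the existential over
  the previous state splits into \<open>time_step_val\<close> and
  \<open>shifted_Suc\<close>.\<close>

lemma reaches_Rel:
  "reaches u (Rel b p) \<longleftrightarrow> time (map snd u) = time (map fst u) + of_bool b \<and>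
     shifted (length u) p (offset (map fst u)) (offset (map snd u))"
proof (induction u arbitrary: b p)
  case Nil
  then show ?case by (cases p; cases b) (auto simp: starts_def time_def offset_def)
next
  case (Cons x u)
  have "reaches (x # u) (Rel b p) \<longleftrightarrow>
      (\<exists>b' p'. reaches u (Rel b' p') \<and> trans (Rel b' p') (fst x) (snd x) (Rel b p))"
  proof
    assume "reaches (x # u) (Rel b p)"
    then obtain r where r: "reaches u r" "trans r (fst x) (snd x) (Rel b p)" by auto
    then show "\<exists>b' p'. reaches u (Rel b' p') \<and> trans (Rel b' p') (fst x) (snd x) (Rel b p)"
      by (cases r) (auto split: if_splits)
  qed (metis run.simps(2) set_edges)
  also have "\<dots> \<longleftrightarrow>
      (\<exists>b'. time (map snd u) = time (map fst u) + of_bool b' \<and> time_step b' (fst (fst x)) (fst (snd x)) b) \<and>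
      (\<exists>p'. shifted (length u) p' (offset (map fst u)) (offset (map snd u)) \<and>
        offset_step p' (snd (fst x)) (snd (snd x)) p)"
    unfolding Cons.IH by auto
  also have "\<dots> \<longleftrightarrow> time (map snd (x # u)) = time (map fst (x # u)) + of_bool b \<and>
      shifted (length (x # u)) p (offset (map fst (x # u))) (offset (map snd (x # u)))"
    unfolding time_step_val
    using shifted_Suc[OF offset_less[of "map fst u" "length u"] offset_less[of "map snd u" "length u"]]
    by (simp add: time_def offset_def)
  finally show ?case .
qed

lemma reaches_zip:
  assumes "length z = length z'" "time z' = time z + of_bool b" "shifted (length z) p (offset z) (offset z')"
  shows "reaches (zip z z') (Rel b p)"
  using assms by (simp add: reaches_Rel)

section \<open>Computations as tilings\<close>

text \<open>The cell at time \<open>t\<close> and offset \<open>y\<close> shows the state and the scanned symbols at time \<open>t\<close>, the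
  action taken (none after acceptance), and for each tape the symbol \<open>y\<close> cells to the right of the
  head, cyclically. Keeping the heads at offset 0 and shifting the tapes instead makes all constraints
  local. Rows after acceptance are unconstrained, and acceptance need not be demanded: as no
  computation is as long as the tiling, some row has no action.\<close>

datatype cell = Cell (cell_state: nat) (scanned: "nat list")
  (action: "(nat \<times> (nat \<times> int) list) option") (syms: "nat list") (at_start: bool) (at_head: bool)

instance cell :: countable by countable_datatype

text \<open>An action can be missing only in the accepting state with no applicable instruction, so
  the run that a tiling follows can end only by accepting. At the head, the tape contents are tied
  to the scanned symbols that the whole row shares.\<close>

definition cells :: "machine \<Rightarrow> cell set" where
  "cells M = {c.
     length (scanned c) = tapes M \<and> set (scanned c) \<subseteq> {..<symbols M} \<and>
     length (syms c) = tapes M \<and> set (syms c) \<subseteq> {..<symbols M} \<and>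
     (case action c of
        Some (q', as) \<Rightarrow> (cell_state c, scanned c, q', as) \<in> instrs M
      | None \<Rightarrow> cell_state c = 1 \<and> (\<forall>q' as. (1, scanned c, q', as) \<notin> instrs M)) \<and>
     (at_head c \<longrightarrow> syms c = scanned c) \<and>
     (at_start c \<longrightarrow> cell_state c = 0 \<and> (\<forall>i. 0 < i \<and> i < tapes M \<longrightarrow> syms c ! i = 0))}"

lemma finite_instrs:
  assumes "wf_machine M"
  shows "finite (instrs M)"
proof -
  have "instrs M \<subseteq> {..<states M} \<times> {rs. set rs \<subseteq> {..<symbols M} \<and> length rs = tapes M} \<times>
      {..<states M} \<times> {as. set as \<subseteq> {..<symbols M} \<times> {-1, 0, 1} \<and> length as = tapes M}"
    using assms unfolding wf_machine_def by fast
  then show ?thesis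
    by (rule finite_subset) (intro finite_cartesian_product finite_lists_length_eq; simp)
qed

lemma finite_cells:
  assumes "wf_machine M"
  shows "finite (cells M)"
proof -
  let ?L = "{rs. set rs \<subseteq> {..<symbols M} \<and> length rs = tapes M}"
  let ?Q = "insert 1 (fst ` instrs M)" and ?A = "insert None (Some ` (snd \<circ> snd) ` instrs M)"
  have "c \<in> (\<lambda>(q, rs, a, ss, g, h). Cell q rs a ss g h) ` (?Q \<times> ?L \<times> ?A \<times> ?L \<times> UNIV \<times> UNIV)"
    if "c \<in> cells M" for c
  proof -
    have "cell_state c \<in> ?Q \<and> action c \<in> ?A"
    proof (cases "action c")
      case None
      then show ?thesis using that by (simp add: cells_def)
    next
      case (Some a)
      obtain q' as where a: "a = (q', as)" by (cases a)
      then have "(cell_state c, scanned c, q', as) \<in> instrs M" using that Some by (simp add: cells_def)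
      from imageI[OF this, of fst] imageI[OF this, of "Some \<circ> snd \<circ> snd"] Some a show ?thesis
        by (auto simp: image_image comp_def)
    qed
    then show ?thesis
      using that by (intro image_eqI[of _ _ "(cell_state c, scanned c, action c, syms c, at_start c, at_head c)"])
        (simp_all add: cells_def)
  qed
  then have "cells M \<subseteq> (\<lambda>(q, rs, a, ss, g, h). Cell q rs a ss g h) ` (?Q \<times> ?L \<times> ?A \<times> ?L \<times> UNIV \<times> UNIV)"
    by blast
  moreover have "finite ?L" by (rule finite_lists_length_eq) simp
  ultimately show ?thesis
    by (elim finite_subset) (use finite_instrs[OF assms] in \<open>intro finite_imageI finite_cartesian_product; simp\<close>)
qed

definition same_row :: "cell \<Rightarrow> cell \<Rightarrow> bool" where
  "same_row c d \<longleftrightarrow> cell_state d = cell_state c \<and> scanned d = scanned c \<and> action d = action c"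

text \<open>Offsets are relative to the head: when the head moves left, every tape cell gets one
  further to the right of it, hence the opposite signs.\<close>

fun tape_shift :: "shift \<Rightarrow> int" where
  "tape_shift Same = 0"
| "tape_shift Up = -1"
| "tape_shift Down = 1"

text \<open>A tape is constrained only under the shift that matches its own move, so the three
  shifts together update all tapes even if their heads move differently.\<close>

definition next_row :: "shift \<Rightarrow> cell \<Rightarrow> cell \<Rightarrow> bool" where
  "next_row p c d \<longleftrightarrow>
     (case action c of
        None \<Rightarrow> True
      | Some (q', as) \<Rightarrow> cell_state d = q' \<and>
          (\<forall>i<length as. snd (as ! i) = tape_shift p \<longrightarrow>
             syms d ! i = (if at_head c then fst (as ! i) else syms c ! i)))"

definition symbol_at :: "word \<Rightarrow> nat \<Rightarrow> nat" where
  "symbol_at x j = (if j < length x then (if x ! j then 2 else 1) else 0)"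

definition tiling :: "machine \<Rightarrow> word \<Rightarrow> nat \<Rightarrow> (nat \<Rightarrow> nat \<Rightarrow> cell) \<Rightarrow> bool" where
  "tiling M x P cl \<longleftrightarrow>
     (\<forall>t<2 ^ P. \<forall>y<2 ^ P. cl t y \<in> cells M \<and> (at_start (cl t y) \<longleftrightarrow> t = 0) \<and> (at_head (cl t y) \<longleftrightarrow> y = 0)) \<and>
     (\<forall>t<2 ^ P. \<forall>y<2 ^ P. same_row (cl t y) (cl t ((y + 1) mod 2 ^ P))) \<and>
     (\<forall>t y y' p. Suc t < 2 ^ P \<longrightarrow> y < 2 ^ P \<longrightarrow> y' < 2 ^ P \<longrightarrow> shifted P p y y' \<longrightarrow>
        next_row p (cl t y) (cl (Suc t) y')) \<and>
     (\<forall>y<2 ^ P. syms (cl 0 y) ! 0 = symbol_at x y)"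

abbreviation tile :: "cell \<Rightarrow> atom" where "tile c \<equiv> G (Tile (to_nat c))"
abbreviation mark :: "nat \<Rightarrow> atom" where "mark j \<equiv> I Mark j"

text \<open>Each address carries exactly one tile, and the cell at time 0 and offset 0 starts the
  chain of marks that spells out the input.\<close>

definition const_clauses :: "cell list \<Rightarrow> clause list" where
  "const_clauses cs =
     ([], map tile cs) #
     map (\<lambda>(c, d). ([tile c, tile d], [])) (filter (\<lambda>(c, d). c \<noteq> d) (List.product cs cs)) @
     map (\<lambda>c. ([tile c], [mark 0])) (filter (\<lambda>c. at_start c \<and> at_head c) cs)"

definition const_rules :: "cell list \<Rightarrow> rule list" where
  "const_rules cs =
     concat (map (\<lambda>c.
       [(TimeZero, tile c, if at_start c then [tile c] else []),
        (TimePos, tile c, if at_start c then [] else [tile c]),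
        (OffsetZero, tile c, if at_head c then [tile c] else []),
        (OffsetPos, tile c, if at_head c then [] else [tile c]),
        (Rel False Up, tile c, map tile (filter (same_row c) cs))] @
       map (\<lambda>p. (Rel True p, tile c, map tile (filter (next_row p c) cs))) [Same, Up, Down]) cs)"

text \<open>A tile does not know its offset, so the input is laid out by marks travelling along the
  first row: each forces one input symbol here and, by \<open>input_rule\<close>, the next mark at
  the next offset.\<close>

definition input_clause :: "cell list \<Rightarrow> nat \<Rightarrow> nat \<Rightarrow> clause" where
  "input_clause cs s j = ([mark j], map tile (filter (\<lambda>c. syms c ! 0 = s) cs))"

definition input_rule :: "nat \<Rightarrow> rule" where
  "input_rule j = (Rel False Up, mark j, [mark (Suc j)])"

text \<open>The last mark repeats itself along the blank rest of the row; the alternative lets it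
  stop where the cyclic row returns to the head.\<close>

definition end_rule :: "cell list \<Rightarrow> nat \<Rightarrow> rule" where
  "end_rule cs n = (Rel False Up, mark n, mark n # map tile (filter at_head cs))"

definition all_clauses :: "cell list \<Rightarrow> word \<Rightarrow> clause set" where
  "all_clauses cs x = set (const_clauses cs) \<union> (\<lambda>j. input_clause cs (symbol_at x j) j) ` {..length x}"

definition all_rules :: "cell list \<Rightarrow> word \<Rightarrow> rule set" where
  "all_rules cs x = set (const_rules cs) \<union> input_rule ` {..<length x} \<union> {end_rule cs (length x)}"

lemma tiling_solves:
  assumes til: "tiling M x P cl" and cs: "set cs = cells M" and x: "length x < 2 ^ P"
  shows "\<exists>T. solves P edges starts (all_rules cs x) (all_clauses cs x) T"
proof -
  let ?n = "length x"
  define C where "C z = cl (time z) (offset z)" for z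
  \<comment> \<open>Marks occur in row 0 only: mark \<open>j\<close> at offset \<open>j\<close>
    inside the input, the last mark at all offsets beyond it.\<close>
  define T where "T z a \<longleftrightarrow> a = tile (C z) \<or> (\<exists>j. a = mark j \<and> time z = 0 \<and>
      (if j < ?n then offset z = j else j = ?n \<and> ?n \<le> offset z))" for z a
  have T_tile: "T z (tile c) \<longleftrightarrow> c = C z" for z c by (auto simp: T_def)
  have T_mark: "T z (mark j) \<longleftrightarrow> time z = 0 \<and> (if j < ?n then offset z = j else j = ?n \<and> ?n \<le> offset z)" for z j
    by (auto simp: T_def)
  have cell: "C z \<in> cells M \<and> (at_start (C z) \<longleftrightarrow> time z = 0) \<and> (at_head (C z) \<longleftrightarrow> offset z = 0)"
    if "length z = P" for z
    using til time_less[OF that] offset_less[OF that] unfolding tiling_def C_def by blast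
  have "\<exists>b\<in>set bs. T z b"
    if z: "length z = P" and c: "(as, bs) \<in> all_clauses cs x" and as: "\<forall>a\<in>set as. T z a" for z as bs
  proof -
    have *: "C z \<in> set cs" using cell[OF z] cs by simp
    from c consider "(as, bs) \<in> set (const_clauses cs)"
      | j where "j \<le> ?n" "(as, bs) = input_clause cs (symbol_at x j) j"
      by (auto simp: all_clauses_def)
    then show ?thesis
    proof cases
      case 1
      then show ?thesis
        using * as cell[OF z] by (auto simp: const_clauses_def T_tile T_mark)
    next
      case (2 j)
      then have "T z (mark j)" using as by (auto simp: input_clause_def)
      then have "time z = 0" "symbol_at x j = symbol_at x (offset z)"
        by (auto simp: T_mark symbol_at_def split: if_splits)
      moreover have "syms (cl 0 (offset z)) ! 0 = symbol_at x (offset z)"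
        using til offset_less[OF z] by (simp add: tiling_def)
      ultimately have "syms (C z) ! 0 = symbol_at x j" by (simp add: C_def)
      then show ?thesis using 2 * by (auto simp: input_clause_def T_tile)
    qed
  qed
  moreover have "\<exists>b\<in>set bs. T (map snd u) b"
    if u: "length u = P" and run: "reaches u s" and c: "(s, a, bs) \<in> all_rules cs x"
      and a: "T (map fst u) a" for u s a bs
  proof -
    let ?z = "map fst u" and ?z' = "map snd u"
    have z: "length ?z = P" "length ?z' = P" using u by auto
    have *: "C ?z' \<in> set cs" using cell[OF z(2)] cs by simp
    from c consider "(s, a, bs) \<in> set (const_rules cs)" | j where "j < ?n" "(s, a, bs) = input_rule j"
      | "(s, a, bs) = end_rule cs ?n"
      by (auto simp: all_rules_def)
    then show ?thesis
    proof cases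
      case 1
      then obtain c where c: "a = tile c" and
        cases: "s = TimeZero \<and> bs = (if at_start c then [tile c] else []) \<or>
          s = TimePos \<and> bs = (if at_start c then [] else [tile c]) \<or>
          s = OffsetZero \<and> bs = (if at_head c then [tile c] else []) \<or>
          s = OffsetPos \<and> bs = (if at_head c then [] else [tile c]) \<or>
          s = Rel False Up \<and> bs = map tile (filter (same_row c) cs) \<or>
          (\<exists>p. s = Rel True p \<and> bs = map tile (filter (next_row p c) cs))"
        unfolding const_rules_def by fastforce
      have C: "c = C ?z" using a c T_tile by simp
      from cases show ?thesis
      proof (elim disjE conjE exE)
        assume "s = Rel False Up" and bs: "bs = map tile (filter (same_row c) cs)"
        then have "time ?z' = time ?z" "offset ?z' = (offset ?z + 1) mod 2 ^ P"
          using run u by (auto simp: reaches_Rel)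
        then have "same_row c (C ?z')"
          using til time_less[OF z(1)] offset_less[OF z(1)] unfolding C C_def tiling_def by simp
        then show ?thesis using bs * by (auto simp: T_tile)
      next
        fix p assume "s = Rel True p" and bs: "bs = map tile (filter (next_row p c) cs)"
        then have "time ?z' = Suc (time ?z)" "shifted P p (offset ?z) (offset ?z')"
          using run u by (auto simp: reaches_Rel)
        then have "next_row p c (C ?z')"
          using til time_less[OF z(2)] offset_less[OF z(1)] offset_less[OF z(2)]
          unfolding C C_def tiling_def by simp
        then show ?thesis using bs * by (auto simp: T_tile)
      qed (use run C cell[OF z(1)] in \<open>auto simp: reaches_time reaches_offset T_tile simp del: map_eq_conv\<close>)
    next
      case (2 j)
      then have "time ?z' = time ?z" "offset ?z' = (offset ?z + 1) mod 2 ^ P"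
        using run u by (auto simp: reaches_Rel input_rule_def)
      moreover have "time ?z = 0" "offset ?z = j" using 2 a by (auto simp: T_mark input_rule_def)
      ultimately have "T ?z' (mark (Suc j))" using 2(1) x by (auto simp: T_mark)
      then show ?thesis using 2 by (auto simp: input_rule_def)
    next
      case 3
      then have "time ?z' = time ?z" "offset ?z' = (offset ?z + 1) mod 2 ^ P"
        using run u by (auto simp: reaches_Rel end_rule_def)
      moreover have "time ?z = 0" "?n \<le> offset ?z" using 3 a by (auto simp: T_mark end_rule_def)
      moreover have "offset ?z < 2 ^ P" by (rule offset_less[OF z(1)])
      \<comment> \<open>At the largest offset the row wraps around to offset 0, where the head tile
        satisfies the second alternative of the rule.\<close>
      ultimately have "T ?z' (mark ?n) \<or> offset ?z' = 0"
        by (cases "offset ?z + 1 = 2 ^ P") (auto simp: T_mark)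
      then show ?thesis using 3 * cell[OF z(2)] by (auto simp: end_rule_def T_tile)
    qed
  qed
  ultimately have "solves P edges starts (all_rules cs x) (all_clauses cs x) T"
    unfolding solves_def by blast
  then show ?thesis by blast
qed

text \<open>A rule only yields some admissible tile at the neighbouring address; uniqueness of tiles
  identifies it with the value of \<open>cl\<close> there. The input row follows by propagating the
  marks from the start cell.\<close>

lemma solves_tiling:
  assumes T: "solves P edges starts (all_rules cs x) (all_clauses cs x) T"
    and cs: "set cs = cells M" and x: "length x < 2 ^ P"
  shows "\<exists>cl. tiling M x P cl"
proof -
  let ?n = "length x"
  have clause: "\<exists>b\<in>set bs. T z b"
    if "length z = P" "(as, bs) \<in> all_clauses cs x" "\<forall>a\<in>set as. T z a" for z as bs
    using T that unfolding solves_def by blast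
  have rule: "\<exists>b\<in>set bs. T z' b"
    if "reaches (zip z z') s" "length z = P" "length z' = P" "(s, a, bs) \<in> all_rules cs x" "T z a" for z z' s a bs
  proof -
    have "length (zip z z') = P" "map fst (zip z z') = z" "map snd (zip z z') = z'" using that by auto
    then show ?thesis using T that unfolding solves_def by metis
  qed
  have const: "(s, a, bs) \<in> all_rules cs x" if "(s, a, bs) \<in> set (const_rules cs)" for s a bs
    using that by (simp add: all_rules_def)
  have const_rule: "(TimeZero, tile c, if at_start c then [tile c] else []) \<in> all_rules cs x"
    "(TimePos, tile c, if at_start c then [] else [tile c]) \<in> all_rules cs x"
    "(OffsetZero, tile c, if at_head c then [tile c] else []) \<in> all_rules cs x"
    "(OffsetPos, tile c, if at_head c then [] else [tile c]) \<in> all_rules cs x"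
    "(Rel False Up, tile c, map tile (filter (same_row c) cs)) \<in> all_rules cs x"
    "(Rel True p, tile c, map tile (filter (next_row p c) cs)) \<in> all_rules cs x" if "c \<in> set cs" for c p
    using that by (cases p; intro const; force simp: const_rules_def)+
  define cl where "cl t y = (SOME c. c \<in> cells M \<and> T (address P t y) (tile c))" for t y
  have cl: "cl t y \<in> cells M" "T (address P t y) (tile (cl t y))" for t y
  proof -
    have "\<exists>b\<in>set (map tile cs). T (address P t y) b"
      by (rule clause[of _ "[]"]) (auto simp: address all_clauses_def const_clauses_def)
    then have "\<exists>c. c \<in> cells M \<and> T (address P t y) (tile c)" using cs by auto
    from someI_ex[OF this] show "cl t y \<in> cells M" "T (address P t y) (tile (cl t y))"
      unfolding cl_def by auto
  qed
  have unique: "c = cl t y" if "c \<in> cells M" "T (address P t y) (tile c)" for c t y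
  proof (rule ccontr)
    assume "c \<noteq> cl t y"
    then have "([tile c, tile (cl t y)], []) \<in> all_clauses cs x"
      using that(1) cl(1)[of t y] cs by (force simp: all_clauses_def const_clauses_def)
    from clause[of "address P t y", OF _ this] show False using that cl(2) by (auto simp: address)
  qed
  have flags: "(at_start (cl t y) \<longleftrightarrow> t = 0) \<and> (at_head (cl t y) \<longleftrightarrow> y = 0)" if "t < 2 ^ P" "y < 2 ^ P" for t y
  proof -
    let ?z = "address P t y"
    have "reaches (zip ?z ?z) (if t = 0 then TimeZero else TimePos)"
      "reaches (zip ?z ?z) (if y = 0 then OffsetZero else OffsetPos)"
      using that by (simp_all add: reaches_time reaches_offset address)
    note run = this
    have c: "cl t y \<in> set cs" using cl(1) cs by simp
    have "at_start (cl t y) \<longleftrightarrow> t = 0"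
      using rule[of ?z ?z TimeZero "tile (cl t y)", OF _ _ _ const_rule(1)[OF c] cl(2)]
        rule[of ?z ?z TimePos "tile (cl t y)", OF _ _ _ const_rule(2)[OF c] cl(2)] run(1)
      by (auto simp: address split: if_splits)
    moreover have "at_head (cl t y) \<longleftrightarrow> y = 0"
      using rule[of ?z ?z OffsetZero "tile (cl t y)", OF _ _ _ const_rule(3)[OF c] cl(2)]
        rule[of ?z ?z OffsetPos "tile (cl t y)", OF _ _ _ const_rule(4)[OF c] cl(2)] run(2)
      by (auto simp: address split: if_splits)
    ultimately show ?thesis ..
  qed
  have up: "reaches (zip (address P t y) (address P t ((y + 1) mod 2 ^ P))) (Rel False Up)"
    if "t < 2 ^ P" "y < 2 ^ P" for t y
    using that by (intro reaches_zip) (simp_all add: address)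
  have row: "same_row (cl t y) (cl t ((y + 1) mod 2 ^ P))" if "t < 2 ^ P" "y < 2 ^ P" for t y
  proof -
    have "cl t y \<in> set cs" using cl(1) cs by simp
    from rule[OF up[OF that] _ _ const_rule(5)[OF this] cl(2)]
    obtain c where "c \<in> cells M" "same_row (cl t y) c" "T (address P t ((y + 1) mod 2 ^ P)) (tile c)"
      using cs by (auto simp: address)
    then show ?thesis using unique by blast
  qed
  have column: "next_row p (cl t y) (cl (Suc t) y')"
    if "Suc t < 2 ^ P" "y < 2 ^ P" "y' < 2 ^ P" "shifted P p y y'" for t y y' p
  proof -
    have run: "reaches (zip (address P t y) (address P (Suc t) y')) (Rel True p)"
      using that by (intro reaches_zip) (simp_all add: address)
    have "cl t y \<in> set cs" using cl(1) cs by simp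
    from rule[OF run _ _ const_rule(6)[OF this] cl(2)]
    obtain c where "c \<in> cells M" "next_row p (cl t y) c" "T (address P (Suc t) y') (tile c)"
      using cs by (auto simp: address)
    then show ?thesis using unique by blast
  qed
  have start: "T (address P 0 0) (mark 0)"
  proof -
    have "([tile (cl 0 0)], [mark 0]) \<in> all_clauses cs x"
      using cl(1)[of 0 0] cs flags[of 0 0] by (force simp: all_clauses_def const_clauses_def)
    from clause[of "address P 0 0", OF _ this] show ?thesis using cl(2) by (simp add: address)
  qed
  \<comment> \<open>From the end of the input on the mark stays the same, hence the minimum. The
    other alternative of \<open>end_rule\<close> is excluded since a positive offset is not the
    head.\<close>
  have mark: "T (address P 0 y) (mark (min y ?n))" if "y < 2 ^ P" for y
    using that
  proof (induction y)
    case 0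
    then show ?case using start by simp
  next
    case (Suc y)
    then have y: "y < 2 ^ P" "(y + 1) mod 2 ^ P = Suc y" by auto
    have z: "length (address P 0 y) = P" "length (address P 0 (Suc y)) = P" by (simp_all add: address)
    have run: "reaches (zip (address P 0 y) (address P 0 (Suc y))) (Rel False Up)"
      using up[of 0 y] y by simp
    have IH: "T (address P 0 y) (mark (min y ?n))" using Suc.IH y(1) .
    show ?case
    proof (cases "y < ?n")
      case True
      then have "(Rel False Up, mark y, [mark (Suc y)]) \<in> all_rules cs x"
        by (auto simp: all_rules_def input_rule_def)
      from rule[OF run z this] IH True show ?thesis by (simp add: min_def)
    next
      case False
      then have min: "min y ?n = ?n" "min (Suc y) ?n = ?n" by simp_all
      have "(Rel False Up, mark ?n, mark ?n # map tile (filter at_head cs)) \<in> all_rules cs x"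
        by (auto simp: all_rules_def end_rule_def)
      from rule[OF run z this] IH
      have "T (address P 0 (Suc y)) (mark ?n) \<or> (\<exists>c\<in>cells M. at_head c \<and> T (address P 0 (Suc y)) (tile c))"
        using cs unfolding min by auto
      moreover have "\<not> at_head c" if "c \<in> cells M" "T (address P 0 (Suc y)) (tile c)" for c
        using unique[OF that] flags[of 0 "Suc y"] Suc.prems by simp
      ultimately show ?thesis unfolding min by blast
    qed
  qed
  have input: "syms (cl 0 y) ! 0 = symbol_at x y" if "y < 2 ^ P" for y
  proof -
    let ?j = "min y ?n"
    have "([mark ?j], map tile (filter (\<lambda>c. syms c ! 0 = symbol_at x ?j) cs)) \<in> all_clauses cs x"
      by (auto simp: all_clauses_def input_clause_def)
    from clause[of "address P 0 y", OF _ this] mark[OF that]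
    obtain c where "c \<in> cells M" "syms c ! 0 = symbol_at x ?j" "T (address P 0 y) (tile c)"
      using cs by (auto simp: address)
    moreover have "symbol_at x ?j = symbol_at x y" by (simp add: symbol_at_def min_def)
    ultimately show ?thesis using unique by metis
  qed
  have "tiling M x P cl"
    unfolding tiling_def using cl(1) flags row column input by simp
  then show ?thesis by blast
qed


section \<open>Tilings and accepting computations\<close>

definition accepts :: "machine \<Rightarrow> word \<Rightarrow> bool" where
  "accepts M x \<longleftrightarrow> (\<exists>n c. (step M ^^ n) (init x) c \<and> halted M c \<and> state c = 1)"

abbreviation scan :: "machine \<Rightarrow> config \<Rightarrow> nat list" where
  "scan M c \<equiv> map (\<lambda>i. tape c i (head c i)) [0..<tapes M]"

definition perform :: "machine \<Rightarrow> config \<Rightarrow> nat \<Rightarrow> (nat \<times> int) list \<Rightarrow> config" where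
  "perform M c q' as = \<lparr>state = q',
     head = (\<lambda>i. if i < tapes M then head c i + snd (as ! i) else head c i),
     tape = (\<lambda>i. if i < tapes M then (tape c i)(head c i := fst (as ! i)) else tape c i)\<rparr>"

lemma step_iff: "step M c c' \<longleftrightarrow> (\<exists>q' as. (state c, scan M c, q', as) \<in> instrs M \<and> c' = perform M c q' as)"
  by (simp add: step_def perform_def)

lemma wf_action:
  assumes "wf_machine M" "(q, rs, q', as) \<in> instrs M"
  shows "length as = tapes M"
    and "i < tapes M \<Longrightarrow> fst (as ! i) < symbols M"
    and "i < tapes M \<Longrightarrow> snd (as ! i) \<in> {-1, 0, 1}"
proof -
  have *: "length as = tapes M" "set as \<subseteq> {..<symbols M} \<times> {-1, 0, 1}"
    using assms(1) bspec[OF _ assms(2)] unfolding wf_machine_def by auto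
  then have "as ! i \<in> {..<symbols M} \<times> {-1, 0, 1}" if "i < tapes M" for i
    using that nth_mem[of i as] by auto
  with * show "length as = tapes M" "i < tapes M \<Longrightarrow> fst (as ! i) < symbols M"
    "i < tapes M \<Longrightarrow> snd (as ! i) \<in> {-1, 0, 1}" by (auto simp: mem_Times_iff)
qed

lemma tape_shift_surj: "d \<in> {-1, 0, 1} \<Longrightarrow> \<exists>p. tape_shift p = d"
  by (metis insertE singletonD tape_shift.simps)

lemma shifted_nat_mod:
  "shifted P p (nat (w mod 2 ^ P)) (nat ((w - tape_shift p) mod 2 ^ P))"
proof (cases p)
  case Up
  have "int ((nat (w mod 2 ^ P) + 1) mod 2 ^ P) = (w mod 2 ^ P + 1) mod 2 ^ P"
    by (simp add: zmod_int add.commute)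
  also have "\<dots> = int (nat ((w + 1) mod 2 ^ P))" by (simp add: mod_add_left_eq)
  finally show ?thesis using Up by simp
next
  case Down
  have "int ((nat ((w - 1) mod 2 ^ P) + 1) mod 2 ^ P) = ((w - 1) mod 2 ^ P + 1) mod 2 ^ P"
    by (simp add: zmod_int add.commute)
  also have "\<dots> = int (nat (w mod 2 ^ P))" by (simp add: mod_add_left_eq)
  finally show ?thesis using Down by simp
qed simp

text \<open>Otherwise the actions of the rows would describe a computation of \<open>Suc N\<close>
  steps, longer than any that exists. The tape is compared with the tiling only on the window from
  \<open>- B\<close> to \<open>B - 1\<close>: its \<open>2 * B\<close> cells are one full period of
  the offsets, and the heads stay inside it for that many steps.\<close>

lemma tiling_accepts:
  assumes wf: "wf_machine M" and til: "tiling M x P cl"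
    and bound: "\<And>n c. (step M ^^ n) (init x) c \<Longrightarrow> n \<le> N" and N: "Suc N < 2 ^ (P - 1)" and P: "0 < P"
    and x: "length x \<le> 2 ^ (P - 1)"
  shows "accepts M x"
proof (rule ccontr)
  assume no: "\<not> accepts M x"
  define B where "B = (2 :: int) ^ (P - 1)"
  have B2: "2 ^ P = 2 * B" using P by (cases P) (auto simp: B_def)
  have N': "int N + 1 < B"
  proof -
    have "int (Suc N) < int (2 ^ (P - 1))" using N by (simp only: of_nat_less_iff)
    then show ?thesis by (simp add: B_def)
  qed
  have x': "int (length x) \<le> B"
  proof -
    have "int (length x) \<le> int (2 ^ (P - 1))" using x by (simp only: of_nat_le_iff)
    then show ?thesis by (simp add: B_def)
  qed
  have lt: "nat (w mod 2 ^ P) < 2 ^ P" for w :: int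
    by (simp add: nat_less_iff)
  have cells: "cl t y \<in> cells M" "at_start (cl t y) \<longleftrightarrow> t = 0" "at_head (cl t y) \<longleftrightarrow> y = 0"
    if "t < 2 ^ P" "y < 2 ^ P" for t y
    using til that unfolding tiling_def by blast+
  have row: "same_row (cl t 0) (cl t y)" if "t < 2 ^ P" "y < 2 ^ P" for t y
    using that(2)
  proof (induction y)
    case (Suc y)
    then have y: "y < 2 ^ P" "(y + 1) mod 2 ^ P = Suc y" by auto
    have "same_row (cl t y) (cl t ((y + 1) mod 2 ^ P))"
      using til that(1) y(1) unfolding tiling_def by blast
    then show ?case using Suc.IH[OF y(1)] unfolding y(2) by (simp add: same_row_def)
  qed (simp add: same_row_def)
  have "\<exists>c. (step M ^^ t) (init x) c \<and> state c = cell_state (cl t 0) \<and>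
      (\<forall>i<tapes M. \<bar>head c i\<bar> \<le> int t \<and>
         (\<forall>z. - B \<le> z \<longrightarrow> z < B \<longrightarrow> tape c i z = syms (cl t (nat ((z - head c i) mod 2 ^ P))) ! i))"
    if "t \<le> Suc N" for t
    using that
  proof (induction t)
    case 0
    have "tape (init x) i z = syms (cl 0 (nat (z mod 2 ^ P))) ! i" if i: "i < tapes M" and z: "- B \<le> z" "z < B" for i z
    proof (cases "i = 0")
      case True
      have "syms (cl 0 (nat (z mod 2 ^ P))) ! 0 = symbol_at x (nat (z mod 2 ^ P))"
        using til lt unfolding tiling_def by blast
      \<comment> \<open>A negative cell \<open>z\<close> has offset \<open>z + 2 * B\<close>, which
        is at least \<open>B\<close> and hence beyond the input; both sides are blank there.\<close>
      moreover have "z mod 2 ^ P = (if 0 \<le> z then z else z + 2 * B)"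
      proof (cases "0 \<le> z")
        case True
        then show ?thesis using z B2 by simp
      next
        case False
        have "z mod 2 ^ P = (z + 2 * B) mod (2 * B)" by (simp add: B2)
        also have "\<dots> = z + 2 * B" using False z by (intro mod_pos_pos_trivial) auto
        finally show ?thesis using False by simp
      qed
      moreover have "word_tape x z = symbol_at x (nat (if 0 \<le> z then z else z + 2 * B))"
        using z x' by (auto simp: word_tape_def symbol_at_def)
      ultimately show ?thesis using True by (simp add: init_def)
    next
      case False
      have "at_start (cl 0 (nat (z mod 2 ^ P)))" "cl 0 (nat (z mod 2 ^ P)) \<in> cells M"
        using cells[OF _ lt] by simp_all
      then show ?thesis using False i by (simp add: init_def cells_def)
    qed
    moreover have "cell_state (cl 0 0) = 0" using cells[of 0 0] by (simp add: cells_def)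
    ultimately show ?case by (intro exI[of _ "init x"]) (simp add: init_def)
  next
    case (Suc t)
    then obtain c where run: "(step M ^^ t) (init x) c" and q: "state c = cell_state (cl t 0)"
      and head: "\<And>i. i < tapes M \<Longrightarrow> \<bar>head c i\<bar> \<le> int t"
      and tape: "\<And>i z. i < tapes M \<Longrightarrow> - B \<le> z \<Longrightarrow> z < B \<Longrightarrow>
        tape c i z = syms (cl t (nat ((z - head c i) mod 2 ^ P))) ! i"
      by auto
    have t: "t < 2 ^ P" "Suc t < 2 ^ P" "int t < B"
    proof -
      have "(2::nat) ^ (P - 1) \<le> 2 ^ P" by (simp add: power_increasing)
      then show "t < 2 ^ P" "Suc t < 2 ^ P" using N Suc.prems by linarith+
      show "int t < B" using N' Suc.prems by simp
    qed
    have c0: "cl t 0 \<in> cells M" "at_head (cl t 0)" using cells[of t 0] t by auto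
    have "scan M c ! i = syms (cl t 0) ! i" if "i < tapes M" for i
      using that tape[OF that, of "head c i"] head[OF that] t by simp
    then have scan: "scan M c = scanned (cl t 0)"
      using c0 by (intro nth_equalityI) (auto simp: cells_def)
    show ?case
    proof (cases "action (cl t 0)")
      case None
      then have "cell_state (cl t 0) = 1" "\<forall>q' as. (1, scanned (cl t 0), q', as) \<notin> instrs M"
        using c0 by (auto simp: cells_def)
      then have "halted M c" "state c = 1"
        using q scan by (auto simp: halted_def step_iff)
      then show ?thesis using no run by (auto simp: accepts_def)
    next
      case (Some a)
      obtain q' as where a: "action (cl t 0) = Some (q', as)" using Some by (cases a) auto
      then have instr: "(state c, scan M c, q', as) \<in> instrs M" using c0 q scan by (simp add: cells_def)
      note as = wf_action[OF wf instr]
      let ?c = "perform M c q' as"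
      have step: "step M c ?c" using instr by (auto simp: step_iff)
      have succ: "cell_state (cl (Suc t) y') = q'"
        "tape_shift p = snd (as ! i) \<Longrightarrow> i < tapes M \<Longrightarrow>
          syms (cl (Suc t) y') ! i = (if y = 0 then fst (as ! i) else syms (cl t y) ! i)"
        if "y < 2 ^ P" "y' < 2 ^ P" "shifted P p y y'" for y y' p i
      proof -
        have "next_row p (cl t y) (cl (Suc t) y')" using til t that unfolding tiling_def by blast
        moreover have "action (cl t y) = Some (q', as)"
          using row[OF t(1) that(1)] a by (simp add: same_row_def)
        moreover have "at_head (cl t y) \<longleftrightarrow> y = 0" using cells[OF t(1) that(1)] by simp
        ultimately show "cell_state (cl (Suc t) y') = q'"
          "tape_shift p = snd (as ! i) \<Longrightarrow> i < tapes M \<Longrightarrow>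
            syms (cl (Suc t) y') ! i = (if y = 0 then fst (as ! i) else syms (cl t y) ! i)"
          using as(1) by (simp_all add: next_row_def)
      qed
      have "\<bar>head ?c i\<bar> \<le> int (Suc t)" if "i < tapes M" for i
        using as(3)[OF that] head[OF that] that by (auto simp: perform_def)
      moreover have "tape ?c i z = syms (cl (Suc t) (nat ((z - head ?c i) mod 2 ^ P))) ! i"
        if i: "i < tapes M" and z: "- B \<le> z" "z < B" for i z
      proof -
        obtain p where p: "tape_shift p = snd (as ! i)" using tape_shift_surj[OF as(3)[OF i]] by blast
        let ?w = "z - head c i"
        have eq: "z - head ?c i = ?w - tape_shift p" using i p by (simp add: perform_def)
        \<comment> \<open>Cell and head lie in the same window, less than one period apart, so
          offset 0 occurs at the head only.\<close>
        have "nat (?w mod 2 ^ P) = 0 \<longleftrightarrow> z = head c i"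
        proof
          assume "nat (?w mod 2 ^ P) = 0"
          then have "?w mod 2 ^ P \<le> 0" by (simp only: nat_eq_iff2 nat_0_iff)
          moreover have "0 \<le> ?w mod 2 ^ P" by (rule pos_mod_sign) simp
          ultimately have "2 ^ P dvd ?w" by (intro mod_0_imp_dvd) (rule order_antisym)
          moreover have "\<bar>?w\<bar> < 2 ^ P" unfolding B2 using head[OF i] t(3) z by linarith
          ultimately have "?w = 0" using dvd_imp_le_int[of ?w "2 ^ P"] by linarith
          then show "z = head c i" by simp
        qed simp
        with succ(2)[OF lt lt shifted_nat_mod[of P p ?w] p i] tape[OF i z] i show ?thesis
          unfolding eq by (auto simp: perform_def)
      qed
      moreover have "state ?c = cell_state (cl (Suc t) 0)"
        using succ(1)[of 0 0 Same] by (simp add: perform_def)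
      moreover have "(step M ^^ Suc t) (init x) ?c" using run step by auto
      ultimately show ?thesis by blast
    qed
  qed
  from this[of "Suc N"] bound show False by fastforce
qed

text \<open>Row \<open>t\<close> shows the configuration at time \<open>min t n\<close>, so the rows
  after the halt repeat the final one without an action. The symbol at offset \<open>y\<close> is
  taken from the representative of head position plus \<open>y\<close> in the window from
  \<open>- B\<close> to \<open>B - 1\<close>, chosen by \<open>rep\<close>.\<close>

lemma accepts_tiling:
  assumes wf: "wf_machine M" and acc: "accepts M x"
    and bound: "\<And>n c. (step M ^^ n) (init x) c \<Longrightarrow> n \<le> N" and N: "Suc N < 2 ^ (P - 1)" and P: "0 < P"
    and x: "length x \<le> 2 ^ (P - 1)"
  shows "\<exists>cl. tiling M x P cl"
proof -
  from acc obtain n c where run: "(step M ^^ n) (init x) c" "halted M c" "state c = 1"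
    by (auto simp: accepts_def)
  then obtain f where f: "f 0 = init x" "f n = c" "\<forall>i<n. step M (f i) (f (Suc i))"
    unfolding relpowp_fun_conv by blast
  define B where "B = (2 :: int) ^ (P - 1)"
  have B2: "2 ^ P = 2 * B" using P by (cases P) (auto simp: B_def)
  have n: "int n < B"
  proof -
    have "int (Suc N) < int (2 ^ (P - 1))" using N by (simp only: of_nat_less_iff)
    moreover have "int (2 ^ (P - 1)) = B" by (simp add: B_def)
    ultimately show ?thesis using bound[OF run(1)] by linarith
  qed
  have x': "int (length x) \<le> B"
  proof -
    have "int (length x) \<le> int (2 ^ (P - 1))" using x by (simp only: of_nat_le_iff)
    then show ?thesis by (simp add: B_def)
  qed
  have "\<forall>t\<in>{..<n}. \<exists>a. (state (f t), scan M (f t), fst a, snd a) \<in> instrs M \<and> f (Suc t) = perform M (f t) (fst a) (snd a)"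
    using f(3) unfolding step_iff by auto
  from bchoice[OF this] obtain g where
    g: "\<And>t. t < n \<Longrightarrow> (state (f t), scan M (f t), fst (g t), snd (g t)) \<in> instrs M"
      "\<And>t. t < n \<Longrightarrow> f (Suc t) = perform M (f t) (fst (g t)) (snd (g t))"
    by auto
  have symbols: "3 \<le> symbols M" using wf by (simp add: wf_machine_def)
  have inv: "(\<forall>i<tapes M. \<bar>head (f t) i\<bar> \<le> int t) \<and> (\<forall>i<tapes M. \<forall>z. tape (f t) i z < symbols M)" if "t \<le> n" for t
    using that
  proof (induction t)
    case 0
    then show ?case using symbols f(1) by (auto simp: init_def word_tape_def)
  next
    case (Suc t)
    then have t: "t < n" by simp
    from Suc.IH t have IH: "\<And>i. i < tapes M \<Longrightarrow> \<bar>head (f t) i\<bar> \<le> int t"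
      "\<And>i z. i < tapes M \<Longrightarrow> tape (f t) i z < symbols M" by auto
    note as = wf_action[OF wf g(1)[OF t]]
    have "\<bar>head (f (Suc t)) i\<bar> \<le> int (Suc t)" if "i < tapes M" for i
      using as(3)[OF that] IH(1)[OF that] that by (auto simp: g(2)[OF t] perform_def)
    then show ?case using as(2) IH(2) by (auto simp: g(2)[OF t] perform_def)
  qed
  define rep where "rep w = (w + B) mod 2 ^ P - B" for w
  have rep_id: "rep w = w" if "- B \<le> w" "w < B" for w
    using that by (simp add: rep_def B2)
  have rep_cong: "rep v = rep w" if "v mod 2 ^ P = w mod 2 ^ P" for v w
    using that unfolding rep_def by (metis mod_add_left_eq)
  have rep_mod: "rep w mod 2 ^ P = w mod 2 ^ P" for w
    unfolding rep_def by (simp add: mod_diff_left_eq)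
  define cl where "cl t y = (let c = f (min t n) in
      Cell (state c) (scan M c) (if t < n then Some (g t) else None)
        (map (\<lambda>i. tape c i (rep (head c i + int y))) [0..<tapes M]) (t = 0) (y = 0))" for t y
  have sel: "cell_state (cl t y) = state (f (min t n))" "scanned (cl t y) = scan M (f (min t n))"
    "action (cl t y) = (if t < n then Some (g t) else None)"
    "i < tapes M \<Longrightarrow> syms (cl t y) ! i = tape (f (min t n)) i (rep (head (f (min t n)) i + int y))"
    "length (syms (cl t y)) = tapes M"
    "at_start (cl t y) \<longleftrightarrow> t = 0" "at_head (cl t y) \<longleftrightarrow> y = 0" for t y i
    by (simp_all add: cl_def Let_def)
  have init_tape: "tape (f 0) i z = (if i = 0 then word_tape x z else 0)" for i z
    by (simp add: f(1) init_def)
  have tapes: "0 < tapes M" using wf by (simp add: wf_machine_def)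
  have "cl t y \<in> cells M" for t y
  proof -
    let ?c = "f (min t n)"
    have bounds: "\<And>i. i < tapes M \<Longrightarrow> \<bar>head ?c i\<bar> \<le> int (min t n)"
      "\<And>i z. i < tapes M \<Longrightarrow> tape ?c i z < symbols M" using inv[of "min t n"] by auto
    have "set (scan M ?c) \<subseteq> {..<symbols M}" using bounds(2) by auto
    moreover have "set (syms (cl t y)) \<subseteq> {..<symbols M}"
      using bounds(2) by (auto simp: cl_def Let_def)
    moreover have "case action (cl t y) of
        Some (q', as) \<Rightarrow> (cell_state (cl t y), scanned (cl t y), q', as) \<in> instrs M
      | None \<Rightarrow> cell_state (cl t y) = 1 \<and> (\<forall>q' as. (1, scanned (cl t y), q', as) \<notin> instrs M)"
    proof (cases "t < n")
      case True
      then show ?thesis using g(1)[OF True] by (auto simp: sel min_def split: prod.splits)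
    next
      case False
      then show ?thesis
        using run f(2) by (auto simp: sel min_def halted_def step_iff)
    qed
    moreover have "syms (cl t y) = scanned (cl t y)" if "at_head (cl t y)"
    proof (rule nth_equalityI)
      fix i assume "i < length (syms (cl t y))"
      then have i: "i < tapes M" by (simp add: sel)
      have "rep (head ?c i) = head ?c i" using bounds(1)[OF i] n by (intro rep_id) auto
      then show "syms (cl t y) ! i = scanned (cl t y) ! i" using i that by (simp add: sel)
    qed (simp add: sel)
    moreover have "cell_state (cl t y) = 0 \<and> (\<forall>i. 0 < i \<and> i < tapes M \<longrightarrow> syms (cl t y) ! i = 0)"
      if "at_start (cl t y)"
      using that by (auto simp: sel init_tape) (simp add: f(1) init_def)
    ultimately show ?thesis unfolding cells_def by (simp add: sel)
  qed
  moreover have "same_row (cl t y) (cl t y')" for t y y'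
    by (simp add: same_row_def sel)
  moreover have "next_row p (cl t y) (cl (Suc t) y')"
    if y: "y < 2 ^ P" "y' < 2 ^ P" and sh: "shifted P p y y'" for t y y' p
  proof (cases "t < n")
    case True
    note as = wf_action[OF wf g(1)[OF True]]
    have min: "min t n = t" "min (Suc t) n = Suc t" using True by auto
    have "syms (cl (Suc t) y') ! i = (if y = 0 then fst (snd (g t) ! i) else syms (cl t y) ! i)"
      if i: "i < tapes M" and d: "snd (snd (g t) ! i) = tape_shift p" for i
    proof -
      let ?h = "head (f t) i"
      \<comment> \<open>Offset \<open>y\<close> before the move and offset \<open>y'\<close> after
        it denote the same tape cell modulo the period.\<close>
      have "(?h + tape_shift p + int y') mod 2 ^ P = (?h + int y) mod 2 ^ P"
      proof (cases p)
        case Up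
        then have "int y' = (int y + 1) mod 2 ^ P" using sh by (simp add: zmod_int add.commute)
        then have "(?h + tape_shift p + int y') mod 2 ^ P = (?h - 1 + (int y + 1)) mod 2 ^ P"
          unfolding Up by (simp only: tape_shift.simps mod_add_right_eq) simp
        then show ?thesis by simp
      next
        case Down
        then have "int y = (int y' + 1) mod 2 ^ P" using sh by (simp add: zmod_int add.commute)
        then have "(?h + int y) mod 2 ^ P = (?h + (int y' + 1)) mod 2 ^ P"
          by (simp only: mod_add_right_eq)
        then show ?thesis using Down by (simp add: algebra_simps)
      qed (use sh in simp)
      then have rep: "rep (?h + tape_shift p + int y') = rep (?h + int y)" by (rule rep_cong)
      have h: "- B \<le> ?h" "?h < B" using inv[of t] True i n by fastforce+
      have "rep (?h + int y) = ?h \<longleftrightarrow> y = 0"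
      proof
        assume "rep (?h + int y) = ?h"
        then have "(?h + int y) mod 2 ^ P = ?h mod 2 ^ P" using rep_mod by metis
        then have "2 ^ P dvd int y" by (simp add: mod_eq_dvd_iff)
        then have "2 ^ P dvd y" by (metis of_nat_dvd_iff of_nat_numeral of_nat_power)
        then show "y = 0" using y(1) by (auto dest: dvd_imp_le)
      qed (use rep_id[OF h] in simp)
      then show ?thesis
        using i d rep by (auto simp: sel min g(2)[OF True] perform_def)
    qed
    moreover have "action (cl t y) = Some (fst (g t), snd (g t))" using True by (simp add: sel)
    moreover have "cell_state (cl (Suc t) y') = fst (g t)"
      by (simp add: sel min g(2)[OF True] perform_def)
    ultimately show ?thesis using as(1) by (simp add: next_row_def sel(7) case_prod_unfold)
  next
    case False
    then show ?thesis by (simp add: next_row_def sel)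
  qed
  moreover have "syms (cl 0 y) ! 0 = symbol_at x y" if "y < 2 ^ P" for y
  proof -
    have "int y < 2 ^ P" using that by (metis of_nat_less_iff of_nat_numeral of_nat_power)
    \<comment> \<open>At time 0 the heads stand at 0. An offset from \<open>B\<close> on denotes a
      negative tape cell, which is blank; since \<open>length x\<close> is at most \<open>B\<close>,
      so is \<open>symbol_at\<close> there.\<close>
    have "rep (int y) = int y \<or> int y \<ge> B \<and> rep (int y) < 0"
    proof (cases "int y < B")
      case True
      have "0 \<le> B" by (simp add: B_def)
      with True show ?thesis using rep_id[of "int y"] by simp
    next
      case False
      have "(int y + B) mod 2 ^ P = (int y + B - 2 * B) mod 2 ^ P"
        unfolding B2 by (metis minus_mod_self2)
      also have "\<dots> = int y - B" using False \<open>int y < 2 ^ P\<close> unfolding B2 by (simp add: mod_pos_pos_trivial)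
      finally show ?thesis using False \<open>int y < 2 ^ P\<close> unfolding rep_def B2 by simp
    qed
    then have "word_tape x (rep (int y)) = symbol_at x y"
      using x' by (auto simp: word_tape_def symbol_at_def)
    then show ?thesis using tapes by (simp add: sel init_tape) (simp add: f(1) init_def)
  qed
  ultimately have "tiling M x P cl"
    unfolding tiling_def by (simp add: sel)
  then show ?thesis by blast
qed

theorem solves_iff_accepts:
  assumes "wf_machine M" "set cs = cells M"
    and "\<And>n c. (step M ^^ n) (init x) c \<Longrightarrow> n \<le> N" "Suc N < 2 ^ (P - 1)" "0 < P" "length x \<le> 2 ^ (P - 1)"
  shows "(\<exists>T. solves P edges starts (all_rules cs x) (all_clauses cs x) T) \<longleftrightarrow> accepts M x"
proof -
  have x: "length x < 2 ^ P"
    by (rule le_less_trans[OF assms(6)]) (use assms(5) in simp)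
  show ?thesis
  proof
    assume "\<exists>T. solves P edges starts (all_rules cs x) (all_clauses cs x) T"
    then obtain cl where "tiling M x P cl" using solves_tiling[OF _ assms(2) x] by blast
    then show "accepts M x" using tiling_accepts[OF assms(1) _ _ assms(4-6)] assms(3) by blast
  next
    assume "accepts M x"
    then obtain cl where "tiling M x P cl"
      using accepts_tiling[OF assms(1) _ _ assms(4-6)] assms(3) by blast
    then show "\<exists>T. solves P edges starts (all_rules cs x) (all_clauses cs x) T"
      using tiling_solves[OF _ assms(2) x] by blast
  qed
qed


section \<open>Structured programs for Turing machines\<close>

text \<open>A store holds on each tape a word, starting at cell 0, and the position of the head.\<close>

type_synonym store = "(nat \<Rightarrow> word) \<times> (nat \<Rightarrow> int)"

text \<open>Symbols are added and removed only at the right end of a word. Each tape thus always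
  holds a contiguous word, and a store can consist of words instead of functions on the
  integers.\<close>

datatype com = Move nat int | Append nat bool | Delete nat | Seq com com | While nat com | Cond nat com com

definition scanned_symbol :: "store \<Rightarrow> nat \<Rightarrow> nat" where
  "scanned_symbol s t = word_tape (fst s t) (snd s t)"

text \<open>The counts are exactly those of the compiled code: a test costs one step, and so does
  the jump back of a loop and the jump over the second branch of a conditional.\<close>

inductive big_step :: "com \<Rightarrow> store \<Rightarrow> nat \<Rightarrow> store \<Rightarrow> bool" where
  Move: "big_step (Move t d) (w, h) 1 (w, h(t := h t + d))"
| Append: "h t = int (length (w t)) \<Longrightarrow>
     big_step (Append t b) (w, h) 1 (w(t := w t @ [b]), h(t := h t + 1))"
| Delete: "w t = u @ [b] \<Longrightarrow> h t = int (length u) \<Longrightarrow>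
     big_step (Delete t) (w, h) 1 (w(t := u), h(t := h t - 1))"
| Seq: "big_step c s m s' \<Longrightarrow> big_step d s' n s'' \<Longrightarrow> big_step (Seq c d) s (m + n) s''"
| While_stop: "scanned_symbol s t = 0 \<Longrightarrow> big_step (While t c) s 1 s"
| While_step: "scanned_symbol s t \<noteq> 0 \<Longrightarrow> big_step c s m s' \<Longrightarrow> big_step (While t c) s' n s'' \<Longrightarrow>
     big_step (While t c) s (m + n + 2) s''"
| Cond_True: "scanned_symbol s t = 2 \<Longrightarrow> big_step c s n s' \<Longrightarrow> big_step (Cond t c d) s (n + 2) s'"
| Cond_False: "scanned_symbol s t \<noteq> 2 \<Longrightarrow> big_step d s n s' \<Longrightarrow> big_step (Cond t c d) s (n + 1) s'"

primrec well_formed :: "nat \<Rightarrow> com \<Rightarrow> bool" where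
  "well_formed k (Move t d) \<longleftrightarrow> t < k \<and> d \<in> {-1, 0, 1}"
| "well_formed k (Append t b) \<longleftrightarrow> t < k"
| "well_formed k (Delete t) \<longleftrightarrow> t < k"
| "well_formed k (Seq c d) \<longleftrightarrow> well_formed k c \<and> well_formed k d"
| "well_formed k (While t c) \<longleftrightarrow> t < k \<and> well_formed k c"
| "well_formed k (Cond t c d) \<longleftrightarrow> t < k \<and> well_formed k c \<and> well_formed k d"

subsection \<open>Compilation\<close>

type_synonym instruction = "nat list \<Rightarrow> nat \<times> (nat \<times> int) list"

definition keep :: "nat list \<Rightarrow> (nat \<times> int) list" where
  "keep rs = map (\<lambda>a. (a, 0)) rs"

primrec code_size :: "com \<Rightarrow> nat" where
  "code_size (Move t d) = 1"
| "code_size (Append t b) = 1"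
| "code_size (Delete t) = 1"
| "code_size (Seq c d) = code_size c + code_size d"
| "code_size (While t c) = code_size c + 2"
| "code_size (Cond t c d) = code_size c + code_size d + 2"

primrec compile :: "com \<Rightarrow> nat \<Rightarrow> instruction list" where
  "compile (Move t d) q = [\<lambda>rs. (Suc q, (keep rs)[t := (rs ! t, d)])]"
| "compile (Append t b) q = [\<lambda>rs. (Suc q, (keep rs)[t := (if b then 2 else 1, 1)])]"
| "compile (Delete t) q = [\<lambda>rs. (Suc q, (keep rs)[t := (0, -1)])]"
| "compile (Seq c d) q = compile c q @ compile d (q + code_size c)"
| "compile (While t c) q =
     [\<lambda>rs. (if rs ! t = 0 then q + code_size c + 2 else Suc q, keep rs)] @ compile c (Suc q) @
     [\<lambda>rs. (q, keep rs)]"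
| "compile (Cond t c d) q =
     [\<lambda>rs. (if rs ! t = 2 then Suc q else q + code_size c + 2, keep rs)] @ compile c (Suc q) @
     [\<lambda>rs. (q + code_size c + 2 + code_size d, keep rs)] @ compile d (q + code_size c + 2)"

lemma length_compile [simp]: "length (compile c q) = code_size c"
  by (induction c arbitrary: q) auto

text \<open>States are positions in the code; the position after the last instruction has no
  instruction and is where the machine halts.\<close>

definition machine_of :: "nat \<Rightarrow> instruction list \<Rightarrow> machine" where
  "machine_of k code = \<lparr>tapes = k, states = length code + 2, symbols = 3,
     instrs = {(q, rs, q', as). q < length code \<and> length rs = k \<and> set rs \<subseteq> {..<3} \<and> (q', as) = (code ! q) rs}\<rparr>"

lemma machine_of_simps [simp]:
  "tapes (machine_of k code) = k" "states (machine_of k code) = length code + 2"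
  "symbols (machine_of k code) = 3"
  by (simp_all add: machine_of_def)

lemma length_keep [simp]: "length (keep rs) = length rs"
  by (simp add: keep_def)

lemma set_keep: "set rs \<subseteq> {..<3} \<Longrightarrow> set (keep rs) \<subseteq> {..<3} \<times> {-1, 0, 1}"
  by (auto simp: keep_def)

lemma set_keep_update:
  assumes "set rs \<subseteq> {..<3}" "a < 3" "d \<in> {-1, 0, 1}"
  shows "set ((keep rs)[t := (a, d)]) \<subseteq> {..<3} \<times> {-1, 0, 1}"
  using set_update_subset_insert[of "keep rs" t "(a, d)"] set_keep[OF assms(1)] assms(2,3) by blast

lemma compile_valid:
  assumes "well_formed k c" "q + code_size c \<le> L" "f \<in> set (compile c q)"
    "length rs = k" "set rs \<subseteq> {..<3}"
  shows "fst (f rs) \<le> L \<and> length (snd (f rs)) = k \<and> set (snd (f rs)) \<subseteq> {..<3} \<times> {-1, 0, 1}"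
  using assms(1-3)
proof (induction c arbitrary: q)
  case (Move t d)
  have "rs ! t \<in> set rs" using Move assms(4) by simp
  then have "rs ! t < 3" using assms(5) by auto
  with Move assms(4) set_keep_update[OF assms(5)] show ?case by simp
next
  case (Append t b)
  with assms(4) set_keep_update[OF assms(5)] show ?case by simp
next
  case (Delete t)
  with assms(4) set_keep_update[OF assms(5)] show ?case by simp
next
  case (Seq c d)
  from Seq.prems(3) show ?case
    using Seq.prems(1,2) Seq.IH(1)[of q] Seq.IH(2)[of "q + code_size c"] by auto
next
  case (While t c)
  from While.prems(3) show ?case
    using While.prems(1,2) While.IH[of "Suc q"] assms(4) set_keep[OF assms(5)] by auto
next
  case (Cond t c d)
  from Cond.prems(3) show ?case
    using Cond.prems(1,2) Cond.IH(1)[of "Suc q"] Cond.IH(2)[of "q + code_size c + 2"] assms(4)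
      set_keep[OF assms(5)] by auto
qed

lemma wf_machine_of:
  assumes "well_formed k c" "0 < k"
  shows "wf_machine (machine_of k (compile c 0))"
proof -
  let ?code = "compile c 0"
  have "q' \<le> length ?code \<and> length as = k \<and> set as \<subseteq> {..<3} \<times> {-1, 0, 1}"
    if "q < length ?code" "length rs = k" "set rs \<subseteq> {..<3}" "(q', as) = (?code ! q) rs" for q rs q' as
    using compile_valid[OF assms(1), of 0 "length ?code" "?code ! q" rs] that by (metis add_0 fst_conv length_compile nth_mem order_refl snd_conv)
  then show ?thesis
    using assms(2) unfolding wf_machine_def machine_of_def by fastforce
qed

lemma deterministic_machine_of: "deterministic (machine_of k code)"
  unfolding deterministic_def machine_of_def by (auto simp: prod_eq_iff)

definition conf :: "nat \<Rightarrow> store \<Rightarrow> config" where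
  "conf q s = \<lparr>state = q, head = snd s, tape = (\<lambda>i. word_tape (fst s i))\<rparr>"

lemma init_conf: "init x = conf 0 ((\<lambda>_. [])(0 := x), \<lambda>_. 0)"
  by (auto simp: init_def conf_def word_tape_def fun_eq_iff)

lemma word_tape_less: "word_tape u z < 3"
  by (simp add: word_tape_def)

lemma word_tape_append: "(word_tape u)(int (length u) := if b then 2 else 1) = word_tape (u @ [b])"
  by (auto simp: word_tape_def fun_eq_iff nth_append)

lemma word_tape_delete: "(word_tape (u @ [b]))(int (length u) := 0) = word_tape u"
  by (auto simp: word_tape_def fun_eq_iff nth_append)

definition at_segment :: "'a list \<Rightarrow> nat \<Rightarrow> 'a list \<Rightarrow> bool" where
  "at_segment code q xs \<longleftrightarrow> (\<exists>us vs. code = us @ xs @ vs \<and> length us = q)"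

lemma at_segment_append:
  "at_segment code q (xs @ ys) \<Longrightarrow> at_segment code q xs \<and> at_segment code (q + length xs) ys"
  unfolding at_segment_def by (metis append.assoc length_append)

lemma at_segment_Cons:
  assumes "at_segment code q (x # xs)"
  shows "q < length code" "code ! q = x" "at_segment code (Suc q) xs"
proof -
  have "at_segment code q ([x] @ xs)" using assms by simp
  from at_segment_append[OF this] have *: "at_segment code q [x]" "at_segment code (Suc q) xs"
    by simp_all
  then show "at_segment code (Suc q) xs" by simp
  from *(1) show "q < length code" "code ! q = x" by (auto simp: at_segment_def)
qed

lemma machine_of_step:
  assumes "q < length code" "(code ! q) (map (scanned_symbol s) [0..<k]) = (q', as)"
  shows "step (machine_of k code) (conf q s) (perform (machine_of k code) (conf q s) q' as)"
proof -
  have scan: "scan (machine_of k code) (conf q s) = map (scanned_symbol s) [0..<k]"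
    by (simp add: conf_def scanned_symbol_def)
  have "(q, map (scanned_symbol s) [0..<k], q', as) \<in> instrs (machine_of k code)"
    using assms by (auto simp: machine_of_def scanned_symbol_def word_tape_less)
  then show ?thesis unfolding step_iff scan by (auto simp: conf_def)
qed

lemma step_keep:
  assumes "q < length code" "code ! q = (\<lambda>rs. (f rs, keep rs))"
  shows "step (machine_of k code) (conf q s) (conf (f (map (scanned_symbol s) [0..<k])) s)"
proof -
  have "perform (machine_of k code) (conf q s) q' (keep (map (scanned_symbol s) [0..<k])) = conf q' s" for q'
    by (auto simp: perform_def conf_def keep_def scanned_symbol_def fun_eq_iff)
  then show ?thesis using machine_of_step[OF assms(1), of s k] assms(2) by force
qed

lemma step_update:
  assumes "q < length code" "code ! q = (\<lambda>rs. (q', (keep rs)[t := (f rs, d)]))" "t < k"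
    and "(word_tape (w t))(h t := f (map (scanned_symbol (w, h)) [0..<k])) = word_tape u"
  shows "step (machine_of k code) (conf q (w, h)) (conf q' (w(t := u), h(t := h t + d)))"
proof -
  define a where "a = f (map (scanned_symbol (w, h)) [0..<k])"
  have u: "word_tape u = (word_tape (w t))(h t := a)" using assms(4) by (simp add: a_def)
  have "perform (machine_of k code) (conf q (w, h)) q'
      ((keep (map (scanned_symbol (w, h)) [0..<k]))[t := (a, d)]) = conf q' (w(t := u), h(t := h t + d))"
    using assms(3)
    by (auto simp: perform_def conf_def keep_def scanned_symbol_def fun_eq_iff nth_list_update u)
  then show ?thesis using machine_of_step[OF assms(1), of "(w, h)" k] assms(2) a_def by force
qed

text \<open>The code may sit at any position inside a larger program, so that the induction
  hypotheses apply to the segments of the subprograms.\<close>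

lemma compile_correct:
  assumes "big_step c s n s'" "well_formed k c" "at_segment code q (compile c q)"
  shows "(step (machine_of k code) ^^ n) (conf q s) (conf (q + code_size c) s')"
  using assms
proof (induction arbitrary: q rule: big_step.induct)
  case (Move t d w h)
  then have "q < length code" "code ! q = (\<lambda>rs. (Suc q, (keep rs)[t := (rs ! t, d)]))"
    using at_segment_Cons[of code] by simp_all
  from step_update[OF this, of k w h "w t"] Move.prems show ?case
    by (simp add: scanned_symbol_def OO_def)
next
  case (Append h t w b)
  then have "q < length code" "code ! q = (\<lambda>rs. (Suc q, (keep rs)[t := (if b then 2 else 1, 1)]))"
    using at_segment_Cons[of code] by simp_all
  from step_update[OF this, of k w h "w t @ [b]"] Append word_tape_append[of "w t" b] show ?case
    by (simp add: OO_def)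
next
  case (Delete w t u b h)
  then have "q < length code" "code ! q = (\<lambda>rs. (Suc q, (keep rs)[t := (0, -1)]))"
    using at_segment_Cons[of code] by simp_all
  from step_update[OF this, of k w h u] Delete word_tape_delete[of u b] show ?case
    by (simp add: OO_def)
next
  case (Seq c s m s' d n s'')
  from Seq.prems(2) have "at_segment code q (compile c q)"
    "at_segment code (q + code_size c) (compile d (q + code_size c))"
    using at_segment_append[of code q "compile c q"] by auto
  with Seq have "(step (machine_of k code) ^^ m) (conf q s) (conf (q + code_size c) s')"
    "(step (machine_of k code) ^^ n) (conf (q + code_size c) s') (conf (q + code_size c + code_size d) s'')"
    by auto
  then have "(step (machine_of k code) ^^ (m + n)) (conf q s) (conf (q + code_size c + code_size d) s'')"
    unfolding relpowp_add by blast
  then show ?case by (simp add: add.assoc)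
next
  case (While_stop s t c)
  from While_stop.prems(2) have q: "q < length code"
    "code ! q = (\<lambda>rs. (if rs ! t = 0 then q + code_size c + 2 else Suc q, keep rs))"
    using at_segment_Cons[of code] by simp_all
  from step_keep[OF q, of k s] While_stop show ?case by (simp add: OO_def)
next
  case (While_step s t c m s' n s'')
  let ?M = "machine_of k code"
  from While_step.prems(2) have q: "q < length code"
    "code ! q = (\<lambda>rs. (if rs ! t = 0 then q + code_size c + 2 else Suc q, keep rs))"
    and rest: "at_segment code (Suc q) (compile c (Suc q) @ [\<lambda>rs. (q, keep rs)])"
    using at_segment_Cons[of code] by simp_all
  have body: "at_segment code (Suc q) (compile c (Suc q))"
    and "at_segment code (Suc q + code_size c) [\<lambda>rs. (q, keep rs)]"
    using at_segment_append[OF rest] by simp_all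
  note jump = at_segment_Cons(1,2)[OF this(2)]
  have "step ?M (conf q s) (conf (Suc q) s)"
    using step_keep[OF q, of k s] While_step by simp
  moreover have "(step ?M ^^ m) (conf (Suc q) s) (conf (Suc q + code_size c) s')"
    using While_step.IH(1)[OF _ body] While_step.prems by simp
  moreover have "step ?M (conf (Suc q + code_size c) s') (conf q s')"
    using step_keep[OF jump, of k s'] by simp
  moreover have "(step ?M ^^ n) (conf q s') (conf (q + code_size (While t c)) s'')"
    using While_step.IH(2) While_step.prems by blast
  ultimately have "(step ?M ^^ (1 + (m + (1 + n)))) (conf q s) (conf (q + code_size (While t c)) s'')"
    unfolding relpowp_add relpowp_1 by blast
  then show ?case by (simp add: add.commute add.left_commute)
next
  case (Cond_True s t c n s' d)
  let ?M = "machine_of k code"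
  from Cond_True.prems(2) have q: "q < length code"
    "code ! q = (\<lambda>rs. (if rs ! t = 2 then Suc q else q + code_size c + 2, keep rs))"
    and rest: "at_segment code (Suc q) (compile c (Suc q) @
      [\<lambda>rs. (q + code_size c + 2 + code_size d, keep rs)] @ compile d (q + code_size c + 2))"
    using at_segment_Cons[of code] by simp_all
  have body: "at_segment code (Suc q) (compile c (Suc q))"
    and "at_segment code (Suc q + code_size c)
      ((\<lambda>rs. (q + code_size c + 2 + code_size d, keep rs)) # compile d (q + code_size c + 2))"
    using at_segment_append[OF rest] by simp_all
  note jump = at_segment_Cons(1,2)[OF this(2)]
  have "step ?M (conf q s) (conf (Suc q) s)"
    using step_keep[OF q, of k s] Cond_True by simp
  moreover have "(step ?M ^^ n) (conf (Suc q) s) (conf (Suc q + code_size c) s')"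
    using Cond_True.IH[OF _ body] Cond_True.prems by simp
  moreover have "step ?M (conf (Suc q + code_size c) s') (conf (q + code_size (Cond t c d)) s')"
    using step_keep[OF jump, of k s'] by (simp add: ac_simps)
  ultimately have "(step ?M ^^ (1 + (n + 1))) (conf q s) (conf (q + code_size (Cond t c d)) s')"
    unfolding relpowp_add relpowp_1 by blast
  then show ?case by (simp add: add.commute add.left_commute)
next
  case (Cond_False s t d n s' c)
  let ?M = "machine_of k code"
  from Cond_False.prems(2) have q: "q < length code"
    "code ! q = (\<lambda>rs. (if rs ! t = 2 then Suc q else q + code_size c + 2, keep rs))"
    and rest: "at_segment code (Suc q) ((compile c (Suc q) @
      [\<lambda>rs. (q + code_size c + 2 + code_size d, keep rs)]) @ compile d (q + code_size c + 2))"
    using at_segment_Cons[of code] by simp_all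
  from at_segment_append[OF rest] have body: "at_segment code (q + code_size c + 2) (compile d (q + code_size c + 2))"
    by simp
  have "step ?M (conf q s) (conf (q + code_size c + 2) s)"
    using step_keep[OF q, of k s] Cond_False by simp
  moreover have "(step ?M ^^ n) (conf (q + code_size c + 2) s) (conf (q + code_size (Cond t c d)) s')"
    using Cond_False.IH[OF _ body] Cond_False.prems by (simp add: ac_simps)
  ultimately have "(step ?M ^^ (1 + n)) (conf q s) (conf (q + code_size (Cond t c d)) s')"
    unfolding relpowp_add relpowp_1 by blast
  then show ?case by (simp add: add.commute)
qed


section \<open>Polynomial-time word generators\<close>

text \<open>Upper bounds instead of exact counts: they can be weakened, so branches and rounds of
  different length get a common bound.\<close>

definition takes :: "com \<Rightarrow> store \<Rightarrow> nat \<Rightarrow> store \<Rightarrow> bool" where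
  "takes c s T s' \<longleftrightarrow> (\<exists>n\<le>T. big_step c s n s')"

lemma takes_mono: "takes c s m s' \<Longrightarrow> m \<le> n \<Longrightarrow> takes c s n s'"
  unfolding takes_def by (meson order_trans)

lemma takes_Move: "takes (Move t d) (w, h) 1 (w, h(t := h t + d))"
  unfolding takes_def using big_step.Move by blast

lemma takes_Append:
  "h t = int (length (w t)) \<Longrightarrow> takes (Append t b) (w, h) 1 (w(t := w t @ [b]), h(t := h t + 1))"
  unfolding takes_def using big_step.Append by blast

lemma takes_Seq: "takes c s m s' \<Longrightarrow> takes d s' n s'' \<Longrightarrow> takes (Seq c d) s (m + n) s''"
  unfolding takes_def by (meson add_mono big_step.Seq)

lemma takes_Cond:
  assumes "scanned_symbol s t = 2 \<Longrightarrow> takes c s n s'" "scanned_symbol s t \<noteq> 2 \<Longrightarrow> takes d s n s'"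
  shows "takes (Cond t c d) s (n + 2) s'"
proof (cases "scanned_symbol s t = 2")
  case True
  with assms(1) obtain m where m: "m \<le> n" "big_step c s m s'" by (auto simp: takes_def)
  from big_step.Cond_True[OF True m(2)] have "big_step (Cond t c d) s (m + 2) s'" .
  with m(1) show ?thesis unfolding takes_def by (intro exI[of _ "m + 2"] conjI) simp_all
next
  case False
  with assms(2) obtain m where m: "m \<le> n" "big_step d s m s'" by (auto simp: takes_def)
  from big_step.Cond_False[OF False m(2)] have "big_step (Cond t c d) s (m + 1) s'" .
  with m(1) show ?thesis unfolding takes_def by (intro exI[of _ "m + 1"] conjI) simp_all
qed

text \<open>\<open>F k\<close> is the store after \<open>k\<close> rounds. The induction goes
  backwards from the last store, since a loop is unfolded at its first round.\<close>

lemma takes_While: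
  assumes "\<And>k. k < n \<Longrightarrow> scanned_symbol (F k) t \<noteq> 0 \<and> takes c (F k) \<tau> (F (Suc k))"
    and "scanned_symbol (F n) t = 0"
  shows "takes (While t c) (F 0) (n * (\<tau> + 2) + 1) (F n)"
proof -
  have "takes (While t c) (F (n - k)) (k * (\<tau> + 2) + 1) (F n)" if "k \<le> n" for k
    using that
  proof (induction k)
    case 0
    then show ?case using big_step.While_stop[OF assms(2)] by (auto simp: takes_def)
  next
    case (Suc k)
    then have k: "n - Suc k < n" "Suc (n - Suc k) = n - k" by auto
    obtain l where l: "l \<le> k * (\<tau> + 2) + 1" "big_step (While t c) (F (n - k)) l (F n)"
      using Suc by (auto simp: takes_def)
    obtain m where m: "m \<le> \<tau>" "big_step c (F (n - Suc k)) m (F (n - k))"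
      using assms(1)[OF k(1)] unfolding k(2) by (auto simp: takes_def)
    have "big_step (While t c) (F (n - Suc k)) (m + l + 2) (F n)"
      using big_step.While_step[OF _ m(2) l(2)] assms(1)[OF k(1)] by blast
    then show ?case unfolding takes_def using l(1) m(1) by (intro exI[of _ "m + l + 2"]) simp
  qed
  from this[of n] show ?thesis by simp
qed

definition skip :: com where "skip = Move 0 0"

lemma takes_skip: "takes skip s 1 s"
  using takes_Move[of 0 0 "fst s" "snd s"] by (simp add: skip_def)

lemma word_tape_eq_0: "word_tape u z = 0 \<longleftrightarrow> z < 0 \<or> int (length u) \<le> z"
  by (auto simp: word_tape_def)

text \<open>The first step to the left makes this work also from the blank right behind the word;
  the loop ends at cell -1.\<close>

definition rewind :: "nat \<Rightarrow> com" where
  "rewind t = Seq (Move t (-1)) (Seq (While t (Move t (-1))) (Move t 1))"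

definition to_end :: "nat \<Rightarrow> com" where
  "to_end t = While t (Move t 1)"

definition clear :: "nat \<Rightarrow> com" where
  "clear t = Seq (to_end t) (Seq (Move t (-1)) (Seq (While t (Delete t)) (Move t 1)))"

definition add_mark :: "nat \<Rightarrow> com" where
  "add_mark t = Seq (to_end t) (Seq (Append t False) (rewind t))"

lemma takes_rewind:
  assumes "h t = int j" "j \<le> length (w t)"
  shows "takes (rewind t) (w, h) (3 * j + 3) (w, h(t := 0))"
proof -
  let ?F = "\<lambda>k. (w, h(t := int j - 1 - int k))"
  have "takes (While t (Move t (-1))) (?F 0) (j * (1 + 2) + 1) (?F j)"
  proof (rule takes_While)
    fix k assume "k < j"
    then show "scanned_symbol (?F k) t \<noteq> 0 \<and> takes (Move t (-1)) (?F k) 1 (?F (Suc k))"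
      using takes_Move[of t "-1" w "h(t := int j - 1 - int k)"] assms
      by (simp add: scanned_symbol_def word_tape_eq_0)
  qed (simp add: scanned_symbol_def word_tape_eq_0)
  moreover have "takes (Move t (-1)) (w, h) 1 (?F 0)"
    using takes_Move[of t "-1" w h] assms by simp
  moreover have "takes (Move t 1) (?F j) 1 (w, h(t := 0))"
    using takes_Move[of t 1 w "h(t := -1)"] by simp
  ultimately show ?thesis
    unfolding rewind_def using takes_Seq by (auto intro!: takes_mono[OF takes_Seq[OF _ takes_Seq]])
qed

lemma takes_to_end:
  assumes "h t = int j" "j \<le> length (w t)"
  shows "takes (to_end t) (w, h) (3 * length (w t) + 1) (w, h(t := int (length (w t))))"
proof -
  let ?F = "\<lambda>k. (w, h(t := int j + int k))"
  have "takes (While t (Move t 1)) (?F 0) ((length (w t) - j) * (1 + 2) + 1) (?F (length (w t) - j))"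
  proof (rule takes_While)
    fix k assume "k < length (w t) - j"
    then show "scanned_symbol (?F k) t \<noteq> 0 \<and> takes (Move t 1) (?F k) 1 (?F (Suc k))"
      using takes_Move[of t 1 w "h(t := int j + int k)"] assms
      by (simp add: scanned_symbol_def word_tape_eq_0 ac_simps)
  qed (use assms in \<open>simp add: scanned_symbol_def word_tape_eq_0\<close>)
  moreover have "?F 0 = (w, h)" "?F (length (w t) - j) = (w, h(t := int (length (w t))))"
    using assms by (simp_all add: of_nat_diff assms(1)[symmetric] del: assms(1))
  ultimately show ?thesis unfolding to_end_def using takes_mono by fastforce
qed

lemma takes_clear:
  assumes "h t = int j" "j \<le> length (w t)"
  shows "takes (clear t) (w, h) (6 * length (w t) + 4) (w(t := []), h(t := 0))"
proof -
  let ?n = "length (w t)"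
  let ?F = "\<lambda>k. (w(t := take (?n - k) (w t)), h(t := int ?n - 1 - int k))"
  have "takes (While t (Delete t)) (?F 0) (?n * (1 + 2) + 1) (?F ?n)"
  proof (rule takes_While)
    fix k assume k: "k < ?n"
    then have "?n - k = Suc (?n - Suc k)" by simp
    then have "take (?n - k) (w t) = take (?n - Suc k) (w t) @ [w t ! (?n - Suc k)]"
      using k by (simp only: take_Suc_conv_app_nth)
    from big_step.Delete[of "w(t := take (?n - k) (w t))" t, simplified, OF this,
        of "h(t := int ?n - 1 - int k)"] k
    have "takes (Delete t) (?F k) 1 (?F (Suc k))"
      by (auto simp: takes_def of_nat_diff)
    then show "scanned_symbol (?F k) t \<noteq> 0 \<and> takes (Delete t) (?F k) 1 (?F (Suc k))"
      using k by (simp add: scanned_symbol_def word_tape_eq_0)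
  qed (simp add: scanned_symbol_def word_tape_eq_0)
  moreover have "takes (to_end t) (w, h) (3 * ?n + 1) (w, h(t := int ?n))"
    using takes_to_end[of h t j w] assms by simp
  moreover have "takes (Move t (-1)) (w, h(t := int ?n)) 1 (?F 0)"
    using takes_Move[of t "-1" w "h(t := int ?n)"] by (simp add: fun_upd_idem)
  moreover have "takes (Move t 1) (?F ?n) 1 (w(t := []), h(t := 0))"
    using takes_Move[of t 1 "w(t := [])" "h(t := -1)"] by simp
  ultimately show ?thesis
    unfolding clear_def by (auto intro!: takes_mono[OF takes_Seq[OF _ takes_Seq[OF _ takes_Seq]]])
qed

lemma takes_add_mark:
  assumes "h t = 0"
  shows "takes (add_mark t) (w, h) (6 * length (w t) + 8) (w(t := w t @ [False]), h)"
proof -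
  let ?n = "length (w t)"
  have "takes (to_end t) (w, h) (3 * ?n + 1) (w, h(t := int ?n))"
    using assms by (intro takes_to_end[of h t 0]) auto
  moreover have "takes (Append t False) (w, h(t := int ?n)) 1 (w(t := w t @ [False]), h(t := int ?n + 1))"
    using takes_Append[of "h(t := int ?n)" t w False] by simp
  moreover have "takes (rewind t) (w(t := w t @ [False]), h(t := int ?n + 1)) (3 * (?n + 1) + 3)
      (w(t := w t @ [False]), h)"
    using takes_rewind[of "h(t := int ?n + 1)" t "?n + 1" "w(t := w t @ [False])"] assms
    by (simp add: fun_upd_idem)
  ultimately show ?thesis
    unfolding add_mark_def by (auto intro!: takes_mono[OF takes_Seq[OF _ takes_Seq]])
qed

text \<open>Tape 0 holds the input, tape 1 the current index, tape 2 the unary bound, tape 3 is auxiliary,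
  and tape 4 receives the output.\<close>

definition marks :: "nat \<Rightarrow> word" where "marks n = replicate n False"

text \<open>Tapes 3 and 4 rest with their heads at the end, ready for appending; tape 1 rests at its
  start, ready for reading.\<close>

definition store :: "word \<Rightarrow> nat \<Rightarrow> nat \<Rightarrow> nat \<Rightarrow> nat \<Rightarrow> nat \<Rightarrow> word \<Rightarrow> store" where
  "store x j i u k v out =
     ((\<lambda>t. if t = 0 then x else if t = 1 then marks i else if t = 2 then marks u else if t = 3 then marks v
        else if t = 4 then out else []),
      (\<lambda>t. if t = 0 then int j else if t = 2 then int k else if t = 3 then int v
        else if t = 4 then int (length out) else 0))"

lemma length_marks [simp]: "length (marks n) = n"
  by (simp add: marks_def)

lemma marks_Suc: "marks n @ [False] = marks (Suc n)"
  by (simp add: marks_def replicate_append_same)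

lemma scanned_store [simp]:
  "scanned_symbol (store x j i u k v out) 0 = symbol_at x j"
  "scanned_symbol (store x j i u k v out) 2 = symbol_at (marks u) k"
  by (simp_all add: scanned_symbol_def store_def word_tape_def symbol_at_def)

lemma symbol_at_eq_0: "symbol_at x j = 0 \<longleftrightarrow> length x \<le> j"
  by (simp add: symbol_at_def)

lemma takes_cong: "takes c (fst s, snd s) T s1 \<Longrightarrow> s1 = s2 \<Longrightarrow> takes c s T s2"
  by simp

lemma takes_store:
  "takes (Move 0 1) (store x j i u k v out) 1 (store x (Suc j) i u k v out)"
  "takes (Move 2 1) (store x j i u k v out) 1 (store x j i u (Suc k) v out)"
  "takes (Append 3 False) (store x j i u k v out) 1 (store x j i u k (Suc v) out)"
  "takes (Append 4 b) (store x j i u k v out) 1 (store x j i u k v (out @ [b]))"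
  "takes (Append 2 False) (store x j i u u v out) 1 (store x j i (Suc u) (Suc u) v out)"
  by (rule takes_cong, rule takes_Move takes_Append; simp add: store_def fun_eq_iff marks_Suc)+

lemma takes_store_rewind:
  "j \<le> length x \<Longrightarrow> takes (rewind 0) (store x j i u k v out) (3 * j + 3) (store x 0 i u k v out)"
  "k \<le> u \<Longrightarrow> takes (rewind 2) (store x j i u k v out) (3 * k + 3) (store x j i u 0 v out)"
  by (rule takes_cong, rule takes_rewind; simp add: store_def fun_eq_iff)+

lemma takes_store_clear:
  "takes (clear 1) (store x j i u k v out) (6 * i + 4) (store x j 0 u k v out)"
  "k \<le> u \<Longrightarrow> takes (clear 2) (store x j i u k v out) (6 * u + 4) (store x j i 0 0 v out)"
  "takes (clear 3) (store x j i u k v out) (6 * v + 4) (store x j i u k 0 out)"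
  "takes (add_mark 1) (store x j i u k v out) (6 * i + 8) (store x j (Suc i) u k v out)"
proof -
  have marks0: "marks 0 = []" by (simp add: marks_def)
  show "takes (clear 1) (store x j i u k v out) (6 * i + 4) (store x j 0 u k v out)"
    by (rule takes_cong, rule takes_mono, rule takes_clear[of _ _ 0]; simp add: store_def fun_eq_iff marks0)
  show "takes (clear 2) (store x j i u k v out) (6 * u + 4) (store x j i 0 0 v out)" if "k \<le> u"
    by (rule takes_cong, rule takes_mono, rule takes_clear[of _ _ k]; simp add: store_def fun_eq_iff marks0 that)
  show "takes (clear 3) (store x j i u k v out) (6 * v + 4) (store x j i u k 0 out)"
    by (rule takes_cong, rule takes_mono, rule takes_clear[of _ _ v]; simp add: store_def fun_eq_iff marks0)
  show "takes (add_mark 1) (store x j i u k v out) (6 * i + 8) (store x j (Suc i) u k v out)"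
    by (rule takes_cong, rule takes_mono, rule takes_add_mark; simp add: store_def fun_eq_iff marks_Suc)
qed

subsection \<open>Emitting words with unary parts\<close>

text \<open>\<open>Unary\<close> is the code of \<open>i\<close> zero digits, which is all that
  multiplying a positive variable number by \<open>2 ^ i\<close> changes in a formula.\<close>

datatype piece = Const word | Unary

fun piece_word :: "nat \<Rightarrow> piece \<Rightarrow> word" where
  "piece_word i (Const u) = u"
| "piece_word i Unary = concat (replicate i [True, False])"

definition pieces_word :: "nat \<Rightarrow> piece list \<Rightarrow> word" where
  "pieces_word i ps = concat (map (piece_word i) ps)"

fun emit_word :: "word \<Rightarrow> com" where
  "emit_word [] = skip"
| "emit_word (b # u) = Seq (Append 4 b) (emit_word u)"

fun emit_piece :: "piece \<Rightarrow> com" where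
  "emit_piece (Const u) = emit_word u"
| "emit_piece Unary =
     Seq (While 1 (Seq (Append 4 True) (Seq (Append 4 False) (Move 1 1)))) (rewind 1)"

fun emit :: "piece list \<Rightarrow> com" where
  "emit [] = skip"
| "emit (p # ps) = Seq (emit_piece p) (emit ps)"

lemma takes_emit_word: "takes (emit_word b) (store x j i u k v out) (length b + 1) (store x j i u k v (out @ b))"
proof (induction b arbitrary: out)
  case Nil
  then show ?case using takes_skip by simp
next
  case (Cons a b)
  from takes_Seq[OF takes_store(4) Cons.IH[of "out @ [a]"]] show ?case by simp
qed

lemma takes_emit_unary:
  "takes (emit_piece Unary) (store x j i u k v out) (8 * i + 4)
     (store x j i u k v (out @ piece_word i Unary))"
proof -
  let ?out = "\<lambda>l. out @ concat (replicate l [True, False])"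
  \<comment> \<open>A \<open>store\<close> has the head of tape 1 at the start, so its position
    inside the loop is patched in.\<close>
  let ?F = "\<lambda>l. (fst (store x j i u k v (?out l)), (snd (store x j i u k v (?out l)))(1 := int l))"
  have "takes (While 1 (Seq (Append 4 True) (Seq (Append 4 False) (Move 1 1)))) (?F 0)
      (i * ((1 + (1 + 1)) + 2) + 1) (?F i)"
  proof (rule takes_While)
    fix l assume "l < i"
    have out: "?out (Suc l) = ?out l @ [True, False]"
      by (induction l) simp_all
    let ?w = "fst (store x j i u k v (?out l))" and ?h = "(snd (store x j i u k v (?out l)))(1 := int l)"
    have "takes (Append 4 True) (?F l) 1 (?w(4 := ?w 4 @ [True]), ?h(4 := ?h 4 + 1))"
      by (rule takes_Append) (simp add: store_def)
    moreover have "takes (Append 4 False) (?w(4 := ?w 4 @ [True]), ?h(4 := ?h 4 + 1)) 1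
        (?w(4 := ?w 4 @ [True, False]), ?h(4 := ?h 4 + 2))"
      by (rule takes_cong, simp only: fst_conv snd_conv, rule takes_Append)
        (simp_all add: store_def fun_eq_iff)
    moreover have "takes (Move 1 1) (?w(4 := ?w 4 @ [True, False]), ?h(4 := ?h 4 + 2)) 1 (?F (Suc l))"
      unfolding out by (rule takes_cong, simp only: fst_conv snd_conv, rule takes_Move)
        (simp add: store_def fun_eq_iff)
    ultimately have "takes (Seq (Append 4 True) (Seq (Append 4 False) (Move 1 1))) (?F l) (1 + (1 + 1)) (?F (Suc l))"
      by (blast intro: takes_Seq)
    moreover have "scanned_symbol (?F l) 1 \<noteq> 0"
      using \<open>l < i\<close> by (simp add: scanned_symbol_def store_def word_tape_eq_0)
    ultimately show "scanned_symbol (?F l) 1 \<noteq> 0 \<and>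
        takes (Seq (Append 4 True) (Seq (Append 4 False) (Move 1 1))) (?F l) (1 + (1 + 1)) (?F (Suc l))" by (rule conjI[rotated])
  qed (simp add: scanned_symbol_def store_def word_tape_eq_0)
  moreover have "takes (rewind 1) (?F i) (3 * i + 3) (store x j i u k v (?out i))"
    by (rule takes_cong, simp only: fst_conv snd_conv, rule takes_rewind)
      (simp_all add: store_def fun_eq_iff)
  moreover have "?F 0 = store x j i u k v out" by (simp add: store_def fun_eq_iff)
  ultimately show ?thesis
    using takes_mono[OF takes_Seq] by fastforce
qed

text \<open>Costs are per unit of \<open>i + 1\<close>; the constant 8 covers the
  \<open>8 * i + 4\<close> steps of a unary part.\<close>

fun piece_cost :: "piece \<Rightarrow> nat" where
  "piece_cost (Const u) = length u + 1"
| "piece_cost Unary = 8"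

definition cost :: "piece list \<Rightarrow> nat" where
  "cost ps = sum_list (map piece_cost ps) + 1"

lemma takes_emit:
  "takes (emit ps) (store x j i u k v out) (cost ps * (i + 1)) (store x j i u k v (out @ pieces_word i ps))"
proof (induction ps arbitrary: out)
  case Nil
  then show ?case using takes_mono[OF takes_skip] by (simp add: pieces_word_def cost_def)
next
  case (Cons p ps)
  have "takes (emit_piece p) (store x j i u k v out) (piece_cost p * (i + 1))
      (store x j i u k v (out @ piece_word i p))"
    using takes_mono[OF takes_emit_word] takes_mono[OF takes_emit_unary] by (cases p) simp_all
  from takes_Seq[OF this Cons.IH] show ?case
    by (simp add: pieces_word_def cost_def algebra_simps)
qed

text \<open>The index tape counts the rounds and keeps the final value, so that a trailing instance
  can be written with the bound itself as index.\<close>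

definition emit_bound :: "piece list \<Rightarrow> com" where
  "emit_bound ps = Seq (While 2 (Seq (emit ps) (Seq (add_mark 1) (Move 2 1)))) (rewind 2)"

definition emit_input :: "piece list \<Rightarrow> piece list \<Rightarrow> com" where
  "emit_input ps qs =
     Seq (While 0 (Seq (Cond 0 (emit ps) (emit qs)) (Seq (add_mark 1) (Move 0 1)))) (rewind 0)"

lemma takes_emit_bound:
  "takes (emit_bound ps) (store x 0 0 u 0 v out) (u * (cost ps * u + 6 * u + 12) + 3 * u + 4)
     (store x 0 u u 0 v (out @ concat (map (\<lambda>i. pieces_word i ps) [0..<u])))"
proof -
  let ?out = "\<lambda>l. out @ concat (map (\<lambda>i. pieces_word i ps) [0..<l])"
  let ?F = "\<lambda>l. store x 0 l u l v (?out l)"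
  have "takes (While 2 (Seq (emit ps) (Seq (add_mark 1) (Move 2 1)))) (?F 0)
      (u * ((cost ps * u + 6 * u + 10) + 2) + 1) (?F u)"
  proof (rule takes_While)
    fix l assume l: "l < u"
    have "takes (Seq (emit ps) (Seq (add_mark 1) (Move 2 1))) (?F l)
        (cost ps * (l + 1) + ((6 * l + 8) + 1)) (?F (Suc l))"
      using takes_Seq[OF takes_emit[of ps x 0 l u l v "?out l"]
          takes_Seq[OF takes_store_clear(4) takes_store(2)]] by simp
    then have "takes (Seq (emit ps) (Seq (add_mark 1) (Move 2 1))) (?F l)
        (cost ps * u + 6 * u + 10) (?F (Suc l))"
      by (rule takes_mono) (use l mult_le_mono2[of "l + 1" u "cost ps"] in simp)
    then show "scanned_symbol (?F l) 2 \<noteq> 0 \<and> takes (Seq (emit ps) (Seq (add_mark 1) (Move 2 1))) (?F l)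
        (cost ps * u + 6 * u + 10) (?F (Suc l))"
      using l by (simp add: symbol_at_eq_0)
  qed (simp add: symbol_at_eq_0)
  from takes_Seq[OF this takes_store_rewind(2)] show ?thesis
    by (simp add: emit_bound_def algebra_simps)
qed

lemma takes_emit_input:
  fixes x :: word
  defines "n \<equiv> length x"
  shows "takes (emit_input ps qs) (store x 0 0 u 0 v out) (n * ((cost ps + cost qs) * n + 6 * n + 14) + 3 * n + 4)
     (store x 0 n u 0 v (out @ concat (map (\<lambda>j. pieces_word j (if x ! j then ps else qs)) [0..<n])))"
proof -
  let ?out = "\<lambda>l. out @ concat (map (\<lambda>j. pieces_word j (if x ! j then ps else qs)) [0..<l])"
  let ?F = "\<lambda>l. store x l l u 0 v (?out l)"
  let ?c = "Seq (Cond 0 (emit ps) (emit qs)) (Seq (add_mark 1) (Move 0 1))"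
  have "takes (While 0 ?c) (?F 0) (n * (((cost ps + cost qs) * n + 6 * n + 12) + 2) + 1) (?F n)"
  proof (rule takes_While)
    fix l assume l: "l < n"
    then have x: "symbol_at x l = (if x ! l then 2 else 1)" by (simp add: symbol_at_def n_def)
    have "takes (Cond 0 (emit ps) (emit qs)) (?F l) ((cost ps + cost qs) * (l + 1) + 2)
        (store x l l u 0 v (?out l @ pieces_word l (if x ! l then ps else qs)))"
    proof (rule takes_Cond)
      assume "scanned_symbol (?F l) 0 = 2"
      then have "x ! l" using x by (simp split: if_splits)
      then show "takes (emit ps) (?F l) ((cost ps + cost qs) * (l + 1))
          (store x l l u 0 v (?out l @ pieces_word l (if x ! l then ps else qs)))"
        using takes_mono[OF takes_emit[of ps x l l u 0 v "?out l"]] by (simp add: algebra_simps)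
    next
      assume "scanned_symbol (?F l) 0 \<noteq> 2"
      then have "\<not> x ! l" using x by (simp split: if_splits)
      then show "takes (emit qs) (?F l) ((cost ps + cost qs) * (l + 1))
          (store x l l u 0 v (?out l @ pieces_word l (if x ! l then ps else qs)))"
        using takes_mono[OF takes_emit[of qs x l l u 0 v "?out l"]] by (simp add: algebra_simps)
    qed
    from takes_Seq[OF this takes_Seq[OF takes_store_clear(4) takes_store(1)]]
    have "takes ?c (?F l) ((cost ps + cost qs) * (l + 1) + 2 + ((6 * l + 8) + 1)) (?F (Suc l))"
      by simp
    then have "takes ?c (?F l) ((cost ps + cost qs) * n + 6 * n + 12) (?F (Suc l))"
      by (rule takes_mono) (use l mult_le_mono2[of "l + 1" n "cost ps + cost qs"] in simp)
    then show "scanned_symbol (?F l) 0 \<noteq> 0 \<and> takes ?c (?F l) ((cost ps + cost qs) * n + 6 * n + 12) (?F (Suc l))"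
      using x by simp
  qed (simp add: symbol_at_eq_0 n_def)
  from takes_Seq[OF this takes_store_rewind(1)] show ?thesis
    by (simp add: emit_input_def algebra_simps n_def)
qed

subsection \<open>Evaluating a polynomial in unary\<close>

fun horner :: "nat \<Rightarrow> nat list \<Rightarrow> nat" where
  "horner n [] = 0"
| "horner n (a # as) = a + n * horner n as"

lemma poly_eq_horner: "poly p n = horner n (coeffs p)"
proof -
  have "horner_sum id n as = horner n as" for as
    by (induction as) auto
  then show ?thesis by (simp add: poly_def fold_coeffs_def)
qed

fun add_marks :: "nat \<Rightarrow> com" where
  "add_marks 0 = skip"
| "add_marks (Suc a) = Seq (Append 2 False) (add_marks a)"

text \<open>One round of Horner's scheme in unary: for every input symbol tape 2 is copied to tape
  3, which multiplies it by the input length; the product replaces tape 2 and \<open>a\<close> marks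
  are added.\<close>

definition horner_step :: "nat \<Rightarrow> com" where
  "horner_step a =
     Seq (While 0 (Seq (While 2 (Seq (Append 3 False) (Move 2 1))) (Seq (rewind 2) (Move 0 1))))
    (Seq (rewind 0)
    (Seq (clear 2)
    (Seq (Seq (rewind 3) (While 3 (Seq (Append 2 False) (Move 3 1))))
    (Seq (clear 3)
    (Seq (add_marks a) (rewind 2))))))"

fun horner_com :: "nat list \<Rightarrow> com" where
  "horner_com [] = skip"
| "horner_com (a # as) = Seq (horner_com as) (horner_step a)"

lemma takes_add_marks:
  "takes (add_marks a) (store x j i u u v out) (a + 1) (store x j i (u + a) (u + a) v out)"
proof (induction a arbitrary: u)
  case 0
  then show ?case using takes_skip by simp
next
  case (Suc a)
  from takes_Seq[OF takes_store(5) Suc.IH[of "Suc u"]] show ?case by simp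
qed

lemma takes_copy:
  "takes (While 2 (Seq (Append 3 False) (Move 2 1))) (store x j i u 0 v out) (4 * u + 1)
     (store x j i u u (v + u) out)"
proof -
  let ?F = "\<lambda>l. store x j i u l (v + l) out"
  have "takes (While 2 (Seq (Append 3 False) (Move 2 1))) (?F 0) (u * ((1 + 1) + 2) + 1) (?F u)"
  proof (rule takes_While)
    fix l assume "l < u"
    then show "scanned_symbol (?F l) 2 \<noteq> 0 \<and> takes (Seq (Append 3 False) (Move 2 1)) (?F l) (1 + 1) (?F (Suc l))"
      using takes_Seq[OF takes_store(3)[of x j i u l "v + l" out] takes_store(2)] by (simp add: symbol_at_eq_0)
  qed (simp add: symbol_at_eq_0)
  from takes_mono[OF this, of "4 * u + 1"] show ?thesis by simp
qed

lemma takes_multiply: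
  fixes x :: word
  defines "n \<equiv> length x"
  shows "takes (While 0 (Seq (While 2 (Seq (Append 3 False) (Move 2 1))) (Seq (rewind 2) (Move 0 1))))
     (store x 0 i u 0 0 out) (n * (7 * u + 7) + 1) (store x n i u 0 (n * u) out)"
proof -
  let ?F = "\<lambda>l. store x l i u 0 (l * u) out"
  let ?c = "Seq (While 2 (Seq (Append 3 False) (Move 2 1))) (Seq (rewind 2) (Move 0 1))"
  have "takes (While 0 ?c) (?F 0) (n * (((4 * u + 1) + ((3 * u + 3) + 1)) + 2) + 1) (?F n)"
  proof (rule takes_While)
    fix l assume "l < n"
    then show "scanned_symbol (?F l) 0 \<noteq> 0 \<and> takes ?c (?F l) ((4 * u + 1) + ((3 * u + 3) + 1)) (?F (Suc l))"
      using takes_Seq[OF takes_copy[of x l i u "l * u" out] takes_Seq[OF takes_store_rewind(2) takes_store(1)]]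
      by (simp add: symbol_at_eq_0 n_def add.commute)
  qed (simp add: symbol_at_eq_0 n_def)
  then show ?thesis by (simp add: algebra_simps)
qed

lemma takes_transfer:
  "takes (Seq (rewind 3) (While 3 (Seq (Append 2 False) (Move 3 1)))) (store x j i 0 0 v out)
     (7 * v + 4) (store x j i v v v out)"
proof -
  let ?F = "\<lambda>l. (fst (store x j i l l v out), (snd (store x j i l l v out))(3 := int l))"
  let ?c = "Seq (Append 2 False) (Move 3 1)"
  have "takes (While 3 ?c) (?F 0) (v * ((1 + 1) + 2) + 1) (?F v)"
  proof (rule takes_While)
    fix l assume "l < v"
    have "takes ?c (?F l) (1 + 1) (?F (Suc l))"
    proof (rule takes_Seq)
      let ?w = "fst (store x j i l l v out)" and ?h = "(snd (store x j i l l v out))(3 := int l)"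
      show "takes (Append 2 False) (?F l) 1 (?w(2 := ?w 2 @ [False]), ?h(2 := ?h 2 + 1))"
        by (rule takes_Append) (simp add: store_def)
      show "takes (Move 3 1) (?w(2 := ?w 2 @ [False]), ?h(2 := ?h 2 + 1)) 1 (?F (Suc l))"
        by (rule takes_cong, simp only: fst_conv snd_conv, rule takes_Move)
          (simp add: store_def fun_eq_iff marks_Suc)
    qed
    moreover have "scanned_symbol (?F l) 3 \<noteq> 0"
      using \<open>l < v\<close> by (simp add: scanned_symbol_def store_def word_tape_eq_0)
    ultimately show "scanned_symbol (?F l) 3 \<noteq> 0 \<and> takes ?c (?F l) (1 + 1) (?F (Suc l))"
      by (rule conjI[rotated])
  qed (simp add: scanned_symbol_def store_def word_tape_eq_0)
  moreover have "?F v = store x j i v v v out" by (simp add: store_def fun_eq_iff)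
  moreover have "takes (rewind 3) (store x j i 0 0 v out) (3 * v + 3) (?F 0)"
    by (rule takes_cong, rule takes_rewind[of _ _ v]) (simp_all add: store_def fun_eq_iff)
  ultimately have "takes (Seq (rewind 3) (While 3 ?c)) (store x j i 0 0 v out)
      ((3 * v + 3) + (v * ((1 + 1) + 2) + 1)) (store x j i v v v out)"
    using takes_Seq by metis
  then show ?thesis by (rule takes_mono) simp
qed

lemma takes_horner_step:
  fixes x :: word
  defines "n \<equiv> length x"
  shows "takes (horner_step a) (store x 0 i u 0 0 out) (23 * (n * u) + 10 * n + 6 * u + 4 * a + 20)
     (store x 0 i (a + n * u) 0 0 out)"
proof -
  have "takes (horner_step a) (store x 0 i u 0 0 out)
      ((n * (7 * u + 7) + 1) + ((3 * n + 3) + ((6 * u + 4) + ((7 * (n * u) + 4) + ((6 * (n * u) + 4) +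
        ((a + 1) + (3 * (n * u + a) + 3))))))) (store x 0 i (n * u + a) 0 0 out)"
    unfolding horner_step_def n_def
    by (intro takes_Seq[OF takes_multiply] takes_Seq[OF takes_store_rewind(1)]
        takes_Seq[OF takes_store_clear(2)] takes_Seq[OF takes_transfer] takes_Seq[OF takes_store_clear(3)]
        takes_Seq[OF takes_add_marks] takes_store_rewind(2)) simp_all
  then show ?thesis by (simp add: algebra_simps)
qed

definition poly_bounded :: "(nat \<Rightarrow> nat) \<Rightarrow> bool" where
  "poly_bounded g \<longleftrightarrow> (\<exists>p. \<forall>n. g n \<le> poly p n)"

lemma poly_bounded_add: "poly_bounded f \<Longrightarrow> poly_bounded g \<Longrightarrow> poly_bounded (\<lambda>n. f n + g n)"
  unfolding poly_bounded_def by (metis add_mono poly_add)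

lemma poly_bounded_mult: "poly_bounded f \<Longrightarrow> poly_bounded g \<Longrightarrow> poly_bounded (\<lambda>n. f n * g n)"
  unfolding poly_bounded_def by (metis mult_le_mono poly_mult)

lemma poly_bounded_const: "poly_bounded (\<lambda>_. c)"
  unfolding poly_bounded_def by (intro exI[of _ "[:c:]"]) simp

lemma poly_bounded_id: "poly_bounded (\<lambda>n. n)"
  unfolding poly_bounded_def by (intro exI[of _ "[:0, 1:]"]) simp

lemma poly_bounded_poly: "poly_bounded (poly p)"
  unfolding poly_bounded_def by blast

lemma poly_bounded_horner: "poly_bounded (\<lambda>n. horner n as)"
proof (induction as)
  case Nil
  then show ?case using poly_bounded_const[of 0] by simp
next
  case (Cons a as)
  have "poly_bounded (\<lambda>n. a + n * horner n as)"
    by (intro poly_bounded_add poly_bounded_mult poly_bounded_const poly_bounded_id Cons.IH)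
  then show ?case by simp
qed

lemmas poly_bounded_intros = poly_bounded_add poly_bounded_mult poly_bounded_const poly_bounded_id
  poly_bounded_poly poly_bounded_horner

lemma takes_horner:
  "\<exists>g. poly_bounded g \<and> (\<forall>x. takes (horner_com as) (store x 0 0 0 0 0 []) (g (length x))
     (store x 0 0 (horner (length x) as) 0 0 []))"
proof (induction as)
  case Nil
  then show ?case using takes_skip poly_bounded_const[of 1] by (intro exI[of _ "\<lambda>_. 1"]) simp
next
  case (Cons a as)
  then obtain g where g: "poly_bounded g"
    "\<And>x. takes (horner_com as) (store x 0 0 0 0 0 []) (g (length x)) (store x 0 0 (horner (length x) as) 0 0 [])"
    by blast
  let ?g = "\<lambda>n. g n + (23 * (n * horner n as) + 10 * n + 6 * horner n as + 4 * a + 20)"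
  have "poly_bounded ?g" by (intro poly_bounded_intros g(1))
  moreover have "takes (horner_com (a # as)) (store x 0 0 0 0 0 []) (?g (length x))
      (store x 0 0 (horner (length x) (a # as)) 0 0 [])" for x
    using takes_Seq[OF g(2) takes_horner_step] by simp
  ultimately show ?case by blast
qed

subsection \<open>Generators\<close>

text \<open>One instance per index below the bound, or per input letter with the template chosen by
  the letter, followed by a closing instance at the bound or at the input length. Constant text is a
  block with an empty repeated part.\<close>

datatype block = Bounded "piece list" "piece list" | Input "piece list" "piece list" "piece list"

fun block_word :: "nat \<Rightarrow> word \<Rightarrow> block \<Rightarrow> word" where
  "block_word u x (Bounded ps qs) = concat (map (\<lambda>i. pieces_word i ps) [0..<u]) @ pieces_word u qs"
| "block_word u x (Input ps qs rs) =
     concat (map (\<lambda>j. pieces_word j (if x ! j then ps else qs)) [0..<length x]) @ pieces_word (length x) rs"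

definition generate :: "nat poly \<Rightarrow> block list \<Rightarrow> word \<Rightarrow> word" where
  "generate p bs x = concat (map (block_word (poly p (length x)) x) bs)"

fun block_com :: "block \<Rightarrow> com" where
  "block_com (Bounded ps qs) = Seq (emit_bound ps) (Seq (emit qs) (clear 1))"
| "block_com (Input ps qs rs) = Seq (emit_input ps qs) (Seq (emit rs) (clear 1))"

fun blocks_com :: "block list \<Rightarrow> com" where
  "blocks_com [] = skip"
| "blocks_com (b # bs) = Seq (block_com b) (blocks_com bs)"

lemma takes_block:
  "\<exists>g. poly_bounded g \<and> (\<forall>x out. takes (block_com b) (store x 0 0 (poly p (length x)) 0 0 out) (g (length x))
     (store x 0 0 (poly p (length x)) 0 0 (out @ block_word (poly p (length x)) x b)))"
proof (cases b)
  case (Bounded ps qs)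
  let ?g = "\<lambda>n. (poly p n * (cost ps * poly p n + 6 * poly p n + 12) + 3 * poly p n + 4) +
    (cost qs * (poly p n + 1) + (6 * poly p n + 4))"
  have "poly_bounded ?g" by (intro poly_bounded_intros)
  moreover have "takes (block_com b) (store x 0 0 (poly p (length x)) 0 0 out) (?g (length x))
     (store x 0 0 (poly p (length x)) 0 0 (out @ block_word (poly p (length x)) x b))" for x out
    using takes_Seq[OF takes_emit_bound[of ps x "poly p (length x)" 0 out] takes_Seq[OF takes_emit[of qs] takes_store_clear(1)]] Bounded
    by simp
  ultimately show ?thesis by blast
next
  case (Input ps qs rs)
  let ?g = "\<lambda>n. (n * ((cost ps + cost qs) * n + 6 * n + 14) + 3 * n + 4) +
    (cost rs * (n + 1) + (6 * n + 4))"
  have "poly_bounded ?g" by (intro poly_bounded_intros)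
  moreover have "takes (block_com b) (store x 0 0 (poly p (length x)) 0 0 out) (?g (length x))
     (store x 0 0 (poly p (length x)) 0 0 (out @ block_word (poly p (length x)) x b))" for x out
    using takes_Seq[OF takes_emit_input[of ps qs x "poly p (length x)" 0 out] takes_Seq[OF takes_emit[of rs] takes_store_clear(1)]] Input
    by simp
  ultimately show ?thesis by blast
qed

lemma takes_blocks:
  "\<exists>g. poly_bounded g \<and> (\<forall>x out. takes (blocks_com bs) (store x 0 0 (poly p (length x)) 0 0 out) (g (length x))
     (store x 0 0 (poly p (length x)) 0 0 (out @ generate p bs x)))"
proof (induction bs)
  case Nil
  then show ?case using takes_skip poly_bounded_const[of 1]
    by (intro exI[of _ "\<lambda>_. 1"]) (simp add: generate_def)
next
  case (Cons b bs)
  then obtain g where g: "poly_bounded g"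
    "\<And>x out. takes (blocks_com bs) (store x 0 0 (poly p (length x)) 0 0 out) (g (length x))
     (store x 0 0 (poly p (length x)) 0 0 (out @ generate p bs x))" by blast
  obtain h where h: "poly_bounded h"
    "\<And>x out. takes (block_com b) (store x 0 0 (poly p (length x)) 0 0 out) (h (length x))
     (store x 0 0 (poly p (length x)) 0 0 (out @ block_word (poly p (length x)) x b))"
    using takes_block by blast
  have "takes (blocks_com (b # bs)) (store x 0 0 (poly p (length x)) 0 0 out) (h (length x) + g (length x))
     (store x 0 0 (poly p (length x)) 0 0 (out @ generate p (b # bs) x))" for x out
    using takes_Seq[OF h(2)[of x out] g(2)] by (simp add: generate_def)
  then show ?case using poly_bounded_add[OF h(1) g(1)] by (intro exI[of _ "\<lambda>n. h n + g n"]) simp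
qed

lemma well_formed_basic:
  "t < k \<Longrightarrow> well_formed k (rewind t)" "t < k \<Longrightarrow> well_formed k (clear t)"
  "t < k \<Longrightarrow> well_formed k (add_mark t)" "0 < k \<Longrightarrow> well_formed k skip"
  by (auto simp: rewind_def clear_def add_mark_def to_end_def skip_def)

lemma well_formed_emit: "well_formed 5 (emit ps)"
proof -
  have "well_formed 5 (emit_word u)" for u by (induction u) (auto simp: well_formed_basic)
  then have "well_formed 5 (emit_piece p)" for p by (cases p) (auto simp: well_formed_basic)
  then show ?thesis by (induction ps) (auto simp: well_formed_basic)
qed

lemma well_formed_horner: "well_formed 5 (horner_com as)"
proof -
  have "well_formed 5 (add_marks a)" for a by (induction a) (auto simp: well_formed_basic)
  then show ?thesis
    by (induction as) (auto simp: well_formed_basic horner_step_def)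
qed

lemma well_formed_blocks: "well_formed 5 (blocks_com bs)"
proof -
  have "well_formed 5 (block_com b)" for b
    by (cases b) (auto simp: well_formed_basic well_formed_emit emit_bound_def emit_input_def)
  then show ?thesis by (induction bs) (auto simp: well_formed_basic)
qed

theorem polytime_generate: "polytime_computable (generate p bs)"
proof -
  let ?c = "Seq (horner_com (coeffs p)) (blocks_com bs)"
  \<comment> \<open>Five tapes make tape 4 the last one, from which the output is read.\<close>
  let ?M = "machine_of 5 (compile ?c 0)"
  obtain g h where g: "poly_bounded g" "\<And>x. takes (horner_com (coeffs p)) (store x 0 0 0 0 0 []) (g (length x))
     (store x 0 0 (poly p (length x)) 0 0 [])"
    and h: "poly_bounded h" "\<And>x out. takes (blocks_com bs) (store x 0 0 (poly p (length x)) 0 0 out) (h (length x))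
     (store x 0 0 (poly p (length x)) 0 0 (out @ generate p bs x))"
    using takes_horner[of "coeffs p"] takes_blocks[of bs p] unfolding poly_eq_horner by blast
  from poly_bounded_add[OF g(1) h(1)] obtain q where q: "\<And>n. g n + h n \<le> poly q n"
    unfolding poly_bounded_def by blast
  have wf: "well_formed 5 ?c" using well_formed_horner well_formed_blocks by simp
  have "\<exists>n c. n \<le> poly q (length x) \<and> (step ?M ^^ n) (init x) c \<and> halted ?M c \<and>
      tape c (tapes ?M - 1) = word_tape (generate p bs x)" for x
  proof -
    let ?s = "store x 0 0 (poly p (length x)) 0 0 (generate p bs x)"
    have "takes ?c (store x 0 0 0 0 0 []) (g (length x) + h (length x)) ?s"
      using takes_Seq[OF g(2) h(2)[of x "[]"]] by simp
    then obtain n where n: "n \<le> poly q (length x)" "big_step ?c (store x 0 0 0 0 0 []) n ?s"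
      using q[of "length x"] unfolding takes_def by (meson order_trans)
    have "init x = conf 0 (store x 0 0 0 0 0 [])"
      unfolding init_conf by (simp add: store_def marks_def conf_def fun_eq_iff)
    moreover have "at_segment (compile ?c 0) 0 (compile ?c 0)"
      unfolding at_segment_def by (intro exI[of _ "[]"]) simp
    ultimately have "(step ?M ^^ n) (init x) (conf (code_size ?c) ?s)"
      using compile_correct[OF n(2) wf, of "compile ?c 0" 0] by simp
    moreover have "halted ?M (conf (code_size ?c) ?s)"
      by (auto simp: halted_def step_iff conf_def machine_of_def)
    moreover have "tape (conf (code_size ?c) ?s) (tapes ?M - 1) = word_tape (generate p bs x)"
      by (simp add: conf_def store_def)
    ultimately show ?thesis using n(1) by blast
  qed
  then have "computes_in_time ?M (poly q) (generate p bs)"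
    using wf_machine_of[OF wf] deterministic_machine_of unfolding computes_in_time_def by simp
  then show ?thesis unfolding polytime_computable_def by blast
qed


section \<open>The reduction\<close>

primrec inst :: "nat \<Rightarrow> fm \<Rightarrow> fm" where
  "inst i (Var v) = Var (if odd v then v else v * 2 ^ i)"
| "inst i Bot = Bot"
| "inst i (Imp \<phi> \<psi>) = Imp (inst i \<phi>) (inst i \<psi>)"
| "inst i (Box \<phi>) = Box (inst i \<phi>)"

lemma inst_At [simp]:
  "inst i (At (G g)) = At (G g)" "inst i (At (I b j)) = At (I b (i + j))"
  by (simp_all add: idx.simps power_add ac_simps)

declare inst.simps(1) [simp del]

lemma inst_imps [simp]: "inst i (imps xs \<phi>) = imps (map (inst i) xs) (inst i \<phi>)"
  by (induction xs) auto

lemma inst_disj [simp]: "inst i (disj xs) = disj (map (inst i) xs)"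
  by (simp add: disj_def comp_def)

lemma inst_boxed: "map (inst i) (boxed xs) = boxed (map (inst i) xs)"
  by (simp add: boxed_def map_concat comp_def)

lemma inst_level_items: "map (inst i) (level_items \<Delta> 0) = level_items \<Delta> i"
proof -
  have "inst i (edge_item 0 e) = edge_item i e" for e
    by (cases e) (simp add: edge_item_def)
  moreover have "map (inst i) (letter_items 0 c) = letter_items i c" for c
    by (simp add: letter_items_def)
  ultimately show ?thesis by (simp add: level_items_def map_concat comp_def)
qed

lemma inst_input_clause: "inst j (clause_item (input_clause cs s 0)) = clause_item (input_clause cs s j)"
  by (simp add: clause_item_def input_clause_def comp_def)

lemma inst_input_rule: "inst j (rule_item (input_rule 0)) = rule_item (input_rule j)"
  by (simp add: rule_item_def input_rule_def comp_def)

lemma inst_end_rule: "inst n (rule_item (end_rule cs 0)) = rule_item (end_rule cs n)"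
  by (simp add: rule_item_def end_rule_def comp_def)

section \<open>Writing shifted copies of a formula\<close>

primrec template :: "fm \<Rightarrow> piece list" where
  "template (Var v) =
     (if odd v then [Const (encode (Var v))]
      else [Const [False, False], Unary, Const (concat (map (\<lambda>b. [True, b]) (digits v)) @ [False])])"
| "template Bot = [Const [False, True]]"
| "template (Imp \<phi> \<psi>) = Const [True, False] # template \<phi> @ template \<psi>"
| "template (Box \<phi>) = Const [True, True] # template \<phi>"

lemma pieces_word_simps [simp]:
  "pieces_word i [] = []" "pieces_word i (p # ps) = piece_word i p @ pieces_word i ps"
  "pieces_word i (ps @ qs) = pieces_word i ps @ pieces_word i qs"
  by (simp_all add: pieces_word_def)

lemma digits_shift:
  assumes "0 < v"
  shows "digits (v * 2 ^ i) = replicate i False @ digits v"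
proof (induction i)
  case (Suc i)
  have "digits (v * 2 ^ Suc i) = odd (v * 2 ^ Suc i) # digits (v * 2 ^ Suc i div 2)"
    using assms by (subst digits.simps) simp
  also have "v * 2 ^ Suc i div 2 = v * 2 ^ i" by simp
  finally show ?case using Suc by simp
qed simp

text \<open>Number 0 has no digits and would wrongly acquire some from the unary part, hence the
  premise; the numbers \<open>idx a\<close> are all positive.\<close>

lemma pieces_template: "0 \<notin> vars \<phi> \<Longrightarrow> pieces_word i (template \<phi>) = encode (inst i \<phi>)"
proof (induction \<phi>)
  case (Var v)
  have "concat (map (\<lambda>b. [True, b]) (replicate i False)) = concat (replicate i [True, False])"
    by (induction i) auto
  with Var show ?case by (simp add: digits_shift inst.simps(1))
qed auto

lemma idx_pos [simp]: "0 < idx a" "idx a \<noteq> 0"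
  by (cases a; simp add: idx.simps)+

definition prefixes :: "fm list \<Rightarrow> word" where
  "prefixes xs = concat (map (\<lambda>x. [True, False] @ encode x) xs)"

lemma prefixes_append [simp]: "prefixes (xs @ ys) = prefixes xs @ prefixes ys"
  by (simp add: prefixes_def)

lemma prefixes_Cons: "prefixes (x # xs) = [True, False] @ encode x @ prefixes xs"
  by (simp add: prefixes_def)

lemma prefixes_concat: "prefixes (concat xss) = concat (map prefixes xss)"
  by (induction xss) (auto simp: prefixes_def)

lemma encode_imps: "encode (imps xs \<phi>) = prefixes xs @ encode \<phi>"
  by (induction xs) (auto simp: prefixes_def)

definition templates :: "fm list \<Rightarrow> piece list" where
  "templates xs = concat (map (\<lambda>x. Const [True, False] # template x) xs)"

lemma pieces_templates:
  "\<forall>x\<in>set xs. 0 \<notin> vars x \<Longrightarrow> pieces_word i (templates xs) = prefixes (map (inst i) xs)"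
  by (induction xs) (auto simp: templates_def prefixes_def pieces_template)

section \<open>The generated pair of formulas\<close>

definition trivial :: "atom \<Rightarrow> fm" where "trivial a = Imp (At a) (At a)"

definition const_part :: "cell list \<Rightarrow> fm list" where
  "const_part cs = Neg (At (G E)) # map (\<lambda>s. At (G (Phase s))) starts @
     boxed (const_items @ map clause_item (const_clauses cs) @ map rule_item (const_rules cs))"

definition root_part :: "nat \<Rightarrow> fm list" where
  "root_part P = At (I Level P) # boxed [At (I Match P), At (I Match' P)]"

definition input_part :: "cell list \<Rightarrow> nat \<Rightarrow> nat \<Rightarrow> fm list" where
  "input_part cs s j = boxed [clause_item (input_clause cs s j), rule_item (input_rule j)]"

definition end_part :: "cell list \<Rightarrow> nat \<Rightarrow> fm list" where
  "end_part cs n = boxed [clause_item (input_clause cs 0 n), rule_item (end_rule cs n)]"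

text \<open>The order follows the blocks of the generator: a constant part, one part per digit, one
  at the bound, one per input letter and one at the input length.\<close>

definition red_items :: "cell list \<Rightarrow> nat \<Rightarrow> word \<Rightarrow> fm list" where
  "red_items cs P x = const_part cs @ concat (map (\<lambda>i. boxed (level_items edges i)) [0..<P]) @ root_part P @
     concat (map (\<lambda>j. input_part cs (if x ! j then 2 else 1) j) [0..<length x]) @ end_part cs (length x)"

definition label_atoms :: "nat \<Rightarrow> atom list" where
  "label_atoms i = map (\<lambda>c. I (Label c) i) letters"

definition red_shared :: "cell list \<Rightarrow> nat \<Rightarrow> nat \<Rightarrow> atom list" where
  "red_shared cs P n = (G E # map tile cs) @ concat (map label_atoms [0..<P]) @ map mark [0..<n] @ [mark n]"

lemma zero_not_vars [simp]:
  "0 \<notin> vars (At a)" "0 \<notin> vars (trivial a)" "0 \<notin> vars (clause_item r)" "0 \<notin> vars (rule_item q)"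
  by (auto simp: trivial_def clause_item_def rule_item_def split: prod.splits)

lemma zero_not_level: "x \<in> set (level_items \<Delta> i) \<Longrightarrow> 0 \<notin> vars x"
  by (auto simp: level_items_def edge_item_def letter_items_def split: prod.splits)

text \<open>The initial \<open>[True, False]\<close> is the outer implication of the negation
  \<open>lhs\<close>, and \<open>[False, True, False, True]\<close> supplies the two occurrences of
  \<open>Bot\<close> that close it. In the last block both letters use the same template, since a
  mark is shared for every input position.\<close>

definition red_blocks :: "cell list \<Rightarrow> block list" where
  "red_blocks cs =
     [Bounded [] [Const ([True, False] @ prefixes (const_part cs))],
      Bounded (templates (boxed (level_items edges 0))) (templates (root_part 0)),
      Input (templates (input_part cs 2 0)) (templates (input_part cs 1 0))
        (templates (end_part cs 0) @ [Const [False, True, False, True]]),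
      Bounded [] [Const (prefixes (map trivial (G E # map tile cs)))],
      Bounded (templates (map trivial (label_atoms 0))) [],
      Input (templates [trivial (mark 0)]) (templates [trivial (mark 0)])
        (templates [trivial (mark 0)] @ [Const (encode (imps cluster_items Bot))])]"

lemma generate_red_blocks:
  assumes "poly p (length x) = P"
  shows "generate p (red_blocks cs) x =
    encode (Neg (imps (red_items cs P x) Bot)) @
    encode (imps (map trivial (red_shared cs P (length x))) (imps cluster_items Bot))"
proof -
  have level: "pieces_word i (templates (boxed (level_items edges 0))) = prefixes (boxed (level_items edges i))" for i
    by (subst pieces_templates) (auto simp: inst_boxed inst_level_items zero_not_level)
  have root: "pieces_word i (templates (root_part 0)) = prefixes (root_part i)" for i
    by (subst pieces_templates) (auto simp: root_part_def inst_boxed)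
  have input: "pieces_word i (templates (input_part cs s 0)) = prefixes (input_part cs s i)" for i s
    by (subst pieces_templates) (auto simp: input_part_def inst_boxed inst_input_clause inst_input_rule)
  have finish: "pieces_word i (templates (end_part cs 0)) = prefixes (end_part cs i)" for i
    by (subst pieces_templates) (auto simp: end_part_def inst_boxed inst_input_clause inst_end_rule)
  have label: "pieces_word i (templates (map trivial (label_atoms 0))) = prefixes (map trivial (label_atoms i))" for i
    by (subst pieces_templates) (auto simp: label_atoms_def trivial_def comp_def)
  have mark: "pieces_word i (templates [trivial (mark 0)]) = prefixes [trivial (mark i)]" for i
    by (subst pieces_templates) (auto simp: trivial_def)
  have if_distrib': "pieces_word j (if b then templates (input_part cs 2 0) else templates (input_part cs 1 0)) =
      prefixes (input_part cs (if b then 2 else 1) j)" for j b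
    by (simp add: input)
  have marks: "prefixes (map (\<lambda>j. trivial (mark j)) js) = concat (map (\<lambda>j. prefixes [trivial (mark j)]) js)" for js
    by (induction js) (auto simp: prefixes_def)
  have const: "block_word u x (Bounded [] qs) = pieces_word u qs" for u qs
    by (induction u) simp_all
  show ?thesis
    using assms unfolding red_blocks_def generate_def list.map const
    by (simp add: red_items_def red_shared_def level root finish label mark if_distrib'
        marks prefixes_concat encode_imps map_concat comp_def prefixes_Cons del: One_nat_def)
qed

lemma gadget_reduction:
  assumes "0 < P"
  shows "gadget P edges starts (all_rules cs x) (all_clauses cs x) (red_items cs P x) (red_shared cs P (length x))"
proof
  show "0 < P" by fact
  let ?n = "length x"
  have "{..?n} = insert ?n {0..<?n}" by auto
  moreover have "symbol_at x ?n = 0" by (simp add: symbol_at_def)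
  moreover have "(\<lambda>j. input_clause cs (symbol_at x j) j) ` {0..<?n} =
      (\<lambda>j. input_clause cs (if x ! j then 2 else 1) j) ` {0..<?n}"
    by (rule image_cong) (simp_all add: symbol_at_def)
  ultimately have "all_clauses cs x = set (const_clauses cs) \<union> (\<lambda>j. input_clause cs (if x ! j then 2 else 1) j) ` {0..<?n} \<union>
      {input_clause cs 0 ?n}"
    by (simp add: all_clauses_def)
  then show "set (red_items cs P x) = {At (I Level P), Neg (At (G E))} \<union> At ` G ` Phase ` set starts \<union>
      set (boxed (tree_items edges P)) \<union>
      (\<Union>y \<in> clause_item ` all_clauses cs x \<union> rule_item ` all_rules cs x. {y, Box y})"
    unfolding red_items_def const_part_def root_part_def input_part_def end_part_def all_rules_def
    by auto
  show "G E \<in> set (red_shared cs P ?n)" by (simp add: red_shared_def)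
  show "I (Label c) i \<in> set (red_shared cs P ?n)" if "i < P" for c i
  proof -
    have "I (Label c) i \<in> set (label_atoms i)" by (simp add: label_atoms_def)
    then have "I (Label c) i \<in> set (concat (map label_atoms [0..<P]))" using that by fastforce
    then show ?thesis unfolding red_shared_def by simp
  qed
  show "a = G E \<or> label_atom a" if "a \<in> set (red_shared cs P ?n)" for a
    using that by (auto simp: red_shared_def label_atoms_def)
  let ?A = "tile ` set cs \<union> mark ` {..?n}"
  have A: "?A \<subseteq> set (red_shared cs P ?n) \<inter> Collect tile_atom"
    by (auto simp: red_shared_def le_less)
  show "set (a # bs) \<subseteq> set (red_shared cs P ?n) \<inter> Collect tile_atom" if "(s, a, bs) \<in> all_rules cs x" for s a bs
  proof -
    from that consider "(s, a, bs) \<in> set (const_rules cs)" | j where "j < ?n" "(s, a, bs) = input_rule j"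
      | "(s, a, bs) = end_rule cs ?n"
      by (auto simp: all_rules_def)
    then have "set (a # bs) \<subseteq> ?A"
    proof cases
      case 1
      then obtain c where "c \<in> set cs" "a = tile c" "bs = [] \<or> bs = [tile c] \<or> (\<exists>f. bs = map tile (filter f cs))"
        unfolding const_rules_def by fastforce
      then show ?thesis by auto
    qed (auto simp: input_rule_def end_rule_def)
    then show ?thesis using A by (rule subset_trans)
  qed
  show "set (as @ bs) \<subseteq> set (red_shared cs P ?n) \<inter> Collect tile_atom" if "(as, bs) \<in> all_clauses cs x" for as bs
  proof -
    have "set (as @ bs) \<subseteq> ?A"
      using that by (auto simp: all_clauses_def const_clauses_def input_clause_def)
    then show ?thesis using A by (rule subset_trans)
  qed
  \<comment> \<open>On the diagonal pair of \<open>z\<close> with itself the zero test for time ends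
    in one of its two states.\<close>
  show "\<exists>u s. reaches u s \<and> map fst u = z" if "length z = P" for z
    using reaches_time[of "zip z z"] by (intro exI[of _ "zip z z"]) auto
qed

theorem theorem4p1:
  shows "hard_for coNExpTime (interpolant_existence wK4)"
  unfolding hard_for_def
proof
  fix A assume "A \<in> coNExpTime"
  then obtain M p where M: "decides_in_time M (\<lambda>n. 2 ^ poly p n) (- A)"
    by (auto simp: coNExpTime_def NExpTime_def)
  then have wf: "wf_machine M" by (simp add: decides_in_time_def)
  obtain cs where cs: "set cs = cells M" using finite_list[OF finite_cells[OF wf]] by blast
  \<comment> \<open>The summands make \<open>2 ^ (P - 1)\<close> equal to four times
    \<open>2 ^ poly p n * 2 ^ n\<close>, which exceeds both the successor of the time bound and the
    input length \<open>n\<close>.\<close>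
  define q where "q = p + [:3, 1:]"
  have q: "poly q n = poly p n + n + 3" for n by (simp add: q_def)
  have "x \<in> A \<longleftrightarrow> generate q (red_blocks cs) x \<in> interpolant_existence wK4" for x
  proof -
    define P where "P = poly q (length x)"
    interpret gadget P edges starts "all_rules cs x" "all_clauses cs x" "red_items cs P x"
      "red_shared cs P (length x)"
      by (rule gadget_reduction) (simp add: P_def q)
    have P: "P - 1 = poly p (length x) + length x + 2" by (simp add: P_def q)
    have two: "(2::nat) ^ (P - 1) = 4 * (2 ^ poly p (length x) * 2 ^ length x)"
      unfolding P by (simp add: power_add)
    have "(\<exists>T. solves P edges starts (all_rules cs x) (all_clauses cs x) T) \<longleftrightarrow> accepts M x"
    proof (rule solves_iff_accepts[OF wf cs])
      show "n \<le> 2 ^ poly p (length x)" if "(step M ^^ n) (init x) c" for n c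
        using M that unfolding decides_in_time_def by blast
      have pos: "1 \<le> (2::nat) ^ poly p (length x)" "1 \<le> (2::nat) ^ length x" by simp_all
      then have "(2::nat) ^ poly p (length x) \<le> 2 ^ poly p (length x) * 2 ^ length x"
        "(2::nat) ^ length x \<le> 2 ^ poly p (length x) * 2 ^ length x"
        by simp_all
      moreover have "length x < 2 ^ length x" by (rule less_exp)
      ultimately show "Suc (2 ^ poly p (length x)) < 2 ^ (P - 1)" "length x \<le> 2 ^ (P - 1)"
        unfolding two using pos by linarith+
    qed (use P_pos in simp)
    \<comment> \<open>\<open>M\<close> decides the complement of \<open>A\<close>, and interpolants
      exist exactly when there is no solution; the two negations cancel.\<close>
    also have "accepts M x \<longleftrightarrow> x \<notin> A"
      using M unfolding decides_in_time_def accepts_def by blast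
    finally have "x \<in> A \<longleftrightarrow> (\<exists>\<iota>. interpolant wK4 lhs rhs \<iota>)" using interpolant_iff by blast
    also have "\<dots> \<longleftrightarrow> encode lhs @ encode rhs \<in> interpolant_existence wK4"
      by (auto simp: interpolant_existence_def encode_pair_inject)
    also have "encode lhs @ encode rhs = generate q (red_blocks cs) x"
      using generate_red_blocks[of q x P cs]
      by (simp add: P_def[symmetric] lhs_def rhs_def trivial_def[abs_def])
    finally show ?thesis .
  qed
  then show "polytime_reducible A (interpolant_existence wK4)"
    unfolding polytime_reducible_def using polytime_generate by blast
qed

end
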